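(* Assume the cavity $\mathcal C_0$ is convex. A quadruple $(\varrho_s,\mathbf v_s,\omega_s,\mathbf g_s)$, with $\mathbf u_s:=\mathbf v_s+\omega_s\mathbf e_3\times\mathbf x$, is a renormalized weak solution of the steady-state problem (defined in the context) if and only if there is $\vartheta_0\in[0,2\pi)$ such that, with $\mathbb Q_0$ the rotation by angle $\vartheta_0$ about $\mathbf e_3$ and $\mathbf y=\mathbb Q_0\mathbf x$, the following hold: (i) $\omega_s=0$ and $\mathbf u_s\equiv\mathbf 0$. (ii) $\varrho_s(\mathbf x)=r_s(y_1)$ for $\mathbf x\in\mathcal C_0$, where $$r_s(y_1)=\left[\left(\frac{\gamma-1}{a\gamma}\,g\,y_1+c\right)_+\right]^{\frac1{\gamma-1}},$$ and $\hat{\mathbf g}_s:=\mathbb Q_0\mathbf g_s=g\,\mathbf e_1$. Here the constant $c\in\mathbb R$ is determined by $\int_{\mathcal C_{eq}}r_s(y_1)\,dy=M$. (iii) $\mathbb Q_0$ is such that the center of mass $C$ of the whole system lies in the vertical plane $\mathsf V=\mathrm{span}(\mathbf e_1,\mathbf e_3)$ containing the rotation axis, precisely at the point whose position vector $\mathbf y_C=\overrightarrow{OC}$ in the inertial frame is $$\mathbf y_C=\frac1{\mathcal M}\left[\left(\int_{\mathcal C_{eq}}r_s(y_1)y_1\,dy+\int_{\mathscr B_{eq}}r_{\mathscr B}(\mathbf y)\,y_1\,dy\right)\mathbf e_1+\left(\int_{\mathcal C_{eq}}r_s(y_1)y_3\,dy\right)\mathbf e_3\right].$$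
   Context: Setting. $\mathcal C_0\subset\mathbb R^3$ (the cavity, filled with fluid) is an open simply connected domain, completely surrounded by a rigid body $\mathscr B_0$: $\partial\mathcal C_0\subset\mathscr B_0$, $\mathcal C_0\cap\mathscr B_0=\emptyset$, and $\mathcal S_0:=\mathscr B_0\cup\mathcal C_0$ is bounded, simply connected and open. The body has a prescribed density $\varrho_{\mathscr B}$ on $\mathscr B_0$ and mass $m$, and rotates about the horizontal axis $\mathsf a$ through the origin $O$ in direction $\mathbf e_3$. $O$ is the orthogonal projection on $\mathsf a$ of the center of mass $G$ of the body, so that $\int_{\mathscr B_0}\varrho_{\mathscr B}\,x_3\,dx=0$. In the inertial frame, $\mathbf e_1$ is the downward vertical. Constants: $g>0$ (magnitude of gravity), $a>0$, $\gamma>3/2$, $\mu>0$, $\lambda\ge0$, and $M>0$ (prescribed fluid mass); $\mathcal M:=M+m$. Further $p(\varrho)=a\varrho^\gamma$ and $\mathbb S(\mathbf u)=2\mu\mathbb D(\mathbf u)+(\lambda-\frac23\mu)\mathbb I\,\mathrm{div}\,\mathbf u$, with $\mathbb D(\mathbf u)$ the symmetric gradient. For a fluid density $\varrho$ on $\mathcal C_0$, $\hat\varrho$ denotes the function on $\mathcal S_0$ equal to $\varrho$ on $\mathcal C_0$ and to $\varrho_{\mathscr B}$ on $\mathscr B_0$. $(\cdot)_+$ is the positive part. Steady-state problem. A renormalized weak solution is a quadruple $(\varrho,\mathbf v,\omega,\mathbf g)$ with $\varrho\in L^\gamma(\mathcal C_0)$, $\varrho\ge0$, $\mathbf v\in W^{1,2}_0(\mathcal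 C_0;\mathbb R^3)$, $\omega\in\mathbb R$, $\mathbf g\in\mathbb R^2\times\{0\}$ such that, with $\mathbf u=\mathbf v+\omega\mathbf e_3\times\mathbf x$ (so $\mathbf u=\omega\mathbf e_3\times\mathbf x$ on $\partial\mathcal C_0$): - $\mathrm{div}(\varrho\mathbf v\otimes\mathbf u)+\varrho\,\omega\,\mathbf e_3\times\mathbf u+\nabla p(\varrho)-\mathrm{div}\,\mathbb S(\mathbf u)=\varrho\,\mathbf g$ and $\mathrm{div}(\varrho\mathbf v)=0$ in the sense of distributions in $\mathcal C_0$, where $(\mathrm{div}(\varrho\mathbf v\otimes\mathbf u))_j=\sum_i\partial_i(\varrho v_iu_j)$; - $\mathbf e_3\cdot\big[\big(\int_{\mathcal S_0}\hat\varrho\,\mathbf x\,dx\big)\times\mathbf g\big]=0$ and $\omega\,\mathbf e_3\times\mathbf g=\mathbf 0$; - $\mathrm{div}(b(\varrho)\mathbf v)+(\varrho b'(\varrho)-b(\varrho))\,\mathrm{div}\,\mathbf v=0$ in the sense of distributions for all $b\in C^1(\mathbb R)$ for which the terms are integrable; - $\int_{\mathcal C_0}\varrho\,dx=M$ and $|\mathbf g|=g$; - the energy inequality, which for time-independent solutions reads $\int_{\mathcal C_0}\mathbb S(\mathbf v):\nabla\mathbf v\,dx\le0$. Notation for the equilibrium configuration. $\mathbb Q_0=\begin{pmatrix}\cos\vartheta_0&-\sin\vartheta_0&0\\ \sin\vartheta_0&\cos\vartheta_0&0\\0&0&1\end{pmatrix}$, $\mathcal C_{eq}:=\mathbb Q_0\mathcal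 C_0$, $\mathscr B_{eq}:=\mathbb Q_0\mathscr B_0$, and $r_{\mathscr B}(\mathbf y):=\varrho_{\mathscr B}(\mathbb Q_0^\top\mathbf y)$ is the body density in inertial coordinates. The center of mass $C$ of the whole system in this configuration is the point with $\overrightarrow{OC}=\frac1{\mathcal M}\left(\int_{\mathcal C_{eq}}r_s(y_1)\mathbf y\,dy+\int_{\mathscr B_{eq}}r_{\mathscr B}(\mathbf y)\mathbf y\,dy\right)$. *)

theory Defs
  imports "HOL-Analysis.Analysis"
begin

text \<open>
  Elements of Lebesgue and Sobolev spaces over a set \<open>\<Omega>\<close> are represented by functions on the whole
  space whose values outside \<open>\<Omega>\<close> are irrelevant; identities between them hold almost everywhere.
  All measure theory is with respect to the (complete) Lebesgue measure, so that changing a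
  representative on a null set does not affect measurability.
\<close>

subsection \<open>Test functions and distributions\<close>

definition partial_deriv :: "'n::finite \<Rightarrow> (real^'n \<Rightarrow> real) \<Rightarrow> real^'n \<Rightarrow> real" where
  "partial_deriv i f x = frechet_derivative f (at x) (axis i 1)"

primrec Ck :: "nat \<Rightarrow> (real^'n::finite \<Rightarrow> real) \<Rightarrow> bool" where
  "Ck 0 f \<longleftrightarrow> continuous_on UNIV f"
| "Ck (Suc k) f \<longleftrightarrow> f differentiable_on UNIV \<and> (\<forall>i. Ck k (partial_deriv i f))"

definition test_function :: "(real^'n::finite) set \<Rightarrow> (real^'n \<Rightarrow> real) \<Rightarrow> bool" where
  "test_function \<Omega> \<phi> \<longleftrightarrow>
     (\<forall>k. Ck k \<phi>) \<and> compact (closure {x. \<phi> x \<noteq> 0}) \<and> closure {x. \<phi> x \<noteq> 0} \<subseteq> \<Omega>"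

definition locally_integrable ::
  "(real^'n::finite) set \<Rightarrow> (real^'n \<Rightarrow> 'b::{banach,second_countable_topology}) \<Rightarrow> bool" where
  "locally_integrable \<Omega> f \<longleftrightarrow> (\<forall>K. compact K \<and> K \<subseteq> \<Omega> \<longrightarrow> integrable (lebesgue_on K) f)"

text \<open>Distributions are represented by their action on test functions.\<close>

definition regular_distr :: "(real^'n::finite) set \<Rightarrow> (real^'n \<Rightarrow> real) \<Rightarrow> (real^'n \<Rightarrow> real) \<Rightarrow> real" where
  "regular_distr \<Omega> f \<phi> = integral\<^sup>L (lebesgue_on \<Omega>) (\<lambda>x. f x * \<phi> x)"

definition distr_deriv ::
  "'n::finite \<Rightarrow> ((real^'n \<Rightarrow> real) \<Rightarrow> real) \<Rightarrow> (real^'n \<Rightarrow> real) \<Rightarrow> real" where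
  "distr_deriv i T \<phi> = - T (partial_deriv i \<phi>)"

definition distr_div :: "(real^'n::finite) set \<Rightarrow> (real^'n \<Rightarrow> real^'n) \<Rightarrow> (real^'n \<Rightarrow> real) \<Rightarrow> real" where
  "distr_div \<Omega> F \<phi> = (\<Sum>i\<in>UNIV. distr_deriv i (regular_distr \<Omega> (\<lambda>x. F x $ i)) \<phi>)"

subsection \<open>Lebesgue and Sobolev spaces\<close>

definition in_Lp :: "real \<Rightarrow> (real^'n::finite) set \<Rightarrow> (real^'n \<Rightarrow> real) \<Rightarrow> bool" where
  "in_Lp p \<Omega> f \<longleftrightarrow> f \<in> borel_measurable (lebesgue_on \<Omega>) \<and>
     integrable (lebesgue_on \<Omega>) (\<lambda>x. \<bar>f x\<bar> powr p)"

definition has_weak_partial ::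
  "(real^'n::finite) set \<Rightarrow> 'n \<Rightarrow> (real^'n \<Rightarrow> real) \<Rightarrow> (real^'n \<Rightarrow> real) \<Rightarrow> bool" where
  "has_weak_partial \<Omega> i f h \<longleftrightarrow> locally_integrable \<Omega> f \<and> locally_integrable \<Omega> h \<and>
     (\<forall>\<phi>. test_function \<Omega> \<phi> \<longrightarrow>
        regular_distr \<Omega> h \<phi> = distr_deriv i (regular_distr \<Omega> f) \<phi>)"

text \<open>The choice is irrelevant: weak derivatives on an open set are unique almost everywhere.\<close>

definition weak_partial :: "(real^'n::finite) set \<Rightarrow> 'n \<Rightarrow> (real^'n \<Rightarrow> real) \<Rightarrow> real^'n \<Rightarrow> real" where
  "weak_partial \<Omega> i f = (SOME h. has_weak_partial \<Omega> i f h)"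

definition in_W12 :: "(real^'n::finite) set \<Rightarrow> (real^'n \<Rightarrow> real) \<Rightarrow> bool" where
  "in_W12 \<Omega> f \<longleftrightarrow> in_Lp 2 \<Omega> f \<and> (\<forall>i. \<exists>h. has_weak_partial \<Omega> i f h \<and> in_Lp 2 \<Omega> h)"

definition W12_norm :: "(real^'n::finite) set \<Rightarrow> (real^'n \<Rightarrow> real) \<Rightarrow> real" where
  "W12_norm \<Omega> f = sqrt (integral\<^sup>L (lebesgue_on \<Omega>) (\<lambda>x. (f x)\<^sup>2) +
     (\<Sum>i\<in>UNIV. integral\<^sup>L (lebesgue_on \<Omega>) (\<lambda>x. (weak_partial \<Omega> i f x)\<^sup>2)))"

text \<open>The closure of the test functions in the norm of \<open>W\<^sup>1\<^sup>,\<^sup>2\<close>.\<close>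

definition in_W12_0 :: "(real^'n::finite) set \<Rightarrow> (real^'n \<Rightarrow> real) \<Rightarrow> bool" where
  "in_W12_0 \<Omega> f \<longleftrightarrow> in_W12 \<Omega> f \<and>
     (\<exists>\<phi>. (\<forall>n::nat. test_function \<Omega> (\<phi> n)) \<and>
          (\<lambda>n. W12_norm \<Omega> (\<lambda>x. f x - \<phi> n x)) \<longlonglongrightarrow> 0)"

text \<open>Jacobian convention: row \<open>i\<close>, column \<open>j\<close> holds the \<open>j\<close>-th derivative of the \<open>i\<close>-th component.\<close>

definition weak_grad :: "(real^'n::finite) set \<Rightarrow> (real^'n \<Rightarrow> real^'n) \<Rightarrow> real^'n \<Rightarrow> real^'n^'n" where
  "weak_grad \<Omega> v x = (\<chi> i j. weak_partial \<Omega> j (\<lambda>y. v y $ i) x)"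

definition weak_div :: "(real^'n::finite) set \<Rightarrow> (real^'n \<Rightarrow> real^'n) \<Rightarrow> real^'n \<Rightarrow> real" where
  "weak_div \<Omega> v x = trace (weak_grad \<Omega> v x)"

subsection \<open>The steady-state problem\<close>

definition e1 :: "real^3" where "e1 = axis 1 1"
definition e3 :: "real^3" where "e3 = axis 3 1"

definition pressure :: "real \<Rightarrow> real \<Rightarrow> real \<Rightarrow> real" where
  "pressure a \<gamma> r = a * r powr \<gamma>"

definition stress :: "real \<Rightarrow> real \<Rightarrow> (real^3) set \<Rightarrow> (real^3 \<Rightarrow> real^3) \<Rightarrow> real^3 \<Rightarrow> real^3^3" where
  "stress \<mu> lam \<Omega> u x =
     (let D = (1 / 2) *\<^sub>R (weak_grad \<Omega> u x + transpose (weak_grad \<Omega> u x))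
      in (2 * \<mu>) *\<^sub>R D + ((lam - 2 / 3 * \<mu>) * weak_div \<Omega> u x) *\<^sub>R mat 1)"

definition full_velocity :: "(real^3 \<Rightarrow> real^3) \<Rightarrow> real \<Rightarrow> real^3 \<Rightarrow> real^3" where
  "full_velocity v \<omega> x = v x + \<omega> *\<^sub>R cross3 e3 x"

definition total_density :: "(real^3) set \<Rightarrow> (real^3 \<Rightarrow> real) \<Rightarrow> (real^3 \<Rightarrow> real) \<Rightarrow> real^3 \<Rightarrow> real" where
  "total_density \<C>\<^sub>0 \<rho> \<rho>\<^sub>B x = (if x \<in> \<C>\<^sub>0 then \<rho> x else \<rho>\<^sub>B x)"

text \<open>
  Local integrability of the terms is part of the meaning of an equation in the sense of
  distributions; it is stated explicitly because the integral of a non-integrable function is 0 here.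
\<close>

definition momentum_equation ::
  "(real^3) set \<Rightarrow> real \<Rightarrow> real \<Rightarrow> real \<Rightarrow> real \<Rightarrow>
   (real^3 \<Rightarrow> real) \<Rightarrow> (real^3 \<Rightarrow> real^3) \<Rightarrow> real \<Rightarrow> real^3 \<Rightarrow> bool" where
  "momentum_equation \<C>\<^sub>0 a \<gamma> \<mu> lam \<rho> v \<omega> gv \<longleftrightarrow>
     (let u = full_velocity v \<omega>;
          conv = (\<lambda>j x. (\<rho> x * u x $ j) *\<^sub>R v x);
          rot = (\<lambda>j x. (\<rho> x * \<omega>) * cross3 e3 (u x) $ j);
          p = (\<lambda>x. pressure a \<gamma> (\<rho> x));
          visc = (\<lambda>j x. column j (stress \<mu> lam \<C>\<^sub>0 u x));
          force = (\<lambda>j x. \<rho> x * gv $ j)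
      in \<forall>j. locally_integrable \<C>\<^sub>0 (conv j) \<and> locally_integrable \<C>\<^sub>0 (rot j) \<and>
             locally_integrable \<C>\<^sub>0 p \<and> locally_integrable \<C>\<^sub>0 (visc j) \<and>
             locally_integrable \<C>\<^sub>0 (force j) \<and>
             (\<forall>\<phi>. test_function \<C>\<^sub>0 \<phi> \<longrightarrow>
                distr_div \<C>\<^sub>0 (conv j) \<phi> + regular_distr \<C>\<^sub>0 (rot j) \<phi>
                + distr_deriv j (regular_distr \<C>\<^sub>0 p) \<phi> - distr_div \<C>\<^sub>0 (visc j) \<phi>
                = regular_distr \<C>\<^sub>0 (force j) \<phi>))"

definition continuity_equation ::
  "(real^3) set \<Rightarrow> (real^3 \<Rightarrow> real) \<Rightarrow> (real^3 \<Rightarrow> real^3) \<Rightarrow> bool" where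
  "continuity_equation \<C>\<^sub>0 \<rho> v \<longleftrightarrow> locally_integrable \<C>\<^sub>0 (\<lambda>x. \<rho> x *\<^sub>R v x) \<and>
     (\<forall>\<phi>. test_function \<C>\<^sub>0 \<phi> \<longrightarrow> distr_div \<C>\<^sub>0 (\<lambda>x. \<rho> x *\<^sub>R v x) \<phi> = 0)"

definition renormalized_continuity ::
  "(real^3) set \<Rightarrow> (real^3 \<Rightarrow> real) \<Rightarrow> (real^3 \<Rightarrow> real^3) \<Rightarrow> bool" where
  "renormalized_continuity \<C>\<^sub>0 \<rho> v \<longleftrightarrow>
     (\<forall>b::real \<Rightarrow> real.
        (let flux = (\<lambda>x. b (\<rho> x) *\<^sub>R v x);
             src = (\<lambda>x. (\<rho> x * deriv b (\<rho> x) - b (\<rho> x)) * weak_div \<C>\<^sub>0 v x)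
         in b C1_differentiable_on UNIV \<and>
            integrable (lebesgue_on \<C>\<^sub>0) flux \<and> integrable (lebesgue_on \<C>\<^sub>0) src \<longrightarrow>
            (\<forall>\<phi>. test_function \<C>\<^sub>0 \<phi> \<longrightarrow>
               distr_div \<C>\<^sub>0 flux \<phi> + regular_distr \<C>\<^sub>0 src \<phi> = 0)))"

definition renormalized_weak_solution ::
  "(real^3) set \<Rightarrow> (real^3) set \<Rightarrow> (real^3 \<Rightarrow> real) \<Rightarrow>
   real \<Rightarrow> real \<Rightarrow> real \<Rightarrow> real \<Rightarrow> real \<Rightarrow> real \<Rightarrow>
   (real^3 \<Rightarrow> real) \<Rightarrow> (real^3 \<Rightarrow> real^3) \<Rightarrow> real \<Rightarrow> real^3 \<Rightarrow> bool" where
  "renormalized_weak_solution \<C>\<^sub>0 \<B>\<^sub>0 \<rho>\<^sub>B g a \<gamma> \<mu> lam M \<rho> v \<omega> gv \<longleftrightarrow>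
     in_Lp \<gamma> \<C>\<^sub>0 \<rho> \<and> (AE x in lebesgue_on \<C>\<^sub>0. 0 \<le> \<rho> x) \<and>
     (\<forall>i. in_W12_0 \<C>\<^sub>0 (\<lambda>x. v x $ i)) \<and> gv $ 3 = 0 \<and>
     momentum_equation \<C>\<^sub>0 a \<gamma> \<mu> lam \<rho> v \<omega> gv \<and>
     continuity_equation \<C>\<^sub>0 \<rho> v \<and>
     e3 \<bullet> cross3 (integral\<^sup>L (lebesgue_on (\<B>\<^sub>0 \<union> \<C>\<^sub>0)) (\<lambda>x. total_density \<C>\<^sub>0 \<rho> \<rho>\<^sub>B x *\<^sub>R x)) gv = 0 \<and>
     \<omega> *\<^sub>R cross3 e3 gv = 0 \<and>
     renormalized_continuity \<C>\<^sub>0 \<rho> v \<and>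
     integral\<^sup>L (lebesgue_on \<C>\<^sub>0) \<rho> = M \<and> norm gv = g \<and>
     integral\<^sup>L (lebesgue_on \<C>\<^sub>0) (\<lambda>x. stress \<mu> lam \<C>\<^sub>0 v x \<bullet> weak_grad \<C>\<^sub>0 v x) \<le> 0"

subsection \<open>The equilibrium configuration\<close>

definition rot_e3 :: "real \<Rightarrow> real^3^3" where
  "rot_e3 \<theta> = vector [vector [cos \<theta>, - sin \<theta>, 0], vector [sin \<theta>, cos \<theta>, 0], vector [0, 0, 1]]"

definition rest_density :: "real \<Rightarrow> real \<Rightarrow> real \<Rightarrow> real \<Rightarrow> real \<Rightarrow> real" where
  "rest_density g a \<gamma> c s = (max 0 ((\<gamma> - 1) / (a * \<gamma>) * g * s + c)) powr (1 / (\<gamma> - 1))"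

definition center_of_mass ::
  "(real^3) set \<Rightarrow> (real^3) set \<Rightarrow> (real^3 \<Rightarrow> real) \<Rightarrow> (real^3 \<Rightarrow> real) \<Rightarrow> real \<Rightarrow> real^3" where
  "center_of_mass Ceq Beq r_fluid r_body \<M> = (1 / \<M>) *\<^sub>R
     (integral\<^sup>L (lebesgue_on Ceq) (\<lambda>y. r_fluid y *\<^sub>R y) +
      integral\<^sup>L (lebesgue_on Beq) (\<lambda>y. r_body y *\<^sub>R y))"

end

theory Submission
  imports Defs
begin

text \<open>
  The dissipation is a nonnegative quadratic form in the velocity gradient. For test fields, swapping
  derivatives under the integral shows that it controls the full gradient, so by density and the
  Poincare inequality zero dissipation forces \<open>v = 0\<close>; the condition
  \<open>\<omega> e\<^sub>3 \<times> g = 0\<close> then gives \<open>\<omega> = 0\<close>.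

  What remains is the distributional equation \<open>\<nabla> (a \<rho>\<^sup>\<gamma>) = \<rho> g\<close> with \<open>\<rho> \<ge> 0\<close>. Testing it against
  translates of a bump shows that \<open>\<rho>(y) \<le> \<rho>(y + k)\<close> for almost all \<open>y\<close> whenever \<open>k \<bullet> g \<ge> 0\<close>
  (this is where convexity of the cavity enters). By Fubini, \<open>\<rho>\<close> agrees off a null set with a monotone
  function \<open>r\<close> of the height \<open>s\<close>, and the equation squeezes the increments of \<open>a r\<^sup>\<gamma>\<close>
  between multiples of \<open>r\<close>. Hence \<open>a r\<^sup>\<gamma>\<close> is differentiable with derivative \<open>g r\<close>, so that
  \<open>r\<^sup>\<gamma>\<^sup>-\<^sup>1\<close> is affine where it is positive; it cannot return to zero because \<open>r\<close> is monotone.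

  The torque condition is the second component of the rotated centre of mass.
\<close>

subsection \<open>Smooth functions and bumps\<close>

text \<open>The density is only an \<open>L^\<gamma>\<close> function, so the set where it is
  positive need not be open and the equation cannot be divided by the density there; even on an open
  set each component could carry its own constant. Monotonicity removes both obstacles. For a test
  function \<open>\<phi> \<ge> 0\<close> the integral of \<open>P x * \<phi> (x - t k)\<close> has
  \<open>t\<close>-derivative \<open>k \<bullet> g\<close> times a nonnegative integral, and
  convexity keeps the support of the translate in the cavity for \<open>t\<close> between 0 and 1. A
  horizontal \<open>k\<close> is admissible together with \<open>-k\<close>, so the density depends
  on the height alone, and the heights that carry fluid form an upper interval, on which one
  constant serves. The exceptional null set depends on \<open>k\<close>; Fubini replaces it by a
  single good set. For the velocity, nonnegativity of the form is not coercivity: it vanishes on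
  antisymmetric gradients and, if \<open>lam = 0\<close>, on multiples of the identity. Only
  integration by parts for compactly supported fields bounds the dissipation from below by
  \<open>\<mu>\<close> times the integral of the squared full gradient.\<close>

lemma has_derivative_partial_deriv:
  fixes f :: "real^'n::finite \<Rightarrow> real"
  assumes "f differentiable (at x)"
  shows "(f has_derivative (\<lambda>k. \<Sum>i\<in>UNIV. k $ i * partial_deriv i f x)) (at x)"
proof -
  have fd: "(f has_derivative frechet_derivative f (at x)) (at x)"
    using assms frechet_derivative_works by blast
  then have lin: "linear (frechet_derivative f (at x))"
    by (rule has_derivative_linear)
  have "frechet_derivative f (at x) k = (\<Sum>i\<in>UNIV. k $ i * partial_deriv i f x)" for k
  proof -
    have "frechet_derivative f (at x) k = frechet_derivative f (at x) (\<Sum>i\<in>UNIV. k $ i *\<^sub>R axis i 1)"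
      by (simp add: basis_expansion flip: scalar_mult_eq_scaleR)
    also have "\<dots> = (\<Sum>i\<in>UNIV. k $ i * partial_deriv i f x)"
      by (simp add: linear_sum[OF lin] linear_scale[OF lin] partial_deriv_def)
    finally show ?thesis .
  qed
  then have "frechet_derivative f (at x) = (\<lambda>k. \<Sum>i\<in>UNIV. k $ i * partial_deriv i f x)"
    by blast
  with fd show ?thesis by simp
qed

lemma partial_deriv_eqI:
  assumes "(f has_derivative f') (at x)"
  shows "partial_deriv i f x = f' (axis i 1)"
  using frechet_derivative_at[OF assms] by (simp add: partial_deriv_def)

lemma Ck_differentiable: "Ck (Suc k) f \<Longrightarrow> f differentiable (at x)"
  by (simp add: differentiable_on_def)

text \<open>\<open>Ck\<close> recurses through \<open>partial_deriv\<close>, an abstract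
  \<open>frechet_derivative\<close> without a formula of its own. Naming candidates \<open>D\<close>
  for the partials identifies them and lowers the order by one, which is the induction step of the
  closure lemmas below.\<close>

lemma Ck_SucI:
  fixes f :: "real^'n::finite \<Rightarrow> real"
  assumes "\<And>x. (f has_derivative (\<lambda>k. \<Sum>i\<in>UNIV. k $ i * D i x)) (at x)" "\<And>i. Ck k (D i)"
  shows "Ck (Suc k) f" "partial_deriv i f = D i"
proof -
  have eq: "partial_deriv i f = D i" for i
  proof
    fix x
    have "(\<Sum>j\<in>UNIV. axis i 1 $ j * D j x) = (\<Sum>j\<in>UNIV. if j = i then D j x else 0)"
      by (rule sum.cong) (auto simp: axis_def)
    then show "partial_deriv i f x = D i x"
      using partial_deriv_eqI[OF assms(1), of i x] by simp
  qed
  then show "partial_deriv i f = D i" .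
  have "f differentiable (at x)" for x using assms(1) differentiableI by blast
  then show "Ck (Suc k) f"
    by (auto simp: differentiable_on_def eq assms(2) differentiable_at_withinI)
qed

lemma Ck_Suc_imp: "Ck (Suc k) f \<Longrightarrow> Ck k f"
proof (induction k arbitrary: f)
  case 0
  then show ?case by (auto intro: differentiable_imp_continuous_on)
next
  case (Suc k)
  then show ?case by (metis Ck.simps(2))
qed

lemma Ck_mono: "Ck k f \<Longrightarrow> j \<le> k \<Longrightarrow> Ck j f"
  by (induction k) (auto simp del: Ck.simps(2) dest: Ck_Suc_imp simp: le_Suc_eq)

lemma Ck_continuous: "Ck k f \<Longrightarrow> continuous_on UNIV f"
  using Ck_mono[of k f 0] by simp

lemma Ck_const: "Ck k (\<lambda>x::real^'n::finite. c)"
proof (induction k arbitrary: c)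
  case (Suc k)
  show ?case
    by (rule Ck_SucI(1)[where D = "\<lambda>i x. 0"]) (auto intro: Suc)
qed simp

lemma Ck_add:
  fixes f g :: "real^'n::finite \<Rightarrow> real"
  assumes "Ck k f" "Ck k g" shows "Ck k (\<lambda>x. f x + g x)"
  using assms
proof (induction k arbitrary: f g)
  case (Suc k)
  show ?case
    by (rule Ck_SucI(1)[where D = "\<lambda>i x. partial_deriv i f x + partial_deriv i g x"])
      (use Suc in \<open>auto intro!: derivative_eq_intros has_derivative_partial_deriv Ck_differentiable
        simp: algebra_simps sum.distrib simp del: Ck.simps(2) intro: Suc.IH\<close>, auto)
qed (auto intro: continuous_intros)

lemma Ck_mult_partial:
  fixes f g :: "real^'n::finite \<Rightarrow> real"
  assumes "\<And>x. f differentiable (at x)" "\<And>x. g differentiable (at x)"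
  shows "((\<lambda>x. f x * g x) has_derivative
    (\<lambda>k. \<Sum>i\<in>UNIV. k $ i * (f x * partial_deriv i g x + partial_deriv i f x * g x))) (at x)"
  by (rule has_derivative_eq_rhs[OF has_derivative_mult[OF
      has_derivative_partial_deriv[OF assms(1)] has_derivative_partial_deriv[OF assms(2)]]])
    (auto simp: algebra_simps sum.distrib sum_distrib_left)

lemma Ck_mult:
  fixes f g :: "real^'n::finite \<Rightarrow> real"
  assumes "Ck k f" "Ck k g" shows "Ck k (\<lambda>x. f x * g x)"
  using assms
proof (induction k arbitrary: f g)
  case (Suc k)
  show ?case
  proof (rule Ck_SucI(1)[OF Ck_mult_partial])
    show "Ck k (\<lambda>x. f x * partial_deriv i g x + partial_deriv i f x * g x)" for i
      using Suc.prems by (intro Ck_add Suc.IH) (auto dest: Ck_Suc_imp simp del: Ck.simps(2), auto)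
  qed (use Suc.prems Ck_differentiable in blast)+
qed (auto intro: continuous_intros)

lemma Ck_sum:
  fixes f :: "'a \<Rightarrow> real^'n::finite \<Rightarrow> real"
  assumes "\<And>i. i \<in> A \<Longrightarrow> Ck k (f i)" shows "Ck k (\<lambda>x. \<Sum>i\<in>A. f i x)"
  using assms by (induction A rule: infinite_finite_induct) (auto intro: Ck_add Ck_const)

lemma Ck_nth: "Ck k (\<lambda>x::real^'n::finite. x $ j)"
proof (cases k)
  case (Suc l)
  show ?thesis unfolding Suc
    by (rule Ck_SucI(1)[where D = "\<lambda>i x. if i = j then 1 else 0"])
      (auto intro!: bounded_linear_imp_has_derivative bounded_linear_vec_nth
        simp: Ck_const if_distrib[where f = "(*) _"] cong: if_cong)
qed (auto intro: continuous_intros)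

text \<open>The index set \<open>S\<close> lists a family of functions that is closed under differentiation up to linear combinations.\<close>

lemma Ck_compose_tower:
  fixes q :: "real^'n::finite \<Rightarrow> real" and H :: "'s \<Rightarrow> real \<Rightarrow> real"
  assumes H: "\<And>s. s \<in> S \<Longrightarrow> \<exists>(A :: nat set) c \<sigma>. finite A \<and> \<sigma> ` A \<subseteq> S \<and>
      (\<forall>t. (H s has_real_derivative (\<Sum>a\<in>A. c a * H (\<sigma> a) t)) (at t))"
    and q: "Ck k q" and "s \<in> S"
  shows "Ck k (\<lambda>x. H s (q x))"
  using q \<open>s \<in> S\<close>
proof (induction k arbitrary: s)
  case 0
  obtain A :: "nat set" and c \<sigma> where der: "\<And>t. (H s has_real_derivative (\<Sum>a\<in>A. c a * H (\<sigma> a) t)) (at t)"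
    using H[OF 0(2)] by metis
  have "continuous_on UNIV (H s)"
    using der DERIV_isCont continuous_at_imp_continuous_on by blast
  then show ?case
    using 0 continuous_on_compose2[of UNIV "H s" UNIV q] by simp
next
  case (Suc k)
  obtain A :: "nat set" and c \<sigma> where A: "\<sigma> ` A \<subseteq> S" 
    and der: "\<And>t. (H s has_real_derivative (\<Sum>a\<in>A. c a * H (\<sigma> a) t)) (at t)"
    using H[OF Suc(3)] by metis
  define S' where "S' = (\<lambda>t. \<Sum>a\<in>A. c a * H (\<sigma> a) t)"
  have der': "(H s has_derivative (*) (S' t)) (at t)" for t
    using der[of t] by (simp add: has_field_derivative_def S'_def)
  show ?case
  proof (rule Ck_SucI(1)[where D = "\<lambda>i x. S' (q x) * partial_deriv i q x"])
    show "((\<lambda>x. H s (q x)) has_derivative (\<lambda>k. \<Sum>i\<in>UNIV. k $ i * (S' (q x) * partial_deriv i q x))) (at x)" for x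
      by (rule has_derivative_eq_rhs[OF has_derivative_compose[OF
        has_derivative_partial_deriv[OF Ck_differentiable[OF Suc(2)]] der']])
       (simp add: sum_distrib_left mult_ac)
    show "Ck k (\<lambda>x. S' (q x) * partial_deriv i q x)" for i
      unfolding S'_def
      using A Suc.prems by (intro Ck_mult Ck_sum Ck_const Suc.IH) (auto dest: Ck_Suc_imp simp del: Ck.simps(2), auto)
  qed
qed

lemma Ck_exp_compose:
  fixes q :: "real^'n::finite \<Rightarrow> real"
  assumes "Ck k q"
  shows "Ck k (\<lambda>x. exp (q x))"
proof -
  have "\<exists>(A :: nat set) c \<sigma>. finite A \<and> \<sigma> ` A \<subseteq> UNIV \<and>
      (\<forall>t. (exp has_real_derivative (\<Sum>a\<in>A. c a * exp t)) (at t))"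
    by (intro exI[of _ "{0::nat}"] exI[of _ "\<lambda>_. 1"]) (auto intro!: derivative_eq_intros)
  then show ?thesis
    using Ck_compose_tower[of "UNIV :: unit set" "\<lambda>_. exp" k q "()"] assms by simp
qed

text \<open>The factor \<open>t\<^sup>-\<^sup>n\<close> makes the family closed under differentiation.\<close>

definition flat_exp :: "nat \<Rightarrow> real \<Rightarrow> real" where
  "flat_exp n t = (if t > 0 then (1 / t) ^ n * exp (- 1 / t) else 0)"

text \<open>From the right \<open>u = 1 / t\<close> tends to infinity and \<open>exp u\<close>
  outgrows every power of \<open>u\<close>; from the left the function is zero.\<close>

lemma flat_exp_tendsto_0: "((\<lambda>t. flat_exp n t) \<longlongrightarrow> 0) (at 0)"
proof -
  have "((\<lambda>t::real. (1 / t) ^ n / exp (1 / t)) \<longlongrightarrow> 0) (at_right 0)"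
    using filterlim_compose[OF tendsto_power_div_exp_0[of n] filterlim_inverse_at_top_right]
    by (simp add: inverse_eq_divide)
  then have "((\<lambda>t. flat_exp n t) \<longlongrightarrow> 0) (at_right 0)"
    by (rule Lim_transform_eventually)
      (auto simp: eventually_at_right_less flat_exp_def exp_minus field_simps
        intro!: eventually_mono[OF eventually_at_right_less[of 0]])
  moreover have "((\<lambda>t. flat_exp n t) \<longlongrightarrow> 0) (at_left 0)"
    by (rule Lim_transform_eventually[OF tendsto_const])
      (auto simp: flat_exp_def eventually_at_left_field intro!: exI[of _ "-1"])
  ultimately show ?thesis
    by (simp add: filterlim_split_at)
qed

lemma flat_exp_deriv:
  "(flat_exp n has_real_derivative (flat_exp (n+2) t - of_nat n * flat_exp (n+1) t)) (at t)"
proof -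
  consider "t > 0" | "t < 0" | "t = 0" by linarith
  then show ?thesis
  proof cases
    case 1
    have "((\<lambda>t. (1 / t) ^ n * exp (- 1 / t)) has_real_derivative
      (flat_exp (n+2) t - of_nat n * flat_exp (n+1) t)) (at t)"
    \<comment> \<open>The power rule produces the exponent \<open>n - 1\<close>, so
      \<open>n = 0\<close> is treated apart.\<close>
    proof (cases n)
      case (Suc l)
      have d: "((\<lambda>t. 1 / t) has_real_derivative - (1 / t\<^sup>2)) (at t)"
        and e: "((\<lambda>t. exp (- 1 / t)) has_real_derivative exp (- 1 / t) * (1 / t\<^sup>2)) (at t)"
        using 1 by (auto intro!: derivative_eq_intros simp: power2_eq_square)
      show ?thesis
        by (rule DERIV_cong[OF DERIV_mult[OF DERIV_power[OF d, of n] e]])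
          (use 1 in \<open>simp add: Suc flat_exp_def power2_eq_square algebra_simps\<close>)
    qed (use 1 in \<open>auto intro!: derivative_eq_intros simp: flat_exp_def power2_eq_square\<close>)
    then show ?thesis
      by (rule has_field_derivative_transform_within_open[where S = "{0<..}"])
         (use 1 in \<open>auto simp: flat_exp_def\<close>)
  next
    case 2
    have "((\<lambda>t. 0) has_real_derivative (flat_exp (n+2) t - of_nat n * flat_exp (n+1) t)) (at t)"
      using 2 by (auto simp: flat_exp_def)
    then show ?thesis
      by (rule has_field_derivative_transform_within_open[where S = "{..<0}"])
         (use 2 in \<open>auto simp: flat_exp_def\<close>)
  next
    case 3
    \<comment> \<open>Dividing by \<open>h\<close> raises the exponent of \<open>1 / h\<close> by
      one, so the difference quotient at zero is \<open>flat_exp (Suc n)\<close>, whose limit is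
      known.\<close>
    have "((\<lambda>h. (flat_exp n (0 + h) - flat_exp n 0) / h) \<longlongrightarrow> 0) (at 0)"
      by (rule Lim_transform_eventually[OF flat_exp_tendsto_0[of "Suc n"]])
        (auto simp: flat_exp_def eventually_at_filter)
    then show ?thesis using 3 by (simp add: DERIV_def flat_exp_def)
  qed
qed

lemma Ck_flat_exp_compose:
  fixes q :: "real^'n::finite \<Rightarrow> real"
  assumes "Ck k q"
  shows "Ck k (\<lambda>x. flat_exp n (q x))"
proof -
  have "\<exists>(A :: nat set) c \<sigma>. finite A \<and> \<sigma> ` A \<subseteq> UNIV \<and>
      (\<forall>t. (flat_exp m has_real_derivative (\<Sum>a\<in>A. c a * flat_exp (\<sigma> a) t)) (at t))" for m
    by (intro exI[of _ "{0, Suc 0}"] exI[of _ "\<lambda>i. if i = 0 then 1 else - real m"]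
        exI[of _ "\<lambda>i. if i = 0 then m + 2 else m + 1"]) (use flat_exp_deriv in auto)
  then show ?thesis
    using Ck_compose_tower[of UNIV flat_exp k q n] assms by simp
qed

text \<open>The squared distance is a polynomial in the coordinates and therefore smooth also at the
  centre, where the distance itself is not.\<close>

definition bump :: "real^'n::finite \<Rightarrow> real \<Rightarrow> real^'n \<Rightarrow> real" where
  "bump c r x = flat_exp 0 (r\<^sup>2 - (\<Sum>i\<in>UNIV. (x $ i - c $ i)\<^sup>2))"

lemma sum_square_eq_dist: "(\<Sum>i\<in>UNIV. (x $ i - c $ i)\<^sup>2) = (dist c x)\<^sup>2" for x c :: "real^'n::finite"
  by (simp add: dist_vec_def L2_set_def dist_real_def sum_nonneg power2_commute)

lemma bump_nonneg: "0 \<le> bump c r x"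
  by (simp add: bump_def flat_exp_def)

lemma bump_pos_iff: "r > 0 \<Longrightarrow> 0 < bump c r x \<longleftrightarrow> x \<in> ball c r"
  by (auto simp: bump_def flat_exp_def sum_square_eq_dist abs_le_square_iff[symmetric]
     power_less_imp_less_base dest: power2_less_imp_less intro: power_strict_mono)

lemma bump_eq_0_iff: "r > 0 \<Longrightarrow> bump c r x = 0 \<longleftrightarrow> x \<notin> ball c r"
  using bump_pos_iff[of r c x] bump_nonneg[of c r x] by linarith

lemma Ck_bump: "Ck k (bump c r)"
proof -
  have "Ck k (\<lambda>x. r\<^sup>2 + (\<Sum>i\<in>UNIV. (- 1) * ((x $ i + (- c $ i)) * (x $ i + (- c $ i)))))"
    by (intro Ck_add Ck_const Ck_sum Ck_mult Ck_nth)
  from Ck_flat_exp_compose[OF this, of 0] show ?thesis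
    by (simp add: bump_def[abs_def] power2_eq_square sum_negf)
qed

lemma partial_deriv_translate:
  fixes f :: "real^'n::finite \<Rightarrow> real"
  assumes "\<And>x. f differentiable (at x)"
  shows "((\<lambda>x. f (x + a)) has_derivative (\<lambda>k. \<Sum>i\<in>UNIV. k $ i * partial_deriv i f (x + a))) (at x)"
proof -
  have "((\<lambda>x. x + a) has_derivative (\<lambda>x. x)) (at x)"
    by (auto intro!: derivative_eq_intros)
  from has_derivative_compose[OF this has_derivative_partial_deriv[OF assms]] show ?thesis .
qed

lemma Ck_translate:
  fixes f :: "real^'n::finite \<Rightarrow> real"
  assumes "Ck k f" shows "Ck k (\<lambda>x. f (x + a))"
  using assms
proof (induction k arbitrary: f)
  case 0
  then show ?case by (auto intro!: continuous_on_compose2[of UNIV f] continuous_intros)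
next
  case (Suc k)
  show ?case
    by (rule Ck_SucI(1)[OF partial_deriv_translate]) (use Suc in \<open>auto simp: differentiable_on_def intro: Suc.IH\<close>)
qed

section \<open>Test functions and their supports\<close>

lemma test_function_Ck: "test_function \<Omega> \<phi> \<Longrightarrow> Ck k \<phi>"
  by (simp add: test_function_def)

lemma test_function_differentiable: "test_function \<Omega> \<phi> \<Longrightarrow> \<phi> differentiable (at x)"
  using Ck_differentiable test_function_Ck by blast

lemma test_functionI:
  assumes "\<And>k. Ck k \<phi>" "compact K" "K \<subseteq> \<Omega>" "\<And>x. x \<notin> K \<Longrightarrow> \<phi> x = 0"
  shows "test_function \<Omega> \<phi>"
proof -
  have "closure {x. \<phi> x \<noteq> 0} \<subseteq> K"
    using assms by (intro closure_minimal) (auto intro: compact_imp_closed)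
  then have "compact (closure {x. \<phi> x \<noteq> 0})" "closure {x. \<phi> x \<noteq> 0} \<subseteq> \<Omega>"
    using compact_Int_closed[OF assms(2) closed_closure, of "{x. \<phi> x \<noteq> 0}"] assms(3)
    by (auto simp: Int_absorb1)
  then show ?thesis
    unfolding test_function_def using assms(1) by blast
qed

lemma test_functionE:
  assumes "test_function \<Omega> \<phi>"
  obtains K where "compact K" "K \<subseteq> \<Omega>" "\<And>x. x \<notin> K \<Longrightarrow> \<phi> x = 0"
proof -
  have "\<phi> x = 0" if "x \<notin> closure {x. \<phi> x \<noteq> 0}" for x
    using that closure_subset[of "{x. \<phi> x \<noteq> 0}"] by blast
  then show thesis
    using assms unfolding test_function_def by (intro that[of "closure {x. \<phi> x \<noteq> 0}"]) blast+
qed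

lemma partial_deriv_outside_compact:
  assumes "compact K" "\<And>x. x \<notin> K \<Longrightarrow> \<phi> x = 0" "x \<notin> K"
  shows "partial_deriv i \<phi> x = 0"
proof -
  have "(\<phi> has_derivative (\<lambda>_. 0)) (at x)"
    by (rule has_derivative_transform_within_open[where f = "\<lambda>_. 0" and s = "- K"])
      (use assms in \<open>auto intro: compact_imp_closed\<close>)
  from partial_deriv_eqI[OF this] show ?thesis by simp
qed

lemma test_function_partial_deriv:
  assumes "test_function \<Omega> \<phi>" shows "test_function \<Omega> (partial_deriv i \<phi>)"
proof -
  obtain K where K: "compact K" "K \<subseteq> \<Omega>" "\<And>x. x \<notin> K \<Longrightarrow> \<phi> x = 0"
    using assms test_functionE by blast
  show ?thesis
    by (rule test_functionI[OF _ K(1,2) partial_deriv_outside_compact[OF K(1,3)]])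
      (use test_function_Ck[OF assms, of "Suc _"] in auto)
qed

lemma test_function_zero: "test_function \<Omega> (\<lambda>x. 0)"
  by (rule test_functionI[where K = "{}"]) (auto intro: Ck_const)

subsection \<open>Integration against test functions\<close>

lemma compact_support_bounded:
  fixes f :: "'a::topological_space \<Rightarrow> real"
  assumes "continuous_on UNIV f" "compact K" "\<And>x. x \<notin> K \<Longrightarrow> f x = 0"
  obtains B where "0 \<le> B" "\<And>x. \<bar>f x\<bar> \<le> B"
proof -
  have "compact (f ` K)"
    using assms by (intro compact_continuous_image) (auto intro: continuous_on_subset)
  then obtain B where B: "\<forall>y\<in>f ` K. norm y \<le> B"
    using compact_imp_bounded bounded_iff by metis
  have "\<bar>f x\<bar> \<le> max 0 B" for x
    using assms(3)[of x] B by (cases "x \<in> K") (auto simp: max.coboundedI2)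
  then show thesis using that[of "max 0 B"] by simp
qed

lemma continuous_borel_measurable_lebesgue:
  fixes f :: "'a::euclidean_space \<Rightarrow> 'b::topological_space"
  assumes "continuous_on UNIV f" shows "f \<in> borel_measurable lebesgue"
  using borel_measurable_continuous_onI[OF assms]
  by (simp add: measurable_completion)

lemma integrable_mult_bounded_continuous:
  fixes f g :: "'a::euclidean_space \<Rightarrow> real"
  assumes f: "integrable lebesgue f" and g: "continuous_on UNIV g" "\<And>x. \<bar>g x\<bar> \<le> B"
  shows "integrable lebesgue (\<lambda>x. f x * g x)"
proof (rule Bochner_Integration.integrable_bound)
  show "integrable lebesgue (\<lambda>x. B * f x)"
    using f by simp
  show "(\<lambda>x. f x * g x) \<in> borel_measurable lebesgue"
    using borel_measurable_integrable[OF f] continuous_borel_measurable_lebesgue[OF g(1)] by simp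
  have "0 \<le> B" using g(2) abs_ge_zero order_trans by blast
  then show "AE x in lebesgue. norm (f x * g x) \<le> norm (B * f x)"
    using g(2) by (auto simp: abs_mult mult.commute[of "\<bar>f _\<bar>"] intro!: AE_I2 mult_right_mono)
qed

lemma integrable_compact_support:
  fixes f :: "'a::euclidean_space \<Rightarrow> real"
  assumes "continuous_on UNIV f" "compact K" "\<And>x. x \<notin> K \<Longrightarrow> f x = 0"
  shows "integrable lebesgue f"
proof -
  have "integrable lborel (\<lambda>x. indicator K x *\<^sub>R f x)"
    using assms by (intro borel_integrable_compact) (auto intro: continuous_on_subset)
  moreover have "(\<lambda>x. indicator K x *\<^sub>R f x) = f"
    using assms(3) by (auto simp: indicator_def fun_eq_iff)
  ultimately show ?thesis
    using borel_measurable_integrable[of lborel f] integrable_completion[of f lborel] by simp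
qed

lemma integral_lebesgue_translate:
  fixes f :: "'a::euclidean_space \<Rightarrow> real"
  assumes [measurable]: "f \<in> borel_measurable borel"
  shows "(\<integral>x. f (x + a) \<partial>lebesgue) = (\<integral>x. f x \<partial>lebesgue)"
proof -
  have "(\<integral>x. f x \<partial>lborel) = (\<integral>x. f x \<partial>distr lborel borel ((+) a))"
    by (simp add: lborel_distr_plus)
  also have "\<dots> = (\<integral>x. f (a + x) \<partial>lborel)"
    by (rule integral_distr) simp_all
  finally show ?thesis
    by (simp add: integral_completion add.commute)
qed

text \<open>All smoothness sits in \<open>\<phi>\<close>, while \<open>f\<close> is merely
  integrable. The directional derivative of \<open>\<phi>\<close> is bounded by some
  \<open>L\<close> because the support is compact, so the difference quotients are dominated by
  \<open>L * \<bar>f x\<bar>\<close>. Vanishing of integrated derivatives, the exchange of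
  derivatives and the shift identity for the pressure all rest on this.\<close>

lemma integral_translate_deriv:
  fixes f :: "real^'n::finite \<Rightarrow> real"
  assumes f: "integrable lebesgue f" and \<phi>: "Ck (Suc 0) \<phi>"
    and K: "compact K" "\<And>x. x \<notin> K \<Longrightarrow> \<phi> x = 0"
  shows "((\<lambda>t. \<integral>x. f x * \<phi> (x + t *\<^sub>R k) \<partial>lebesgue) has_real_derivative
     (\<integral>x. f x * (\<Sum>i\<in>UNIV. k $ i * partial_deriv i \<phi> (x + t *\<^sub>R k)) \<partial>lebesgue)) (at t)"
proof -
  define d where "d = (\<lambda>x. \<Sum>i\<in>UNIV. k $ i * partial_deriv i \<phi> x)"
  have d_cont: "continuous_on UNIV d"
    unfolding d_def using \<phi> by (auto intro!: continuous_intros)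
  have \<phi>_cont: "continuous_on UNIV \<phi>" using \<phi> by (rule Ck_continuous)
  have d_0: "d x = 0" if "x \<notin> K" for x
    unfolding d_def using partial_deriv_outside_compact[OF K that] by simp
  obtain L where L: "0 \<le> L" "\<And>x. \<bar>d x\<bar> \<le> L"
    using compact_support_bounded[OF d_cont K(1) d_0] by blast
  obtain M where M: "0 \<le> M" "\<And>x. \<bar>\<phi> x\<bar> \<le> M"
    using compact_support_bounded[OF \<phi>_cont K] by blast
  have dir: "((\<lambda>t. \<phi> (x + t *\<^sub>R k)) has_real_derivative d (x + t *\<^sub>R k)) (at t)" for x t
  proof -
    have "((\<lambda>t. x + t *\<^sub>R k) has_derivative (\<lambda>s. s *\<^sub>R k)) (at t)"
      by (auto intro!: derivative_eq_intros)
    from has_derivative_compose[OF this has_derivative_partial_deriv[OF Ck_differentiable[OF \<phi>]]]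
    show ?thesis
      by (simp add: has_field_derivative_def d_def mult.assoc mult.commute[of _ "sum _ _"] flip: sum_distrib_left)
  qed
  have lip: "\<bar>\<phi> (x + s *\<^sub>R k) - \<phi> (x + t *\<^sub>R k)\<bar> \<le> L * \<bar>s - t\<bar>" for x s t
    using field_differentiable_bound[of UNIV "\<lambda>t. \<phi> (x + t *\<^sub>R k)" "\<lambda>t. d (x + t *\<^sub>R k)" L s t] dir L
    by simp
  have tr: "continuous_on UNIV (\<lambda>x. \<phi> (x + a))" for a
    using Ck_continuous[OF Ck_translate[OF \<phi>]] .
  have int: "integrable lebesgue (\<lambda>x. f x * \<phi> (x + a))" for a
    by (rule integrable_mult_bounded_continuous[OF f tr]) (use M in auto)
  have bd: "norm (f x * Y) \<le> L * \<bar>f x\<bar>" if "\<bar>Y\<bar> \<le> L" for x Y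
    using that mult_left_mono[of "\<bar>Y\<bar>" L "\<bar>f x\<bar>"] by (simp add: abs_mult mult.commute)
  define F where "F = (\<lambda>t. \<integral>x. f x * \<phi> (x + t *\<^sub>R k) \<partial>lebesgue)"
  have "((\<lambda>h. (F (t + h) - F t) / h) \<longlongrightarrow> (\<integral>x. f x * d (x + t *\<^sub>R k) \<partial>lebesgue)) (at 0)"
    unfolding tendsto_at_iff_sequentially
  proof (intro allI impI, unfold comp_def)
    fix h :: "nat \<Rightarrow> real"
    assume h: "\<forall>n. h n \<in> UNIV - {0}" "h \<longlonglongrightarrow> 0"
    have F_eq: "(F (t + h n) - F t) / h n =
        (\<integral>x. f x * ((\<phi> (x + (t + h n) *\<^sub>R k) - \<phi> (x + t *\<^sub>R k)) / h n) \<partial>lebesgue)" for n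
    proof -
      have "F (t + h n) - F t = (\<integral>x. f x * \<phi> (x + (t + h n) *\<^sub>R k) - f x * \<phi> (x + t *\<^sub>R k) \<partial>lebesgue)"
        unfolding F_def by (rule Bochner_Integration.integral_diff[symmetric]; rule int)
      then have "(F (t + h n) - F t) / h n = (\<integral>x. (f x * \<phi> (x + (t + h n) *\<^sub>R k) - f x * \<phi> (x + t *\<^sub>R k)) / h n \<partial>lebesgue)"
        by simp
      then show ?thesis
        by (simp add: right_diff_distrib)
    qed
    show "(\<lambda>n. (F (t + h n) - F t) / h n) \<longlonglongrightarrow> (\<integral>x. f x * d (x + t *\<^sub>R k) \<partial>lebesgue)"
      unfolding F_eq
    proof (rule integral_dominated_convergence[where w = "\<lambda>x. L * \<bar>f x\<bar>"])
      have "continuous_on UNIV (\<lambda>x. d (x + t *\<^sub>R k))"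
        by (intro continuous_on_compose2[OF d_cont] continuous_intros) auto
      then show "(\<lambda>x. f x * d (x + t *\<^sub>R k)) \<in> borel_measurable lebesgue"
        by (rule borel_measurable_times[OF borel_measurable_integrable[OF f] continuous_borel_measurable_lebesgue])
      show "(\<lambda>x. f x * ((\<phi> (x + (t + h n) *\<^sub>R k) - \<phi> (x + t *\<^sub>R k)) / h n)) \<in> borel_measurable lebesgue" for n
        by (intro borel_measurable_times borel_measurable_divide borel_measurable_diff borel_measurable_const
            borel_measurable_integrable[OF f] continuous_borel_measurable_lebesgue[OF tr])
      show "integrable lebesgue (\<lambda>x. L * \<bar>f x\<bar>)" using f by simp
      have "(\<lambda>n. (\<phi> (x + (t + h n) *\<^sub>R k) - \<phi> (x + t *\<^sub>R k)) / h n) \<longlonglongrightarrow> d (x + t *\<^sub>R k)" for x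
        using dir[of x t] h unfolding DERIV_def tendsto_at_iff_sequentially comp_def by blast
      then show "AE x in lebesgue. (\<lambda>n. f x * ((\<phi> (x + (t + h n) *\<^sub>R k) - \<phi> (x + t *\<^sub>R k)) / h n))
          \<longlonglongrightarrow> f x * d (x + t *\<^sub>R k)"
        by (intro AE_I2 tendsto_mult_left)
      have "\<bar>(\<phi> (x + (t + h n) *\<^sub>R k) - \<phi> (x + t *\<^sub>R k)) / h n\<bar> \<le> L" for x n
        using lip[of x "t + h n" t] h(1) by (simp add: abs_divide divide_le_eq)
      then show "AE x in lebesgue. norm (f x * ((\<phi> (x + (t + h n) *\<^sub>R k) - \<phi> (x + t *\<^sub>R k)) / h n)) \<le> L * \<bar>f x\<bar>" for n
        using bd by (intro AE_I2) blast
    qed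
  qed
  then show ?thesis
    by (simp add: DERIV_def F_def d_def)
qed

text \<open>The integral of \<open>\<phi>\<close> does not change under translation, so its
  derivative in the translation parameter is zero; differentiating under the integral gives the
  integral of the partial derivative.\<close>

lemma integral_partial_deriv_eq_0:
  fixes \<phi> :: "real^'n::finite \<Rightarrow> real"
  assumes \<phi>: "Ck (Suc 0) \<phi>" and K: "compact K" "\<And>x. x \<notin> K \<Longrightarrow> \<phi> x = 0"
  shows "(\<integral>x. partial_deriv i \<phi> x \<partial>lebesgue) = 0"
proof -
  obtain r where r: "K \<subseteq> cball 0 r"
    using compact_imp_bounded[OF K(1)] bounded_subset_ballD[of K 0] ball_subset_cball by (metis order_trans)
  \<comment> \<open>Differentiation under the integral is available only with an integrable factor.
    The extra radius 1 makes this factor equal to 1 wherever a translate of \<open>\<phi>\<close> by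
    less than 1 is nonzero.\<close>
  define f where "f = (indicator (cball 0 (r + 1)) :: real^'n \<Rightarrow> real)"
  have int: "integrable lebesgue f"
    unfolding f_def using lmeasurable_cball lmeasurable_iff_integrable by blast
  have loc: "f x * \<phi> (x + t *\<^sub>R axis i 1) = \<phi> (x + t *\<^sub>R axis i 1)" if "\<bar>t\<bar> < 1" for x t
  proof (cases "x + t *\<^sub>R axis i 1 \<in> K")
    case True
    then have "norm (x + t *\<^sub>R axis i 1) \<le> r" using r by auto
    then have "norm x \<le> r + 1"
      using that norm_triangle_ineq4[of "x + t *\<^sub>R axis i 1" "t *\<^sub>R axis i (1::real)"] by simp
    then show ?thesis by (simp add: f_def)
  qed (simp add: K)
  define F where "F = (\<lambda>t. \<integral>x. f x * \<phi> (x + t *\<^sub>R axis i 1) \<partial>lebesgue)"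
  have "(F has_real_derivative 0) (at 0)"
  proof (rule has_field_derivative_transform_within_open[where S = "{-1<..<1}"])
    show "((\<lambda>_. \<integral>x. \<phi> x \<partial>lebesgue) has_real_derivative 0) (at 0)" by simp
    show "(\<integral>x. \<phi> x \<partial>lebesgue) = F t" if "t \<in> {-1<..<1}" for t
    proof -
      have "\<bar>t\<bar> < 1" using that by auto
      then have "F t = (\<integral>x. \<phi> (x + t *\<^sub>R axis i 1) \<partial>lebesgue)"
        unfolding F_def by (simp only: loc)
      then show ?thesis using integral_lebesgue_translate[OF borel_measurable_continuous_onI[OF Ck_continuous[OF \<phi>]]] by simp
    qed
  qed auto
  from DERIV_unique[OF this integral_translate_deriv[OF int \<phi> K, of "axis i 1" 0, folded F_def]]
  have "(\<integral>x. f x * (\<Sum>j\<in>UNIV. axis i 1 $ j * partial_deriv j \<phi> x) \<partial>lebesgue) = 0"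
    by simp
  also have "(\<lambda>x. f x * (\<Sum>j\<in>UNIV. axis i 1 $ j * partial_deriv j \<phi> x)) = partial_deriv i \<phi>"
  proof
    fix x
    have "(\<Sum>j\<in>UNIV. axis i 1 $ j * partial_deriv j \<phi> x) = (\<Sum>j\<in>UNIV. if j = i then partial_deriv j \<phi> x else 0)"
      by (rule sum.cong) (auto simp: axis_def)
    moreover have "f x * partial_deriv i \<phi> x = partial_deriv i \<phi> x"
      using r partial_deriv_outside_compact[where x = x and i = i, OF K] by (cases "x \<in> K") (auto simp: f_def)
    ultimately show "f x * (\<Sum>j\<in>UNIV. axis i 1 $ j * partial_deriv j \<phi> x) = partial_deriv i \<phi> x"
      by simp
  qed
  finally show ?thesis .
qed

text \<open>Compact support is asked of \<open>\<phi>\<close> only, so a polynomial such as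
  \<open>x $ i\<close> may stand for \<open>\<psi>\<close>.\<close>

lemma integration_by_parts_compact:
  fixes \<phi> \<psi> :: "real^'n::finite \<Rightarrow> real"
  assumes \<phi>: "Ck (Suc 0) \<phi>" and \<psi>: "Ck (Suc 0) \<psi>" and K: "compact K" "\<And>x. x \<notin> K \<Longrightarrow> \<phi> x = 0"
  shows "(\<integral>x. partial_deriv i \<phi> x * \<psi> x \<partial>lebesgue) = - (\<integral>x. \<phi> x * partial_deriv i \<psi> x \<partial>lebesgue)"
proof -
  have eq: "partial_deriv i (\<lambda>x. \<phi> x * \<psi> x) = (\<lambda>x. \<phi> x * partial_deriv i \<psi> x + partial_deriv i \<phi> x * \<psi> x)"
    by (rule Ck_SucI(2)[OF Ck_mult_partial, where k = 0])
      (use \<phi> \<psi> Ck_continuous[OF \<phi>] Ck_continuous[OF \<psi>] in \<open>auto simp: differentiable_on_def intro!: continuous_intros\<close>)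
  have "(\<integral>x. partial_deriv i (\<lambda>x. \<phi> x * \<psi> x) x \<partial>lebesgue) = 0"
    using \<phi> \<psi> K by (intro integral_partial_deriv_eq_0[where K = K] Ck_mult) auto
  moreover have "integrable lebesgue (\<lambda>x. \<phi> x * partial_deriv i \<psi> x)"
    "integrable lebesgue (\<lambda>x. partial_deriv i \<phi> x * \<psi> x)"
    using \<phi> \<psi> K Ck_continuous[OF \<phi>] Ck_continuous[OF \<psi>] partial_deriv_outside_compact[OF K]
    by (auto intro!: integrable_compact_support[where K = K] continuous_intros)
  ultimately show ?thesis
    using Bochner_Integration.integral_add[of lebesgue "\<lambda>x. \<phi> x * partial_deriv i \<psi> x" "\<lambda>x. partial_deriv i \<phi> x * \<psi> x"]
    unfolding eq by linarith
qed

text \<open>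
  Both sides arise by differentiating the same function of a translation parameter, which avoids
  the symmetry of second derivatives.
\<close>

lemma integral_partial_deriv_swap:
  fixes \<phi> \<psi> :: "real^'n::finite \<Rightarrow> real"
  assumes \<phi>: "test_function \<Omega> \<phi>" and \<psi>: "test_function \<Omega> \<psi>"
  shows "(\<integral>x. partial_deriv i \<phi> x * partial_deriv j \<psi> x \<partial>lebesgue) =
    (\<integral>x. partial_deriv j \<phi> x * partial_deriv i \<psi> x \<partial>lebesgue)"
proof -
  obtain K where K: "compact K" "K \<subseteq> \<Omega>" "\<And>x. x \<notin> K \<Longrightarrow> \<phi> x = 0"
    using \<phi> test_functionE by blast
  obtain L where L: "compact L" "L \<subseteq> \<Omega>" "\<And>x. x \<notin> L \<Longrightarrow> \<psi> x = 0"
    using \<psi> test_functionE by blast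
  note K = K(1,3) and L = L(1,3)
  have C1: "Ck (Suc 0) \<phi>" "Ck (Suc 0) \<psi>" "Ck (Suc 0) (partial_deriv j \<phi>)"
    using \<phi> \<psi> test_function_partial_deriv test_function_Ck by blast+
  have C0: "continuous_on UNIV (partial_deriv j \<phi>)" "continuous_on UNIV (partial_deriv j \<psi>)" "continuous_on UNIV \<psi>"
    using Ck_continuous[OF C1(2)] Ck_continuous[OF C1(3)] C1(2) by auto
  have axis: "(\<Sum>l\<in>UNIV. (c *\<^sub>R axis i 1 :: real^'n) $ l * g l) = c * g i" for c and g :: "'n \<Rightarrow> real"
  proof -
    have "(\<Sum>l\<in>UNIV. (c *\<^sub>R axis i 1 :: real^'n) $ l * g l) = (\<Sum>l\<in>UNIV. if l = i then c * g l else 0)"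
      by (rule sum.cong) (auto simp: axis_def)
    then show ?thesis by simp
  qed
  define P where "P = (\<lambda>t. \<integral>x. partial_deriv j \<psi> x * \<phi> (x + t *\<^sub>R axis i 1) \<partial>lebesgue)"
  define Q where "Q = (\<lambda>t. \<integral>x. partial_deriv j \<phi> x * \<psi> (x + t *\<^sub>R (- 1) *\<^sub>R axis i 1) \<partial>lebesgue)"
  have P: "(P has_real_derivative (\<integral>x. partial_deriv j \<psi> x * partial_deriv i \<phi> x \<partial>lebesgue)) (at 0)"
    using integral_translate_deriv[OF _ C1(1) K, of "partial_deriv j \<psi>" "axis i 1" 0] axis[of 1]
      integrable_compact_support[OF C0(2) L(1) partial_deriv_outside_compact[OF L]]
    by (simp add: P_def)
  have Q: "(Q has_real_derivative - (\<integral>x. partial_deriv j \<phi> x * partial_deriv i \<psi> x \<partial>lebesgue)) (at 0)"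
    using integral_translate_deriv[OF _ C1(2) L, of "partial_deriv j \<phi>" "(-1) *\<^sub>R axis i 1" 0] axis[of "-1"]
      integrable_compact_support[OF C0(1) K(1) partial_deriv_outside_compact[OF K]]
    by (simp add: Q_def)
  \<comment> \<open>One integration by parts in direction \<open>j\<close> followed by a translation
    of the integration variable.\<close>
  have "P t = - Q t" for t
  proof -
    let ?a = "t *\<^sub>R axis i 1 :: real^'n"
    have tr: "partial_deriv j (\<lambda>x. \<phi> (x + ?a)) = (\<lambda>x. partial_deriv j \<phi> (x + ?a))"
      by (rule Ck_SucI(2)[OF partial_deriv_translate, where k = 0])
         (use C1 \<phi> in \<open>auto simp: test_function_differentiable Ck_translate[of 0, simplified]\<close>)
    have "P t = - (\<integral>x. \<psi> x * partial_deriv j \<phi> (x + ?a) \<partial>lebesgue)"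
      unfolding P_def using integration_by_parts_compact[OF C1(2) Ck_translate[OF C1(1), of ?a] L, of j]
      by (simp add: tr)
    also have "(\<integral>x. \<psi> x * partial_deriv j \<phi> (x + ?a) \<partial>lebesgue) =
        (\<integral>x. \<psi> (x - ?a) * partial_deriv j \<phi> x \<partial>lebesgue)"
      using integral_lebesgue_translate[of "\<lambda>x. \<psi> (x - ?a) * partial_deriv j \<phi> x" ?a] C0
      by (simp add: borel_measurable_continuous_onI continuous_on_compose2[OF C0(3)] continuous_intros)
    finally show ?thesis by (simp add: Q_def mult.commute)
  qed
  then have "P = (\<lambda>t. - Q t)" by blast
  with P DERIV_minus[OF Q] have "(\<integral>x. partial_deriv j \<psi> x * partial_deriv i \<phi> x \<partial>lebesgue) =
     (\<integral>x. partial_deriv j \<phi> x * partial_deriv i \<psi> x \<partial>lebesgue)"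
    using DERIV_unique by fastforce
  then show ?thesis by (simp add: mult.commute)
qed

section \<open>From the sign of a distribution to the sign of its density\<close>

lemma open_Union_balls:
  fixes U :: "('a::euclidean_space) set"
  assumes "open U" "U \<noteq> {}"
  obtains c :: "nat \<Rightarrow> 'a" and r where "\<And>n. 0 < r n" "\<And>n. cball (c n) (r n) \<subseteq> U" "(\<Union>n. ball (c n) (r n)) = U"
proof -
  define F where "F = {ball c r |c r. 0 < r \<and> cball c r \<subseteq> U}"
  have F: "\<Union>F = U"
  proof
    show "\<Union>F \<subseteq> U" using ball_subset_cball by (fastforce simp: F_def)
    show "U \<subseteq> \<Union>F"
    proof
      fix x assume "x \<in> U"
      then obtain e where "e > 0" "cball x e \<subseteq> U" using assms(1) open_contains_cball by blast
      then show "x \<in> \<Union>F" unfolding F_def by (intro UnionI[of "ball x e"]) auto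
    qed
  qed
  obtain F' where F': "F' \<subseteq> F" "countable F'" "\<Union>F' = \<Union>F"
    using Lindelof[of F] F_def by blast
  then have ne: "F' \<noteq> {}" using F assms by auto
  have "\<exists>c r. from_nat_into F' n = ball c r \<and> 0 < r \<and> cball c r \<subseteq> U" for n
    using from_nat_into[OF ne, of n] F' F_def by blast
  then obtain c r where cr: "\<And>n. from_nat_into F' n = ball (c n) (r n)" "\<And>n. 0 < r n" "\<And>n. cball (c n) (r n) \<subseteq> U"
    by metis
  have "(\<Union>n. ball (c n) (r n)) = \<Union>(range (from_nat_into F'))"
    using cr(1) by simp
  also have "\<dots> = U" using range_from_nat_into[OF ne F'(2)] F' F by simp
  finally show thesis using that cr by blast
qed

text \<open>With \<open>S n\<close> the sum of the first \<open>n\<close> bumps of a countable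
  cover, \<open>1 - exp (- n * S n)\<close> is smooth, lies in the unit interval and vanishes off
  finitely many closed balls. At a point of \<open>U\<close> one bump bounds \<open>S n\<close> from
  below for all large \<open>n\<close>, so the exponential decays geometrically there.\<close>

lemma test_functions_approx_indicator:
  fixes U :: "(real^'n::finite) set"
  assumes "open U"
  obtains \<psi> where "\<And>n::nat. test_function U (\<psi> n)" "\<And>n x. 0 \<le> \<psi> n x" "\<And>n x. \<psi> n x \<le> 1"
    "\<And>x. (\<lambda>n. \<psi> n x) \<longlonglongrightarrow> indicator U x"
proof (cases "U = {}")
  case True
  then show ?thesis using that[of "\<lambda>n x. 0"] by (simp add: test_function_zero)
next
  case False
  obtain c r where cr: "\<And>n::nat. 0 < r n" "\<And>n. cball (c n) (r n) \<subseteq> U" "(\<Union>n. ball (c n) (r n)) = U"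
    using open_Union_balls[OF assms False] by metis
  define S where "S = (\<lambda>n x. \<Sum>i<n. bump (c i) (r i) x)"
  define \<psi> where "\<psi> = (\<lambda>n x. 1 + (-1) * exp ((- real n) * S n x))"
  have S0: "0 \<le> S n x" for n x by (simp add: S_def sum_nonneg bump_nonneg)
  show ?thesis
  proof
    show "test_function U (\<psi> n)" for n
    proof (rule test_functionI[where K = "\<Union>i<n. cball (c i) (r i)"])
      show "Ck k (\<psi> n)" for k
        unfolding \<psi>_def S_def by (intro Ck_add Ck_mult Ck_const Ck_exp_compose Ck_sum Ck_bump)
      show "\<psi> n x = 0" if "x \<notin> (\<Union>i<n. cball (c i) (r i))" for x
      proof -
        have "S n x = 0"
          unfolding S_def using that cr(1) ball_subset_cball by (intro sum.neutral) (force simp: bump_eq_0_iff)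
        then show ?thesis by (simp add: \<psi>_def)
      qed
    qed (use cr in auto)
    show "0 \<le> \<psi> n x" "\<psi> n x \<le> 1" for n x
      using S0[of n x] by (auto simp: \<psi>_def)
    show "(\<lambda>n. \<psi> n x) \<longlonglongrightarrow> indicator U x" for x
    proof (cases "x \<in> U")
      case True
      then obtain m where m: "x \<in> ball (c m) (r m)" using cr(3) by blast
      define b where "b = bump (c m) (r m) x"
      have b: "b > 0" using m cr(1) bump_pos_iff b_def by blast
      have "b \<le> S n x" if "n > m" for n
        unfolding b_def S_def using that by (intro member_le_sum) (auto simp: bump_nonneg)
      then have ev: "eventually (\<lambda>n. exp (- real n * S n x) \<le> exp (- b) ^ n) sequentially"
        by (intro eventually_sequentiallyI[of "Suc m"]) (simp add: exp_of_nat_mult[symmetric] mult_left_mono)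
      have "(\<lambda>n. exp (- b) ^ n) \<longlonglongrightarrow> 0"
        using b by (intro LIMSEQ_realpow_zero) auto
      then have "(\<lambda>n. exp (- real n * S n x)) \<longlonglongrightarrow> 0"
        by (rule tendsto_sandwich[OF _ ev tendsto_const, rotated]) simp
      then have "(\<lambda>n. \<psi> n x) \<longlonglongrightarrow> 1 + (-1) * 0"
        unfolding \<psi>_def by (intro tendsto_intros)
      then show ?thesis using True by simp
    next
      case False
      then have "S n x = 0" for n
        unfolding S_def using cr bump_eq_0_iff by (intro sum.neutral) blast
      then show ?thesis using False by (simp add: \<psi>_def)
    qed
  qed
qed

text \<open>Approximating indicators by test functions gives a nonnegative integral of
  \<open>H\<close> over every open subset of \<open>B\<close>. Outer regularity carries this over to
  the set where \<open>H\<close> is negative, and an integral over that set can be nonnegative only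
  if the set is null.\<close>

lemma nonneg_distr_imp_nonneg_AE_integrable:
  fixes H :: "real^'n::finite \<Rightarrow> real"
  assumes B: "open B" and H: "integrable lebesgue H"
    and pos: "\<And>\<phi>. test_function B \<phi> \<Longrightarrow> (\<And>x. 0 \<le> \<phi> x) \<Longrightarrow> 0 \<le> (\<integral>x. H x * \<phi> x \<partial>lebesgue)"
  shows "AE x in lebesgue. x \<in> B \<longrightarrow> 0 \<le> H x"
proof -
  have [measurable]: "H \<in> borel_measurable lebesgue" using H by auto
  have opn: "0 \<le> (\<integral>x. H x * indicator U x \<partial>lebesgue)" if U: "open U" "U \<subseteq> B" for U
  proof -
    obtain \<psi> where \<psi>: "\<And>n::nat. test_function U (\<psi> n)" "\<And>n x. 0 \<le> \<psi> n x" "\<And>n x. \<psi> n x \<le> 1"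
      "\<And>x. (\<lambda>n. \<psi> n x) \<longlonglongrightarrow> indicator U x"
      using test_functions_approx_indicator[OF U(1)] by metis
    have meas: "\<psi> n \<in> borel_measurable lebesgue" for n
      using \<psi>(1) test_function_Ck Ck_continuous continuous_borel_measurable_lebesgue by metis
    have "(\<lambda>n. \<integral>x. H x * \<psi> n x \<partial>lebesgue) \<longlonglongrightarrow> (\<integral>x. H x * indicator U x \<partial>lebesgue)"
    proof (rule integral_dominated_convergence[where w = "\<lambda>x. \<bar>H x\<bar>"])
      show "(\<lambda>x. H x * indicator U x) \<in> borel_measurable lebesgue"
        using U(1) by (intro borel_measurable_times borel_measurable_indicator) auto
      show "AE x in lebesgue. norm (H x * \<psi> n x) \<le> \<bar>H x\<bar>" for n
        using \<psi>(2,3)[of n] by (auto simp: abs_mult mult_left_le)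
      show "AE x in lebesgue. (\<lambda>n. H x * \<psi> n x) \<longlonglongrightarrow> H x * indicator U x"
        by (intro AE_I2 tendsto_mult_left \<psi>(4))
    qed (use H meas in auto)
    moreover have "0 \<le> (\<integral>x. H x * \<psi> n x \<partial>lebesgue)" for n
    proof (rule pos)
      show "test_function B (\<psi> n)" using \<psi>(1) U(2) by (auto simp: test_function_def)
    qed (rule \<psi>(2))
    ultimately show ?thesis by (intro LIMSEQ_le_const) auto
  qed
  define A where "A = {x. x \<in> B \<and> H x < 0}"
  have A_eq: "A = B \<inter> (H -` {..<0} \<inter> space lebesgue)" by (auto simp: A_def)
  have A: "A \<in> sets lebesgue"
    unfolding A_eq by (intro sets.Int measurable_sets[of H lebesgue borel]) (use B H in auto)
  have "\<exists>T. open T \<and> A \<subseteq> T \<and> T - A \<in> lmeasurable \<and> emeasure lebesgue (T - A) < ennreal (1 / real (Suc n))" for n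
  proof -
    have "0 < 1 / real (Suc n)" by simp
    from sets_lebesgue_outer_open[OF A this] show ?thesis by metis
  qed
  then obtain T where T: "\<And>n. open (T n)" "\<And>n. A \<subseteq> T n" "\<And>n. emeasure lebesgue (T n - A) < ennreal (1 / real (Suc n))"
    by metis
  \<comment> \<open>Finite intersections keep the approximating sets open and make them decrease to
    \<open>G\<close>, which exceeds \<open>A\<close> by a null set only.\<close>
  define U where "U = (\<lambda>n. B \<inter> (\<Inter>i\<le>n. T i))"
  define G where "G = B \<inter> (\<Inter>i. T i)"
  have U: "open (U n)" "U n \<subseteq> B" for n
    using B T(1) by (auto simp: U_def)
  have G: "G \<in> sets lebesgue"
    unfolding G_def using B T(1) by auto
  have AG: "A \<subseteq> G" using T(2) by (auto simp: G_def A_def)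
  have null: "G - A \<in> null_sets lebesgue"
  proof -
    have "emeasure lebesgue (G - A) \<le> ennreal (1 / real (Suc n))" for n
      using emeasure_mono[of "G - A" "T n - A" lebesgue] T(1,3)[of n] A
      by (fastforce simp: G_def intro: order_trans less_imp_le)
    moreover have "(\<lambda>n. ennreal (1 / real (Suc n))) \<longlonglongrightarrow> ennreal 0"
      by (intro tendsto_ennrealI) (use LIMSEQ_inverse_real_of_nat in \<open>simp add: inverse_eq_divide\<close>)
    ultimately have "emeasure lebesgue (G - A) \<le> 0"
      by (intro LIMSEQ_le_const[where X = "\<lambda>n. ennreal (1 / real (Suc n))"]) auto
    then show ?thesis using A G by (auto simp: null_sets_def)
  qed
  have lim: "(\<lambda>n. \<integral>x. H x * indicator (U n) x \<partial>lebesgue) \<longlonglongrightarrow> (\<integral>x. H x * indicator G x \<partial>lebesgue)"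
  proof (rule integral_dominated_convergence[where w = "\<lambda>x. \<bar>H x\<bar>"])
    have "(\<lambda>n. indicator (U n) x :: real) \<longlonglongrightarrow> indicator G x" for x
    proof -
      have "eventually (\<lambda>n. indicator (U n) x = (indicator G x :: real)) sequentially"
      proof (cases "x \<in> G")
        case False
        then consider "x \<notin> B" | m where "x \<notin> T m" by (auto simp: G_def)
        then show ?thesis
        proof cases
          case 2
          then show ?thesis using False
            by (intro eventually_sequentiallyI[of m]) (auto simp: U_def indicator_def)
        qed (use False in \<open>auto simp: U_def\<close>)
      qed (auto simp: U_def G_def)
      then show ?thesis by (rule tendsto_eventually)
    qed
    then show "AE x in lebesgue. (\<lambda>n. H x * indicator (U n) x) \<longlonglongrightarrow> H x * indicator G x"
      by (intro AE_I2 tendsto_mult_left)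
    show "AE x in lebesgue. norm (H x * indicator (U n) x) \<le> \<bar>H x\<bar>" for n
      by (auto simp: indicator_def)
    have "U n \<in> sets lebesgue" for n using U(1) by simp
    then show "(\<lambda>x. H x * indicator (U n) x) \<in> borel_measurable lebesgue" for n
      by (intro borel_measurable_times borel_measurable_indicator) auto
  qed (use H G in auto)
  have "0 \<le> (\<integral>x. H x * indicator G x \<partial>lebesgue)"
    using opn[OF U] by (intro LIMSEQ_le_const[OF lim]) auto
  also have "\<dots> = (\<integral>x. H x * indicator A x \<partial>lebesgue)"
  proof (rule integral_cong_AE)
    show "AE x in lebesgue. H x * indicator G x = H x * indicator A x"
      using AE_not_in[OF null] by eventually_elim (use AG in \<open>auto simp: indicator_def\<close>)
  qed (use A G in auto)
  finally have "0 \<le> (\<integral>x. H x * indicator A x \<partial>lebesgue)" .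
  moreover have iA: "integrable lebesgue (\<lambda>x. H x * indicator A x)"
    using integrable_mult_indicator[OF A H] by (simp add: mult.commute)
  moreover have "0 \<le> - (H x * indicator A x)" for x by (auto simp: A_def indicator_def)
  ultimately have "(\<integral>x. - (H x * indicator A x) \<partial>lebesgue) = 0"
    using integral_nonneg_AE[where M = lebesgue and f = "\<lambda>x. - (H x * indicator A x)"] by (simp add: antisym)
  then have "AE x in lebesgue. - (H x * indicator A x) = 0"
    using integral_nonneg_eq_0_iff_AE[where M = lebesgue and f = "\<lambda>x. - (H x * indicator A x)"] iA
      \<open>\<And>x. 0 \<le> - (H x * indicator A x)\<close> by auto
  then show ?thesis
    by eventually_elim (auto simp: A_def indicator_def split: if_splits)
qed

lemma locally_integrable_indicator:
  fixes h :: "real^'n::finite \<Rightarrow> real"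
  assumes "locally_integrable \<Omega> h" "compact K" "K \<subseteq> \<Omega>"
  shows "integrable lebesgue (\<lambda>x. indicator K x * h x)"
proof -
  have "K \<in> sets lebesgue" using \<open>compact K\<close> by (simp add: compact_imp_closed)
  then show ?thesis
    using assms integrable_restrict_space[of K lebesgue h] by (auto simp: locally_integrable_def)
qed

lemma regular_distr_lebesgue:
  assumes "\<Omega> \<in> sets lebesgue"
  shows "regular_distr \<Omega> h \<phi> = (\<integral>x. indicator \<Omega> x * (h x * \<phi> x) \<partial>lebesgue)"
  using assms by (simp add: regular_distr_def integral_restrict_space)

lemma AE_lebesgue_on:
  assumes "\<Omega> \<in> sets lebesgue"
  shows "(AE x in lebesgue_on \<Omega>. P x) \<longleftrightarrow> (AE x in lebesgue. x \<in> \<Omega> \<longrightarrow> P x)"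
  using assms by (simp add: AE_restrict_space_iff)

lemma regular_distr_compact:
  assumes "\<Omega> \<in> sets lebesgue" "K \<subseteq> \<Omega>" "\<And>x. x \<notin> K \<Longrightarrow> \<phi> x = 0"
  shows "regular_distr \<Omega> h \<phi> = (\<integral>x. indicator K x * h x * \<phi> x \<partial>lebesgue)"
  unfolding regular_distr_lebesgue[OF assms(1)]
  by (rule Bochner_Integration.integral_cong) (use assms in \<open>auto simp: indicator_def\<close>)

text \<open>Countably many balls with closure in \<Omega> cover \<Omega>, and local integrability
  makes \<open>h\<close> integrable on each; the exceptional null sets can then be united.\<close>

theorem nonneg_distr_imp_nonneg_AE:
  fixes h :: "real^'n::finite \<Rightarrow> real"
  assumes \<Omega>: "open \<Omega>" and h: "locally_integrable \<Omega> h"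
    and pos: "\<And>\<phi>. test_function \<Omega> \<phi> \<Longrightarrow> (\<And>x. 0 \<le> \<phi> x) \<Longrightarrow> 0 \<le> regular_distr \<Omega> h \<phi>"
  shows "AE x in lebesgue_on \<Omega>. 0 \<le> h x"
proof (cases "\<Omega> = {}")
  case False
  have \<Omega>': "\<Omega> \<in> sets lebesgue" using \<Omega> by simp
  obtain c r where cr: "\<And>n::nat. 0 < r n" "\<And>n. cball (c n) (r n) \<subseteq> \<Omega>" "(\<Union>n. ball (c n) (r n)) = \<Omega>"
    using open_Union_balls[OF \<Omega> False] by metis
  have "AE x in lebesgue. x \<in> ball (c n) (r n) \<longrightarrow> 0 \<le> indicator (cball (c n) (r n)) x * h x" for n
  proof (rule nonneg_distr_imp_nonneg_AE_integrable)
    show "integrable lebesgue (\<lambda>x. indicator (cball (c n) (r n)) x * h x)"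
      by (rule locally_integrable_indicator[OF h _ cr(2)]) simp
    fix \<phi> :: "real^'n \<Rightarrow> real" assume \<phi>: "test_function (ball (c n) (r n)) \<phi>" "\<And>x. 0 \<le> \<phi> x"
    obtain K where K: "compact K" "K \<subseteq> ball (c n) (r n)" "\<And>x. x \<notin> K \<Longrightarrow> \<phi> x = 0"
      using \<phi>(1) test_functionE by blast
    have "test_function \<Omega> \<phi>" using \<phi>(1) cr(2)[of n] ball_subset_cball by (fastforce simp: test_function_def)
    from pos[OF this \<phi>(2)] have "0 \<le> regular_distr \<Omega> h \<phi>" .
    also have "\<dots> = (\<integral>x. indicator (cball (c n) (r n)) x * h x * \<phi> x \<partial>lebesgue)"
      by (rule regular_distr_compact[OF \<Omega>' cr(2)]) (use K(2,3) ball_subset_cball in blast)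
    finally show "0 \<le> (\<integral>x. indicator (cball (c n) (r n)) x * h x * \<phi> x \<partial>lebesgue)" .
  qed simp
  then have "AE x in lebesgue. \<forall>n. x \<in> ball (c n) (r n) \<longrightarrow> 0 \<le> indicator (cball (c n) (r n)) x * h x"
    unfolding AE_all_countable by blast
  then show ?thesis
    unfolding AE_lebesgue_on[OF \<Omega>']
  proof eventually_elim
    case (elim x)
    show ?case
    proof
      assume "x \<in> \<Omega>"
      then obtain n where n: "x \<in> ball (c n) (r n)" using cr(3) by blast
      with ball_subset_cball have "x \<in> cball (c n) (r n)" by blast
      with elim n show "0 \<le> h x" by fastforce
    qed
  qed
qed (simp add: AE_lebesgue_on)

lemma locally_integrable_uminus:
  fixes f :: "real^'n::finite \<Rightarrow> real"
  shows "locally_integrable \<Omega> f \<Longrightarrow> locally_integrable \<Omega> (\<lambda>x. - f x)"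
  by (simp add: locally_integrable_def)

lemma locally_integrable_diff:
  fixes f g :: "real^'n::finite \<Rightarrow> real"
  shows "locally_integrable \<Omega> f \<Longrightarrow> locally_integrable \<Omega> g \<Longrightarrow> locally_integrable \<Omega> (\<lambda>x. f x - g x)"
  by (simp add: locally_integrable_def)

lemma zero_distr_imp_zero_AE:
  fixes h :: "real^'n::finite \<Rightarrow> real"
  assumes \<Omega>: "open \<Omega>" and h: "locally_integrable \<Omega> h"
    and zero: "\<And>\<phi>. test_function \<Omega> \<phi> \<Longrightarrow> regular_distr \<Omega> h \<phi> = 0"
  shows "AE x in lebesgue_on \<Omega>. h x = 0"
proof -
  have "regular_distr \<Omega> (\<lambda>x. - h x) \<phi> = - regular_distr \<Omega> h \<phi>" for \<phi>
    by (simp add: regular_distr_def)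
  then have "AE x in lebesgue_on \<Omega>. 0 \<le> - h x"
    by (intro nonneg_distr_imp_nonneg_AE[OF \<Omega> locally_integrable_uminus[OF h]]) (simp add: zero)
  moreover have "AE x in lebesgue_on \<Omega>. 0 \<le> h x"
    by (intro nonneg_distr_imp_nonneg_AE[OF \<Omega> h]) (simp add: zero)
  ultimately show ?thesis by eventually_elim simp
qed

subsection \<open>Vanishing of the velocity\<close>

lemma integrable_mult_test_function:
  fixes h :: "real^'n::finite \<Rightarrow> real"
  assumes \<Omega>: "\<Omega> \<in> sets lebesgue" and h: "locally_integrable \<Omega> h" and \<phi>: "test_function \<Omega> \<phi>"
  shows "integrable (lebesgue_on \<Omega>) (\<lambda>x. h x * \<phi> x)"
proof -
  obtain K where K: "compact K" "K \<subseteq> \<Omega>" "\<And>x. x \<notin> K \<Longrightarrow> \<phi> x = 0"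
    using \<phi> test_functionE by blast
  have cont: "continuous_on UNIV \<phi>" using Ck_continuous[OF test_function_Ck[OF \<phi>]] .
  obtain B where B: "0 \<le> B" "\<And>x. \<bar>\<phi> x\<bar> \<le> B"
    using compact_support_bounded[OF cont K(1,3)] by blast
  have "integrable lebesgue (\<lambda>x. (indicator K x * h x) * \<phi> x)"
    by (rule integrable_mult_bounded_continuous[OF locally_integrable_indicator[OF h K(1,2)] cont B(2)])
  also have "(\<lambda>x. (indicator K x * h x) * \<phi> x) = (\<lambda>x. indicator \<Omega> x *\<^sub>R (h x * \<phi> x))"
  proof
    fix x show "(indicator K x * h x) * \<phi> x = indicator \<Omega> x *\<^sub>R (h x * \<phi> x)"
      using K(2) K(3)[of x] by (cases "x \<in> K") auto
  qed
  finally show ?thesis using \<Omega> by (simp add: integrable_restrict_space)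
qed

lemma regular_distr_diff:
  fixes f h :: "real^'n::finite \<Rightarrow> real"
  assumes "\<Omega> \<in> sets lebesgue" "locally_integrable \<Omega> f" "locally_integrable \<Omega> h" "test_function \<Omega> \<phi>"
  shows "regular_distr \<Omega> (\<lambda>x. f x - h x) \<phi> = regular_distr \<Omega> f \<phi> - regular_distr \<Omega> h \<phi>"
  unfolding regular_distr_def left_diff_distrib
  by (intro Bochner_Integration.integral_diff integrable_mult_test_function assms)

lemma regular_distr_cong_AE:
  assumes "AE x in lebesgue_on \<Omega>. f x = h x"
    "f \<in> borel_measurable (lebesgue_on \<Omega>)" "h \<in> borel_measurable (lebesgue_on \<Omega>)"
    "\<phi> \<in> borel_measurable (lebesgue_on \<Omega>)"
  shows "regular_distr \<Omega> f \<phi> = regular_distr \<Omega> h \<phi>"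
  unfolding regular_distr_def
  by (intro integral_cong_AE borel_measurable_times assms) (use assms(1) in eventually_elim, simp)

section \<open>Weak derivatives and the space \<open>W12_0\<close>\<close>

lemma has_weak_partial_unique:
  fixes f :: "real^'n::finite \<Rightarrow> real"
  assumes \<Omega>: "open \<Omega>" and h: "has_weak_partial \<Omega> i f h" and h': "has_weak_partial \<Omega> i f h'"
  shows "AE x in lebesgue_on \<Omega>. h x = h' x"
proof -
  have li: "locally_integrable \<Omega> h" "locally_integrable \<Omega> h'"
    using h h' by (auto simp: has_weak_partial_def)
  have "AE x in lebesgue_on \<Omega>. h x - h' x = 0"
  proof (rule zero_distr_imp_zero_AE[OF \<Omega> locally_integrable_diff[OF li]])
    fix \<phi> :: "real^'n \<Rightarrow> real" assume \<phi>: "test_function \<Omega> \<phi>"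
    have "\<Omega> \<in> sets lebesgue" using \<Omega> by simp
    from regular_distr_diff[OF this li \<phi>] show "regular_distr \<Omega> (\<lambda>x. h x - h' x) \<phi> = 0"
      using h h' \<phi> by (simp add: has_weak_partial_def)
  qed
  then show ?thesis by simp
qed

lemma has_weak_partial_weak_partial:
  "has_weak_partial \<Omega> i f h \<Longrightarrow> has_weak_partial \<Omega> i f (weak_partial \<Omega> i f)"
  unfolding weak_partial_def by (rule someI[of "has_weak_partial \<Omega> i f"])

lemma weak_partial_AE_eq:
  fixes f :: "real^'n::finite \<Rightarrow> real"
  assumes "open \<Omega>" "has_weak_partial \<Omega> i f h"
  shows "AE x in lebesgue_on \<Omega>. weak_partial \<Omega> i f x = h x"
  using has_weak_partial_unique[OF assms(1) has_weak_partial_weak_partial[OF assms(2)] assms(2)] .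

lemma locally_integrable_continuous:
  fixes f :: "real^'n::finite \<Rightarrow> real"
  assumes "continuous_on UNIV f" shows "locally_integrable \<Omega> f"
  unfolding locally_integrable_def
proof (intro allI impI, elim conjE)
  fix K :: "(real^'n) set" assume K: "compact K"
  have "integrable lborel (\<lambda>x. indicator K x *\<^sub>R f x)"
    using assms K by (intro borel_integrable_compact) (auto intro: continuous_on_subset)
  then have "integrable lebesgue (\<lambda>x. indicator K x *\<^sub>R f x)"
    using borel_measurable_integrable[of lborel] integrable_completion[of _ lborel] by blast
  then show "integrable (lebesgue_on K) f"
    using K by (simp add: integrable_restrict_space compact_imp_closed)
qed

lemma integral_lebesgue_on_eq:
  fixes f :: "'a::euclidean_space \<Rightarrow> real"
  assumes "\<Omega> \<in> sets lebesgue" "\<And>x. x \<notin> \<Omega> \<Longrightarrow> f x = 0"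
  shows "integral\<^sup>L (lebesgue_on \<Omega>) f = integral\<^sup>L lebesgue f"
proof -
  have "integral\<^sup>L (lebesgue_on \<Omega>) f = (\<integral>x. indicator \<Omega> x *\<^sub>R f x \<partial>lebesgue)"
    using assms(1) by (simp add: integral_restrict_space)
  also have "(\<lambda>x. indicator \<Omega> x *\<^sub>R f x) = f"
  proof
    fix x show "indicator \<Omega> x *\<^sub>R f x = f x" using assms(2)[of x] by (cases "x \<in> \<Omega>") auto
  qed
  finally show ?thesis .
qed

lemma test_function_eq_0: "test_function \<Omega> \<phi> \<Longrightarrow> x \<notin> \<Omega> \<Longrightarrow> \<phi> x = 0"
  by (meson test_functionE subsetD)

lemma has_weak_partial_C1:
  fixes f :: "real^'n::finite \<Rightarrow> real"
  assumes \<Omega>: "open \<Omega>" and f: "Ck (Suc 0) f"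
  shows "has_weak_partial \<Omega> i f (partial_deriv i f)"
  unfolding has_weak_partial_def
proof (intro conjI allI impI)
  show "locally_integrable \<Omega> f" "locally_integrable \<Omega> (partial_deriv i f)"
    using f Ck_continuous[OF f] by (auto intro!: locally_integrable_continuous)
  fix \<phi> :: "real^'n \<Rightarrow> real" assume \<phi>: "test_function \<Omega> \<phi>"
  have \<Omega>': "\<Omega> \<in> sets lebesgue" using \<Omega> by simp
  obtain K where K: "compact K" "K \<subseteq> \<Omega>" "\<And>x. x \<notin> K \<Longrightarrow> \<phi> x = 0"
    using \<phi> test_functionE by blast
  have "regular_distr \<Omega> (partial_deriv i f) \<phi> = (\<integral>x. \<phi> x * partial_deriv i f x \<partial>lebesgue)"
    unfolding regular_distr_def using test_function_eq_0[OF \<phi>]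
    by (subst integral_lebesgue_on_eq[OF \<Omega>']) (simp_all add: mult.commute)
  also have "\<dots> = - (\<integral>x. partial_deriv i \<phi> x * f x \<partial>lebesgue)"
    using integration_by_parts_compact[OF test_function_Ck[OF \<phi>] f K(1,3)] by simp
  also have "(\<integral>x. partial_deriv i \<phi> x * f x \<partial>lebesgue) = regular_distr \<Omega> f (partial_deriv i \<phi>)"
    unfolding regular_distr_def using test_function_eq_0[OF test_function_partial_deriv[OF \<phi>]]
    by (subst integral_lebesgue_on_eq[OF \<Omega>']) (simp_all add: mult.commute)
  finally show "regular_distr \<Omega> (partial_deriv i f) \<phi> = distr_deriv i (regular_distr \<Omega> f) \<phi>"
    by (simp add: distr_deriv_def)
qed

lemma has_weak_partial_diff:
  fixes f f' :: "real^'n::finite \<Rightarrow> real"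
  assumes \<Omega>: "open \<Omega>" and h: "has_weak_partial \<Omega> i f h" and h': "has_weak_partial \<Omega> i f' h'"
  shows "has_weak_partial \<Omega> i (\<lambda>x. f x - f' x) (\<lambda>x. h x - h' x)"
proof -
  have \<Omega>': "\<Omega> \<in> sets lebesgue" using \<Omega> by simp
  have li: "locally_integrable \<Omega> f" "locally_integrable \<Omega> f'" "locally_integrable \<Omega> h" "locally_integrable \<Omega> h'"
    using h h' by (auto simp: has_weak_partial_def)
  show ?thesis
    unfolding has_weak_partial_def
  proof (intro conjI allI impI)
    fix \<phi> :: "real^'n \<Rightarrow> real" assume \<phi>: "test_function \<Omega> \<phi>"
    show "regular_distr \<Omega> (\<lambda>x. h x - h' x) \<phi> = distr_deriv i (regular_distr \<Omega> (\<lambda>x. f x - f' x)) \<phi>"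
      using h h' \<phi> by (simp add: has_weak_partial_def distr_deriv_def regular_distr_diff[OF \<Omega>' li(3,4) \<phi>]
        regular_distr_diff[OF \<Omega>' li(1,2) test_function_partial_deriv[OF \<phi>]])
  qed (intro locally_integrable_diff li)+
qed

definition square_integrable :: "'a measure \<Rightarrow> ('a \<Rightarrow> real) \<Rightarrow> bool" where
  "square_integrable M f \<longleftrightarrow> f \<in> borel_measurable M \<and> integrable M (\<lambda>x. (f x)\<^sup>2)"

lemma in_Lp_2_iff: "in_Lp 2 \<Omega> f \<longleftrightarrow> square_integrable (lebesgue_on \<Omega>) f"
proof -
  have "\<bar>y\<bar> powr 2 = y\<^sup>2" for y :: real
    by (cases "y = 0") (simp_all add: powr_numeral)
  then show ?thesis by (simp add: in_Lp_def square_integrable_def)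
qed

lemma square_integrable_mult:
  assumes "square_integrable M f" "square_integrable M h"
  shows "integrable M (\<lambda>x. f x * h x)"
proof (rule Bochner_Integration.integrable_bound)
  show "integrable M (\<lambda>x. (f x)\<^sup>2 + (h x)\<^sup>2)" "(\<lambda>x. f x * h x) \<in> borel_measurable M"
    using assms by (auto simp: square_integrable_def)
  have "\<bar>a * b\<bar> \<le> a\<^sup>2 + b\<^sup>2" for a b :: real
    using sum_squares_bound[of "\<bar>a\<bar>" "\<bar>b\<bar>"] mult_nonneg_nonneg[OF abs_ge_zero abs_ge_zero, of a b]
    unfolding abs_mult power2_abs by linarith
  then show "AE x in M. norm (f x * h x) \<le> norm ((f x)\<^sup>2 + (h x)\<^sup>2)"
    by simp
qed

lemma square_integrable_diff:
  assumes "square_integrable M f" "square_integrable M h"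
  shows "square_integrable M (\<lambda>x. f x - h x)"
proof -
  have "integrable M (\<lambda>x. (f x)\<^sup>2 + (h x)\<^sup>2 - 2 * (f x * h x))"
    using assms square_integrable_mult[OF assms] by (auto simp: square_integrable_def)
  moreover have "(\<lambda>x. f x - h x) \<in> borel_measurable M"
    using assms by (auto simp: square_integrable_def intro: borel_measurable_diff)
  ultimately show ?thesis
    by (simp add: square_integrable_def power2_diff mult.assoc)
qed

lemma square_integrable_cong_AE:
  assumes "square_integrable M f" "AE x in M. f x = h x" "h \<in> borel_measurable M"
  shows "square_integrable M h" "integral\<^sup>L M (\<lambda>x. (f x)\<^sup>2) = integral\<^sup>L M (\<lambda>x. (h x)\<^sup>2)"
proof -
  have ae: "AE x in M. (f x)\<^sup>2 = (h x)\<^sup>2" using assms(2) by eventually_elim simp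
  have m: "(\<lambda>x. (f x)\<^sup>2) \<in> borel_measurable M" "(\<lambda>x. (h x)\<^sup>2) \<in> borel_measurable M"
    using assms by (auto simp: square_integrable_def)
  show "square_integrable M h"
    using assms integrable_cong_AE[OF m ae] by (simp add: square_integrable_def)
  show "integral\<^sup>L M (\<lambda>x. (f x)\<^sup>2) = integral\<^sup>L M (\<lambda>x. (h x)\<^sup>2)"
    by (rule integral_cong_AE[OF m ae])
qed

lemma square_integrable_test_function:
  fixes \<phi> :: "real^'n::finite \<Rightarrow> real"
  assumes \<Omega>: "\<Omega> \<in> sets lebesgue" and \<phi>: "test_function \<Omega> \<phi>"
  shows "square_integrable (lebesgue_on \<Omega>) \<phi>"
proof -
  obtain K where K: "compact K" "K \<subseteq> \<Omega>" "\<And>x. x \<notin> K \<Longrightarrow> \<phi> x = 0"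
    using \<phi> test_functionE by blast
  have cont: "continuous_on UNIV \<phi>" using Ck_continuous[OF test_function_Ck[OF \<phi>]] .
  have "integrable lebesgue (\<lambda>x. (\<phi> x)\<^sup>2)"
    using cont K by (intro integrable_compact_support[of _ K] continuous_intros) auto
  then have "integrable (lebesgue_on \<Omega>) (\<lambda>x. (\<phi> x)\<^sup>2)"
    using integrable_mult_indicator[OF \<Omega>, of "\<lambda>x. (\<phi> x)\<^sup>2"] \<Omega> by (simp add: integrable_restrict_space)
  then show ?thesis
    using continuous_borel_measurable_lebesgue[OF cont]
    by (simp add: square_integrable_def measurable_restrict_space1)
qed

text \<open>Finite unions of closed balls exhaust \<Omega> by compact sets, so \<open>h\<close> is
  on \<Omega> a pointwise limit of measurable functions.\<close>

lemma locally_integrable_measurable: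
  fixes h :: "real^'n::finite \<Rightarrow> real"
  assumes \<Omega>: "open \<Omega>" and h: "locally_integrable \<Omega> h"
  shows "h \<in> borel_measurable (lebesgue_on \<Omega>)"
proof (cases "\<Omega> = {}")
  case False
  obtain c r where cr: "\<And>n::nat. 0 < r n" "\<And>n. cball (c n) (r n) \<subseteq> \<Omega>" "(\<Union>n. ball (c n) (r n)) = \<Omega>"
    using open_Union_balls[OF \<Omega> False] by metis
  define K where "K = (\<lambda>n. \<Union>i<n. cball (c i) (r i))"
  have K: "compact (K n)" "K n \<subseteq> \<Omega>" for n
    using cr(2) by (auto simp: K_def intro!: compact_UN)
  have "(\<lambda>x. indicator \<Omega> x * h x) \<in> borel_measurable lebesgue"
  proof (rule borel_measurable_LIMSEQ_real)
    show "(\<lambda>x. indicator (K n) x * h x) \<in> borel_measurable lebesgue" for n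
      using locally_integrable_indicator[OF h K] by (rule borel_measurable_integrable)
    fix x
    show "(\<lambda>n. indicator (K n) x * h x) \<longlonglongrightarrow> indicator \<Omega> x * h x"
    proof (cases "x \<in> \<Omega>")
      case True
      then obtain m where "x \<in> ball (c m) (r m)" using cr(3) by blast
      then have m: "x \<in> cball (c m) (r m)" using ball_subset_cball by blast
      have "indicator (K n) x * h x = indicator \<Omega> x * h x" if "n \<ge> Suc m" for n
      proof -
        have "x \<in> K n" using m that unfolding K_def by (intro UN_I[of m]) auto
        then show ?thesis using True by simp
      qed
      then show ?thesis
        by (intro tendsto_eventually eventually_sequentiallyI[of "Suc m"])
    next
      case False
      then have "x \<notin> K n" for n using K(2) by blast
      then show ?thesis using False by simp
    qed
  qed
  then show ?thesis
    using \<Omega> by (simp add: borel_measurable_restrict_space_iff)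
qed (simp add: space_restrict_space measurable_def)

text \<open>The norm of \<open>f - \<phi> n\<close> involves a weak derivative chosen for that
  difference, with no formal link to the one chosen for \<open>f\<close>. Uniqueness almost
  everywhere replaces it by the weak derivative of \<open>f\<close> minus the classical derivative
  of \<open>\<phi> n\<close>. The squared norm is a sum of nonnegative terms, so each of them tends
  to zero.\<close>

lemma in_W12_0_approx:
  fixes f :: "real^'n::finite \<Rightarrow> real"
  assumes \<Omega>: "open \<Omega>" and f: "in_W12_0 \<Omega> f"
  obtains \<phi> where "\<And>n::nat. test_function \<Omega> (\<phi> n)"
    "(\<lambda>n. integral\<^sup>L (lebesgue_on \<Omega>) (\<lambda>x. (f x - \<phi> n x)\<^sup>2)) \<longlonglongrightarrow> 0"
    "\<And>i. (\<lambda>n. integral\<^sup>L (lebesgue_on \<Omega>) (\<lambda>x. (weak_partial \<Omega> i f x - partial_deriv i (\<phi> n) x)\<^sup>2)) \<longlonglongrightarrow> 0"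
    and "square_integrable (lebesgue_on \<Omega>) f" "\<And>i. square_integrable (lebesgue_on \<Omega>) (weak_partial \<Omega> i f)"
proof -
  have \<Omega>': "\<Omega> \<in> sets lebesgue" using \<Omega> by simp
  obtain \<phi> where \<phi>: "\<And>n::nat. test_function \<Omega> (\<phi> n)"
    and lim: "(\<lambda>n. W12_norm \<Omega> (\<lambda>x. f x - \<phi> n x)) \<longlonglongrightarrow> 0"
    using f unfolding in_W12_0_def by metis
  have sq: "square_integrable (lebesgue_on \<Omega>) f"
    using f by (simp add: in_W12_0_def in_W12_def in_Lp_2_iff)
  have "\<exists>h. has_weak_partial \<Omega> i f h \<and> square_integrable (lebesgue_on \<Omega>) h" for i
    using f by (simp add: in_W12_0_def in_W12_def in_Lp_2_iff)
  then obtain h where h: "\<And>i. has_weak_partial \<Omega> i f (h i)" "\<And>i. square_integrable (lebesgue_on \<Omega>) (h i)"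
    by metis
  have wp: "has_weak_partial \<Omega> i f (weak_partial \<Omega> i f)" for i
    using has_weak_partial_weak_partial[OF h(1)] .
  have wpm: "weak_partial \<Omega> i f \<in> borel_measurable (lebesgue_on \<Omega>)" for i
    using wp locally_integrable_measurable[OF \<Omega>] by (auto simp: has_weak_partial_def)
  have sqw: "square_integrable (lebesgue_on \<Omega>) (weak_partial \<Omega> i f)" for i
  proof (rule square_integrable_cong_AE(1)[OF h(2) _ wpm])
    show "AE x in lebesgue_on \<Omega>. h i x = weak_partial \<Omega> i f x"
      using weak_partial_AE_eq[OF \<Omega> h(1)[of i]] by eventually_elim simp
  qed
  have sqd: "square_integrable (lebesgue_on \<Omega>) (\<lambda>x. weak_partial \<Omega> i f x - partial_deriv i (\<phi> n) x)" for i n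
    by (intro square_integrable_diff sqw square_integrable_test_function[OF \<Omega>'] test_function_partial_deriv \<phi>)
  have hd: "has_weak_partial \<Omega> i (\<lambda>x. f x - \<phi> n x) (\<lambda>x. weak_partial \<Omega> i f x - partial_deriv i (\<phi> n) x)" for i n
    by (intro has_weak_partial_diff[OF \<Omega> wp] has_weak_partial_C1[OF \<Omega>] test_function_Ck[OF \<phi>])
  have hdm: "weak_partial \<Omega> i (\<lambda>x. f x - \<phi> n x) \<in> borel_measurable (lebesgue_on \<Omega>)" for i n
    using has_weak_partial_weak_partial[OF hd] locally_integrable_measurable[OF \<Omega>] by (auto simp: has_weak_partial_def)
  define a where "a = (\<lambda>n. integral\<^sup>L (lebesgue_on \<Omega>) (\<lambda>x. (f x - \<phi> n x)\<^sup>2))"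
  define b where "b = (\<lambda>i n. integral\<^sup>L (lebesgue_on \<Omega>) (\<lambda>x. (weak_partial \<Omega> i f x - partial_deriv i (\<phi> n) x)\<^sup>2))"
  have ab: "0 \<le> a n" "0 \<le> b i n" for i n
    by (simp_all add: a_def b_def)
  have b: "integral\<^sup>L (lebesgue_on \<Omega>) (\<lambda>x. (weak_partial \<Omega> i (\<lambda>x. f x - \<phi> n x) x)\<^sup>2) = b i n" for i n
    unfolding b_def
  proof (rule square_integrable_cong_AE(2)[OF sqd _ hdm, symmetric])
    show "AE x in lebesgue_on \<Omega>. weak_partial \<Omega> i f x - partial_deriv i (\<phi> n) x = weak_partial \<Omega> i (\<lambda>x. f x - \<phi> n x) x"
      using weak_partial_AE_eq[OF \<Omega> hd[where i = i and n = n]] by eventually_elim simp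
  qed
  have nrm: "W12_norm \<Omega> (\<lambda>x. f x - \<phi> n x) = sqrt (a n + (\<Sum>i\<in>UNIV. b i n))" for n
    unfolding W12_norm_def b a_def ..
  have "(\<lambda>n. (W12_norm \<Omega> (\<lambda>x. f x - \<phi> n x))\<^sup>2) \<longlonglongrightarrow> 0\<^sup>2"
    by (rule tendsto_power[OF lim])
  then have S: "(\<lambda>n. a n + (\<Sum>i\<in>UNIV. b i n)) \<longlonglongrightarrow> 0"
    using ab by (simp add: nrm sum_nonneg)
  have "a \<longlonglongrightarrow> 0"
    by (rule tendsto_sandwich[OF _ _ tendsto_const S]) (use ab in \<open>auto simp: sum_nonneg\<close>)
  moreover have "b i \<longlonglongrightarrow> 0" for i
  proof (rule tendsto_sandwich[OF _ _ tendsto_const S])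
    have "b i n \<le> a n + (\<Sum>i\<in>UNIV. b i n)" for n
      using member_le_sum[of i UNIV "\<lambda>i. b i n"] ab(1)[of n] ab(2) by (simp add: add_increasing)
    then show "\<forall>\<^sub>F n in sequentially. b i n \<le> a n + (\<Sum>i\<in>UNIV. b i n)" by simp
  qed (use ab in simp)
  ultimately show thesis
    by (intro that[OF \<phi>] sq sqw) (simp_all add: a_def b_def)
qed

section \<open>Estimates of Poincare and Korn type\<close>

lemma poincare_test_function:
  fixes \<phi> :: "real^'n::finite \<Rightarrow> real"
  assumes \<phi>: "test_function \<Omega> \<phi>" and R: "\<And>x. x \<in> \<Omega> \<Longrightarrow> norm x \<le> R"
  shows "(\<integral>x. (\<phi> x)\<^sup>2 \<partial>lebesgue) \<le> 4 * R\<^sup>2 * (\<integral>x. (partial_deriv i \<phi> x)\<^sup>2 \<partial>lebesgue)"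
proof -
  obtain K where K: "compact K" "K \<subseteq> \<Omega>" "\<And>x. x \<notin> K \<Longrightarrow> \<phi> x = 0"
    using \<phi> test_functionE by blast
  have c: "continuous_on UNIV \<phi>" "continuous_on UNIV (partial_deriv i \<phi>)"
    using Ck_continuous[OF test_function_Ck] \<phi> test_function_partial_deriv by blast+
  have z: "partial_deriv i \<phi> x = 0" if "x \<notin> K" for x
    by (rule partial_deriv_outside_compact[OF K(1,3) that])
  have 1: "partial_deriv i (\<lambda>x. \<phi> x * \<phi> x) x = 2 * (\<phi> x * partial_deriv i \<phi> x)" for x
  proof -
    have "partial_deriv i (\<lambda>x. \<phi> x * \<phi> x) = (\<lambda>x. \<phi> x * partial_deriv i \<phi> x + partial_deriv i \<phi> x * \<phi> x)"
      by (rule Ck_SucI(2)[OF Ck_mult_partial, where k = 0])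
        (use c \<phi> Ck_continuous[OF test_function_Ck[OF test_function_partial_deriv[OF \<phi>]]] in
          \<open>auto intro!: continuous_intros test_function_differentiable[OF \<phi>]\<close>)
    then show ?thesis by simp
  qed
  have 2: "partial_deriv i (\<lambda>x. x $ i) x = 1" for x :: "real^'n"
  proof -
    have "((\<lambda>x::real^'n. x $ i) has_derivative (\<lambda>x. x $ i)) (at x)"
      by (intro bounded_linear_imp_has_derivative bounded_linear_vec_nth)
    from partial_deriv_eqI[OF this, of i] show ?thesis by (simp add: axis_def)
  qed
  \<comment> \<open>The integrand \<open>\<phi>\<^sup>2\<close> is read as
    \<open>\<phi>\<^sup>2\<close> times the derivative of \<open>x $ i\<close> and integrated by
    parts. Half of the integral of \<open>\<phi>\<^sup>2\<close> is absorbed on the left afterwards,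
    which doubles \<open>2 * R\<^sup>2\<close> into the constant
    \<open>4 * R\<^sup>2\<close>.\<close>
  have "(\<integral>x. partial_deriv i (\<lambda>x. \<phi> x * \<phi> x) x * x $ i \<partial>lebesgue) =
    - (\<integral>x. (\<phi> x * \<phi> x) * partial_deriv i (\<lambda>x. x $ i) x \<partial>lebesgue)"
    using K(3) by (intro integration_by_parts_compact[OF _ _ K(1)] Ck_mult Ck_nth test_function_Ck[OF \<phi>]) simp
  then have eq: "(\<integral>x. (\<phi> x)\<^sup>2 \<partial>lebesgue) = (\<integral>x. - (2 * (\<phi> x * partial_deriv i \<phi> x) * x $ i) \<partial>lebesgue)"
    by (simp add: 1 2 power2_eq_square)
  have i1: "integrable lebesgue (\<lambda>x. - (2 * (\<phi> x * partial_deriv i \<phi> x) * x $ i))"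
    using K c by (intro integrable_compact_support[of _ K] continuous_intros) auto
  have i2: "integrable lebesgue (\<lambda>x. (\<phi> x)\<^sup>2)" "integrable lebesgue (\<lambda>x. (partial_deriv i \<phi> x)\<^sup>2)"
    using K c z by (auto intro!: integrable_compact_support[of _ K] continuous_intros)
  have "(\<integral>x. - (2 * (\<phi> x * partial_deriv i \<phi> x) * x $ i) \<partial>lebesgue) \<le>
     (\<integral>x. (1/2) * (\<phi> x)\<^sup>2 + 2 * R\<^sup>2 * (partial_deriv i \<phi> x)\<^sup>2 \<partial>lebesgue)"
  proof (rule integral_mono)
    fix x
    show "- (2 * (\<phi> x * partial_deriv i \<phi> x) * x $ i) \<le> (1/2) * (\<phi> x)\<^sup>2 + 2 * R\<^sup>2 * (partial_deriv i \<phi> x)\<^sup>2"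
    proof (cases "x \<in> K")
      case True
      have "(x $ i)\<^sup>2 \<le> R\<^sup>2"
        using order_trans[OF component_le_norm_cart R] True K(2) by (metis abs_ge_zero power2_abs power_mono subsetD)
      then have "(partial_deriv i \<phi> x)\<^sup>2 * (x $ i)\<^sup>2 \<le> (partial_deriv i \<phi> x)\<^sup>2 * R\<^sup>2"
        by (intro mult_left_mono) auto
      \<comment> \<open>Young's inequality with weights 1/2 and 2, written as a square.\<close>
      moreover have "0 \<le> (\<phi> x + 2 * (partial_deriv i \<phi> x * x $ i))\<^sup>2" by simp
      ultimately show ?thesis by (simp add: power2_sum power_mult_distrib mult_ac)
    qed (use K(3) z in simp)
  qed (use i1 i2 in auto)
  also have "\<dots> = (1/2) * (\<integral>x. (\<phi> x)\<^sup>2 \<partial>lebesgue) + 2 * R\<^sup>2 * (\<integral>x. (partial_deriv i \<phi> x)\<^sup>2 \<partial>lebesgue)"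
    using i2 by simp
  finally show ?thesis using eq by simp
qed

text \<open>This is the stress contracted with the gradient \<open>A\<close>. The three double sums
  are the squared norm of \<open>A\<close>, the product of \<open>A\<close> with its transpose, and
  the squared trace; they are kept apart because integration by parts relates the second to the
  third.\<close>

definition viscous_form :: "real \<Rightarrow> real \<Rightarrow> real^3^3 \<Rightarrow> real" where
  "viscous_form \<mu> lam A = \<mu> * (\<Sum>i\<in>UNIV. \<Sum>j\<in>UNIV. A $ i $ j * A $ i $ j) + \<mu> * (\<Sum>i\<in>UNIV. \<Sum>j\<in>UNIV. A $ i $ j * A $ j $ i)
     + (lam - 2 / 3 * \<mu>) * (\<Sum>i\<in>UNIV. \<Sum>j\<in>UNIV. A $ i $ i * A $ j $ j)"

lemma stress_inner_eq_viscous_form: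
  "stress \<mu> lam \<Omega> v x \<bullet> weak_grad \<Omega> v x = viscous_form \<mu> lam (weak_grad \<Omega> v x)"
  unfolding stress_def viscous_form_def weak_div_def Let_def
  by (simp add: inner_vec_def sum_3 trace_def transpose_def mat_def algebra_simps)

text \<open>The coefficient 2/3 makes the shear part of the stress trace-free in dimension three, so
  shear sees the diagonal only through differences of its entries, and everything is a sum of
  squares.\<close>

lemma viscous_form_nonneg:
  assumes "\<mu> \<ge> 0" "lam \<ge> 0" shows "0 \<le> viscous_form \<mu> lam A"
proof -
  have "viscous_form \<mu> lam A = \<mu> * ((A$1$2 + A$2$1)\<^sup>2 + (A$1$3 + A$3$1)\<^sup>2 + (A$2$3 + A$3$2)\<^sup>2)
     + 2 / 3 * \<mu> * ((A$1$1 - A$2$2)\<^sup>2 + (A$1$1 - A$3$3)\<^sup>2 + (A$2$2 - A$3$3)\<^sup>2)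
     + lam * (A$1$1 + A$2$2 + A$3$3)\<^sup>2"
    by (simp add: viscous_form_def sum_3 power2_eq_square algebra_simps)
  then show ?thesis using assms by simp
qed

text \<open>The form is \<open>2 * \<mu>\<close> times the squared norm on trace-free symmetric
  matrices, \<open>3 * lam\<close> times it on multiples of the identity, and zero on antisymmetric
  matrices; the sum of the two factors serves for all. The slack is again a sum of squares.\<close>

lemma viscous_form_le:
  assumes "\<mu> \<ge> 0" "lam \<ge> 0"
  shows "viscous_form \<mu> lam A \<le> (2 * \<mu> + 3 * lam) * (\<Sum>i\<in>UNIV. \<Sum>j\<in>UNIV. (A $ i $ j)\<^sup>2)"
proof -
  have "(2 * \<mu> + 3 * lam) * (\<Sum>i\<in>UNIV. \<Sum>j\<in>UNIV. (A $ i $ j)\<^sup>2) - viscous_form \<mu> lam A =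
     \<mu> * ((A$1$2 - A$2$1)\<^sup>2 + (A$1$3 - A$3$1)\<^sup>2 + (A$2$3 - A$3$2)\<^sup>2)
     + 2 / 3 * \<mu> * (A$1$1 + A$2$2 + A$3$3)\<^sup>2
     + lam * ((A$1$1 - A$2$2)\<^sup>2 + (A$1$1 - A$3$3)\<^sup>2 + (A$2$2 - A$3$3)\<^sup>2)
     + 3 * lam * ((A$1$2)\<^sup>2 + (A$2$1)\<^sup>2 + (A$1$3)\<^sup>2 + (A$3$1)\<^sup>2 + (A$2$3)\<^sup>2 + (A$3$2)\<^sup>2)"
    by (simp add: viscous_form_def sum_3 power2_eq_square algebra_simps)
  moreover have "\<dots> \<ge> 0" using assms by simp
  ultimately show ?thesis by linarith
qed

text \<open>A parallelogram identity: it lets the approximating gradients inherit small dissipation without any continuity of the form.\<close>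

lemma viscous_form_triangle:
  assumes "\<mu> \<ge> 0" "lam \<ge> 0"
  shows "viscous_form \<mu> lam B \<le> 2 * viscous_form \<mu> lam A + 2 * viscous_form \<mu> lam (A - B)"
proof -
  have "viscous_form \<mu> lam B = 2 * viscous_form \<mu> lam A + 2 * viscous_form \<mu> lam (A - B)
     - viscous_form \<mu> lam (2 *\<^sub>R A - B)"
    by (simp add: viscous_form_def sum_3 algebra_simps)
  then show ?thesis using viscous_form_nonneg[OF assms, of "2 *\<^sub>R A - B"] by linarith
qed

lemma integral_viscous_form:
  assumes "\<And>i j. square_integrable M (\<lambda>x. G x $ i $ j)"
  shows "integrable M (\<lambda>x. viscous_form \<mu> lam (G x))"
    and "integral\<^sup>L M (\<lambda>x. viscous_form \<mu> lam (G x)) =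
      \<mu> * (\<Sum>i\<in>UNIV. \<Sum>j\<in>UNIV. integral\<^sup>L M (\<lambda>x. G x $ i $ j * G x $ i $ j))
      + \<mu> * (\<Sum>i\<in>UNIV. \<Sum>j\<in>UNIV. integral\<^sup>L M (\<lambda>x. G x $ i $ j * G x $ j $ i))
      + (lam - 2 / 3 * \<mu>) * (\<Sum>i\<in>UNIV. \<Sum>j\<in>UNIV. integral\<^sup>L M (\<lambda>x. G x $ i $ i * G x $ j $ j))"
proof -
  have I: "integrable M (\<lambda>x. G x $ i $ j * G x $ k $ l)" for i j k l
    by (rule square_integrable_mult[OF assms assms])
  show "integrable M (\<lambda>x. viscous_form \<mu> lam (G x))"
    unfolding viscous_form_def by (intro Bochner_Integration.integrable_add integrable_mult_right Bochner_Integration.integrable_sum I)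
  show "integral\<^sup>L M (\<lambda>x. viscous_form \<mu> lam (G x)) =
      \<mu> * (\<Sum>i\<in>UNIV. \<Sum>j\<in>UNIV. integral\<^sup>L M (\<lambda>x. G x $ i $ j * G x $ i $ j))
      + \<mu> * (\<Sum>i\<in>UNIV. \<Sum>j\<in>UNIV. integral\<^sup>L M (\<lambda>x. G x $ i $ j * G x $ j $ i))
      + (lam - 2 / 3 * \<mu>) * (\<Sum>i\<in>UNIV. \<Sum>j\<in>UNIV. integral\<^sup>L M (\<lambda>x. G x $ i $ i * G x $ j $ j))"
    unfolding viscous_form_def
    by (simp only: Bochner_Integration.integral_add Bochner_Integration.integrable_add integrable_mult_right
        Bochner_Integration.integrable_sum I Bochner_Integration.integral_sum integral_mult_right_zero)
qed

text \<open>\<open>\<integral> \<partial>\<^sub>j \<phi>\<^sub>i \<partial>\<^sub>i \<phi>\<^sub>j = \<integral> \<partial>\<^sub>i \<phi>\<^sub>i \<partial>\<^sub>j \<phi>\<^sub>j\<close> turns the mixed terms into the square of the divergence.\<close>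

lemma korn_test_function:
  fixes \<phi> :: "3 \<Rightarrow> real^3 \<Rightarrow> real"
  assumes \<Omega>: "\<Omega> \<in> sets lebesgue" and \<phi>: "\<And>i. test_function \<Omega> (\<phi> i)" and "\<mu> \<ge> 0" "lam \<ge> 0"
  shows "\<mu> * (\<Sum>i\<in>UNIV. \<Sum>j\<in>UNIV. integral\<^sup>L (lebesgue_on \<Omega>) (\<lambda>x. (partial_deriv j (\<phi> i) x)\<^sup>2))
    \<le> integral\<^sup>L (lebesgue_on \<Omega>) (\<lambda>x. viscous_form \<mu> lam (\<chi> i j. partial_deriv j (\<phi> i) x))"
proof -
  define I where "I = (\<lambda>i j k l. integral\<^sup>L (lebesgue_on \<Omega>) (\<lambda>x. partial_deriv j (\<phi> i) x * partial_deriv l (\<phi> k) x))"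
  have sq: "square_integrable (lebesgue_on \<Omega>) (partial_deriv j (\<phi> i))" for i j
    by (intro square_integrable_test_function[OF \<Omega>] test_function_partial_deriv \<phi>)
  have I_eq: "I i j k l = (\<integral>x. partial_deriv j (\<phi> i) x * partial_deriv l (\<phi> k) x \<partial>lebesgue)" for i j k l
    unfolding I_def
    by (rule integral_lebesgue_on_eq[OF \<Omega>]) (simp add: test_function_eq_0[OF test_function_partial_deriv[OF \<phi>]])
  have sw: "I i j k l = I i l k j" for i j k l
    unfolding I_eq by (rule integral_partial_deriv_swap[OF \<phi> \<phi>])
  have "0 \<le> integral\<^sup>L (lebesgue_on \<Omega>) (\<lambda>x. (partial_deriv 1 (\<phi> 1) x + partial_deriv 2 (\<phi> 2) x + partial_deriv 3 (\<phi> 3) x)\<^sup>2)"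
    by simp
  also have "\<dots> = (\<Sum>i\<in>UNIV. \<Sum>j\<in>UNIV. I i i j j)"
  proof -
    have "(\<lambda>x. (partial_deriv 1 (\<phi> 1) x + partial_deriv 2 (\<phi> 2) x + partial_deriv 3 (\<phi> 3) x)\<^sup>2) =
      (\<lambda>x. \<Sum>i\<in>UNIV. \<Sum>j\<in>UNIV. partial_deriv i (\<phi> i) x * partial_deriv j (\<phi> j) x)"
      by (simp add: sum_3 power2_eq_square algebra_simps fun_eq_iff)
    then show ?thesis
      unfolding I_def by (simp only: Bochner_Integration.integral_sum Bochner_Integration.integrable_sum square_integrable_mult[OF sq sq])
  qed
  finally have div: "0 \<le> (\<Sum>i\<in>UNIV. \<Sum>j\<in>UNIV. I i i j j)" .
  have sqG: "square_integrable (lebesgue_on \<Omega>) (\<lambda>x. (\<chi> i j. partial_deriv j (\<phi> i) x) $ i $ j)" for i j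
    using sq by simp
  have swap_div: "I i j j i = I i i j j" for i j
    using sw[of i j j i] .
  have "integral\<^sup>L (lebesgue_on \<Omega>) (\<lambda>x. viscous_form \<mu> lam (\<chi> i j. partial_deriv j (\<phi> i) x)) =
      \<mu> * (\<Sum>i\<in>UNIV. \<Sum>j\<in>UNIV. I i j i j) + \<mu> * (\<Sum>i\<in>UNIV. \<Sum>j\<in>UNIV. I i j j i)
      + (lam - 2 / 3 * \<mu>) * (\<Sum>i\<in>UNIV. \<Sum>j\<in>UNIV. I i i j j)"
    unfolding integral_viscous_form(2)[OF sqG] by (simp add: I_def)
  \<comment> \<open>The mixed terms contribute \<open>\<mu>\<close> times the squared divergence and
    outweigh the coefficient \<open>lam - 2 / 3 * \<mu>\<close>, which may be negative.\<close>
  also have "\<dots> = \<mu> * (\<Sum>i\<in>UNIV. \<Sum>j\<in>UNIV. I i j i j) + (lam + \<mu> / 3) * (\<Sum>i\<in>UNIV. \<Sum>j\<in>UNIV. I i i j j)"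
    unfolding swap_div by (simp add: algebra_simps)
  also have "\<dots> \<ge> \<mu> * (\<Sum>i\<in>UNIV. \<Sum>j\<in>UNIV. I i j i j)"
    using div assms(3,4) by simp
  finally show ?thesis by (simp add: I_def power2_eq_square)
qed

text \<open>Coercivity is known for test functions only, so the approximants are estimated instead
  of \<open>v\<close>. Their dissipation is at most twice that of \<open>v\<close>, which is not
  positive, plus twice that of the error, which the upper bound on the form controls by the distance
  \<open>D\<close> of the gradients. Poincare then sends the approximants to zero in the square
  mean, while they converge to \<open>v\<close>.\<close>

theorem zero_dissipation_imp_zero:
  fixes v :: "real^3 \<Rightarrow> real^3"
  assumes \<Omega>: "open \<Omega>" "bounded \<Omega>" and v: "\<And>i. in_W12_0 \<Omega> (\<lambda>x. v x $ i)"
    and \<mu>: "\<mu> > 0" and lam: "lam \<ge> 0"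
    and diss: "integral\<^sup>L (lebesgue_on \<Omega>) (\<lambda>x. stress \<mu> lam \<Omega> v x \<bullet> weak_grad \<Omega> v x) \<le> 0"
  shows "AE x in lebesgue_on \<Omega>. v x = 0"
proof -
  let ?M = "lebesgue_on \<Omega>"
  have \<Omega>': "\<Omega> \<in> sets lebesgue" using \<Omega> by simp
  obtain R where R: "\<And>x. x \<in> \<Omega> \<Longrightarrow> norm x \<le> R"
    using \<Omega>(2) unfolding bounded_iff by blast
  define w where "w = (\<lambda>i j. weak_partial \<Omega> j (\<lambda>x. v x $ i))"
  \<comment> \<open>All facts about component \<open>i\<close> are bundled, so that one choice over
    \<open>i\<close> fixes the approximating sequences.\<close>
  define P where "P = (\<lambda>i \<phi>. (\<forall>n::nat. test_function \<Omega> (\<phi> n)) \<and>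
      (\<lambda>n. integral\<^sup>L ?M (\<lambda>x. (v x $ i - \<phi> n x)\<^sup>2)) \<longlonglongrightarrow> 0 \<and>
      (\<forall>j. (\<lambda>n. integral\<^sup>L ?M (\<lambda>x. (w i j x - partial_deriv j (\<phi> n) x)\<^sup>2)) \<longlonglongrightarrow> 0) \<and>
      square_integrable ?M (\<lambda>x. v x $ i) \<and> (\<forall>j. square_integrable ?M (w i j)))"
  have "\<exists>\<phi>. P i \<phi>" for i
    unfolding P_def w_def by (rule in_W12_0_approx[OF \<Omega>(1) v[of i]]) blast
  then obtain \<phi> where P: "\<And>i. P i (\<phi> i)"
    by metis
  have \<phi>: "test_function \<Omega> (\<phi> i n)"
      and lim_v: "(\<lambda>n. integral\<^sup>L ?M (\<lambda>x. (v x $ i - \<phi> i n x)\<^sup>2)) \<longlonglongrightarrow> 0"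
      and lim_w: "(\<lambda>n. integral\<^sup>L ?M (\<lambda>x. (w i j x - partial_deriv j (\<phi> i n) x)\<^sup>2)) \<longlonglongrightarrow> 0"
      and sq_v: "square_integrable ?M (\<lambda>x. v x $ i)" and sq_w: "square_integrable ?M (w i j)" for i j n
    using P[of i] unfolding P_def by simp_all
  have sq_\<phi>: "square_integrable ?M (\<phi> i n)" "square_integrable ?M (partial_deriv j (\<phi> i n))" for i j n
    by (intro square_integrable_test_function[OF \<Omega>'] test_function_partial_deriv \<phi>)+
  define C where "C = 2 * \<mu> + 3 * lam"
  define D where "D = (\<lambda>n. \<Sum>i\<in>UNIV. \<Sum>j\<in>UNIV. integral\<^sup>L ?M (\<lambda>x. (w i j x - partial_deriv j (\<phi> i n) x)\<^sup>2))"
  define W where "W = (\<lambda>x. \<chi> i j. w i j x)"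
  define F where "F = (\<lambda>n x. \<chi> i j. partial_deriv j (\<phi> i n) x)"
  have D: "D \<longlonglongrightarrow> 0"
    using tendsto_sum[OF tendsto_sum[OF lim_w]] unfolding D_def by (simp add: tendsto_null_sum lim_w)
  have EW: "integral\<^sup>L ?M (\<lambda>x. viscous_form \<mu> lam (W x)) \<le> 0"
    using diss unfolding stress_inner_eq_viscous_form by (simp add: weak_grad_def W_def w_def)
  have iW: "integrable ?M (\<lambda>x. viscous_form \<mu> lam (W x))"
    by (rule integral_viscous_form(1)) (simp add: W_def sq_w)
  have iWF: "integrable ?M (\<lambda>x. viscous_form \<mu> lam (W x - F n x))" for n
    by (rule integral_viscous_form(1)) (simp add: W_def F_def square_integrable_diff sq_w sq_\<phi>)
  have iF: "integrable ?M (\<lambda>x. viscous_form \<mu> lam (F n x))" for n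
    by (rule integral_viscous_form(1)) (simp add: F_def sq_\<phi>)
  have sqd: "integrable ?M (\<lambda>x. (w i j x - partial_deriv j (\<phi> i n) x)\<^sup>2)" for i j n
    using square_integrable_diff[OF sq_w sq_\<phi>(2)] by (simp add: square_integrable_def)
  have grad: "\<mu> * (\<Sum>i\<in>UNIV. \<Sum>j\<in>UNIV. integral\<^sup>L ?M (\<lambda>x. (partial_deriv j (\<phi> i n) x)\<^sup>2)) \<le> 2 * C * D n" for n
  proof -
    have "\<mu> * (\<Sum>i\<in>UNIV. \<Sum>j\<in>UNIV. integral\<^sup>L ?M (\<lambda>x. (partial_deriv j (\<phi> i n) x)\<^sup>2)) \<le> integral\<^sup>L ?M (\<lambda>x. viscous_form \<mu> lam (F n x))"
      unfolding F_def using korn_test_function[OF \<Omega>' \<phi>] \<mu> lam by simp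
    also have "\<dots> \<le> integral\<^sup>L ?M (\<lambda>x. 2 * viscous_form \<mu> lam (W x) + 2 * viscous_form \<mu> lam (W x - F n x))"
      using iF iW iWF \<mu> lam by (intro integral_mono viscous_form_triangle) auto
    also have "\<dots> = 2 * integral\<^sup>L ?M (\<lambda>x. viscous_form \<mu> lam (W x)) + 2 * integral\<^sup>L ?M (\<lambda>x. viscous_form \<mu> lam (W x - F n x))"
      using iW iWF by simp
    also have "\<dots> \<le> 2 * integral\<^sup>L ?M (\<lambda>x. viscous_form \<mu> lam (W x - F n x))"
      using EW by simp
    also have "integral\<^sup>L ?M (\<lambda>x. viscous_form \<mu> lam (W x - F n x)) \<le>
        integral\<^sup>L ?M (\<lambda>x. C * (\<Sum>i\<in>UNIV. \<Sum>j\<in>UNIV. (w i j x - partial_deriv j (\<phi> i n) x)\<^sup>2))"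
    proof (rule integral_mono[OF iWF])
      show "integrable ?M (\<lambda>x. C * (\<Sum>i\<in>UNIV. \<Sum>j\<in>UNIV. (w i j x - partial_deriv j (\<phi> i n) x)\<^sup>2))"
        by (intro integrable_mult_right Bochner_Integration.integrable_sum sqd)
      show "viscous_form \<mu> lam (W x - F n x) \<le> C * (\<Sum>i\<in>UNIV. \<Sum>j\<in>UNIV. (w i j x - partial_deriv j (\<phi> i n) x)\<^sup>2)" for x
        using viscous_form_le[of \<mu> lam "W x - F n x"] \<mu> lam by (simp add: C_def W_def F_def)
    qed
    also have "\<dots> = C * D n"
      unfolding D_def by (simp only: integral_mult_right_zero Bochner_Integration.integral_sum Bochner_Integration.integrable_sum sqd)
    finally show ?thesis by simp
  qed
  have "AE x in ?M. v x $ i = 0" for i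
  proof -
    \<comment> \<open>The factor 16 collects 2 from splitting the square,
      \<open>4 * R\<^sup>2\<close> from Poincare and \<open>2 * C / \<mu>\<close> from
      \<open>grad\<close>.\<close>
    have "integral\<^sup>L ?M (\<lambda>x. (v x $ i)\<^sup>2) \<le> 2 * integral\<^sup>L ?M (\<lambda>x. (v x $ i - \<phi> i n x)\<^sup>2) + 16 * R\<^sup>2 * C / \<mu> * D n" for n
    proof -
      have i1: "integrable ?M (\<lambda>x. (v x $ i - \<phi> i n x)\<^sup>2)" "integrable ?M (\<lambda>x. (\<phi> i n x)\<^sup>2)"
        using square_integrable_diff[OF sq_v sq_\<phi>(1)] sq_\<phi>(1) by (simp_all add: square_integrable_def)
      have "integral\<^sup>L ?M (\<lambda>x. (v x $ i)\<^sup>2) \<le> integral\<^sup>L ?M (\<lambda>x. 2 * (v x $ i - \<phi> i n x)\<^sup>2 + 2 * (\<phi> i n x)\<^sup>2)"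
      proof (rule integral_mono)
        show "(v x $ i)\<^sup>2 \<le> 2 * (v x $ i - \<phi> i n x)\<^sup>2 + 2 * (\<phi> i n x)\<^sup>2" for x
          using zero_le_power2[of "v x $ i - 2 * \<phi> i n x"] by (simp add: power2_eq_square algebra_simps)
      qed (use i1 sq_v in \<open>auto simp: square_integrable_def\<close>)
      also have "\<dots> = 2 * integral\<^sup>L ?M (\<lambda>x. (v x $ i - \<phi> i n x)\<^sup>2) + 2 * integral\<^sup>L ?M (\<lambda>x. (\<phi> i n x)\<^sup>2)"
        using i1 by simp
      also have "integral\<^sup>L ?M (\<lambda>x. (\<phi> i n x)\<^sup>2) = (\<integral>x. (\<phi> i n x)\<^sup>2 \<partial>lebesgue)"
        by (rule integral_lebesgue_on_eq[OF \<Omega>']) (simp add: test_function_eq_0[OF \<phi>])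
      also have "\<dots> \<le> 4 * R\<^sup>2 * (\<integral>x. (partial_deriv 1 (\<phi> i n) x)\<^sup>2 \<partial>lebesgue)"
        by (rule poincare_test_function[OF \<phi> R])
      also have "(\<integral>x. (partial_deriv 1 (\<phi> i n) x)\<^sup>2 \<partial>lebesgue) = integral\<^sup>L ?M (\<lambda>x. (partial_deriv 1 (\<phi> i n) x)\<^sup>2)"
        by (rule integral_lebesgue_on_eq[OF \<Omega>', symmetric]) (simp add: test_function_eq_0[OF test_function_partial_deriv[OF \<phi>]])
      also have "\<dots> \<le> (\<Sum>j\<in>UNIV. integral\<^sup>L ?M (\<lambda>x. (partial_deriv j (\<phi> i n) x)\<^sup>2))"
        by (rule member_le_sum) auto
      also have "\<dots> \<le> (\<Sum>i\<in>UNIV. \<Sum>j\<in>UNIV. integral\<^sup>L ?M (\<lambda>x. (partial_deriv j (\<phi> i n) x)\<^sup>2))"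
        by (rule member_le_sum[where f = "\<lambda>i. \<Sum>j\<in>UNIV. integral\<^sup>L ?M (\<lambda>x. (partial_deriv j (\<phi> i n) x)\<^sup>2)"]) (auto intro!: sum_nonneg)
      also have "\<dots> \<le> 2 * C * D n / \<mu>"
        using grad[of n] \<mu> by (simp add: pos_le_divide_eq mult.commute)
      finally show ?thesis by (simp add: mult_left_mono mult_right_mono field_simps)
    qed
    moreover have "(\<lambda>n. 2 * integral\<^sup>L ?M (\<lambda>x. (v x $ i - \<phi> i n x)\<^sup>2) + 16 * R\<^sup>2 * C / \<mu> * D n) \<longlonglongrightarrow> 2 * 0 + 16 * R\<^sup>2 * C / \<mu> * 0"
      by (intro tendsto_intros lim_v D)
    ultimately have "integral\<^sup>L ?M (\<lambda>x. (v x $ i)\<^sup>2) \<le> 0"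
      by (intro LIMSEQ_le_const) auto
    moreover have "0 \<le> integral\<^sup>L ?M (\<lambda>x. (v x $ i)\<^sup>2)" by simp
    ultimately have "integral\<^sup>L ?M (\<lambda>x. (v x $ i)\<^sup>2) = 0" by linarith
    then have "AE x in ?M. (v x $ i)\<^sup>2 = 0"
      using integral_nonneg_eq_0_iff_AE[where M = ?M and f = "\<lambda>x. (v x $ i)\<^sup>2"] sq_v[of i] by (simp add: square_integrable_def)
    then show ?thesis by eventually_elim simp
  qed
  then have "AE x in ?M. \<forall>i. v x $ i = 0"
    by (rule eventually_all_finite)
  then show ?thesis by eventually_elim (simp add: vec_eq_iff)
qed

subsection \<open>The hydrostatic equation in one variable\<close>

lemma rest_density_nonneg: "0 \<le> rest_density g a \<gamma> c s"
  by (simp add: rest_density_def)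

text \<open>The offsets \<open>\<delta>\<close> in \<open>sandwich\<close> stem from testing with
  bumps of radius \<open>\<delta>\<close>: on such a ball a density that is monotone in the height
  is known only between its values at the two extreme heights. Continuity of \<open>r\<close> has to
  be derived before \<open>\<delta>\<close> can tend to zero.\<close>

context
  fixes I :: "real set" and r :: "real \<Rightarrow> real" and g a \<gamma> :: real
  assumes I: "open I" "is_interval I"
    and r: "\<And>s t. s \<in> I \<Longrightarrow> t \<in> I \<Longrightarrow> s \<le> t \<Longrightarrow> r s \<le> r t" "\<And>t. t \<in> I \<Longrightarrow> 0 \<le> r t"
    and pos: "g > 0" "a > 0" "\<gamma> > 1"
    and sandwich: "\<And>s t. s \<in> I \<Longrightarrow> t \<in> I \<Longrightarrow> s < t \<Longrightarrow> \<exists>\<delta>\<^sub>0>0. \<forall>\<delta>. 0 < \<delta> \<and> \<delta> < \<delta>\<^sub>0 \<longrightarrow>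
       s - \<delta> \<in> I \<and> t + \<delta> \<in> I \<and>
       a * r (t - \<delta>) powr \<gamma> - a * r (s + \<delta>) powr \<gamma> \<le> g * (t - s) * r (t + \<delta>) \<and>
       g * (t - s) * r (s - \<delta>) \<le> a * r (t + \<delta>) powr \<gamma> - a * r (s - \<delta>) powr \<gamma>"
begin

private definition p where "p t = a * r t powr \<gamma>"

private lemma in_I: "s \<in> I \<Longrightarrow> t \<in> I \<Longrightarrow> s \<le> x \<Longrightarrow> x \<le> t \<Longrightarrow> x \<in> I"
  using I(2) unfolding is_interval_1 by blast

private lemma p_mono: "s \<in> I \<Longrightarrow> t \<in> I \<Longrightarrow> s \<le> t \<Longrightarrow> p s \<le> p t"
  unfolding p_def using pos r by (intro mult_left_mono powr_mono2) auto

private lemma open_I_cball: 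
  assumes "x \<in> I" obtains d where "d > 0" "\<And>y. \<bar>y - x\<bar> \<le> d \<Longrightarrow> y \<in> I"
proof -
  obtain d where "d > 0" "cball x d \<subseteq> I" using I(1) assms open_contains_cball by blast
  then show thesis using that[of d] by (auto simp: dist_real_def abs_minus_commute subset_iff)
qed

text \<open>Applying \<open>sandwich\<close> to the wider pair \<open>s'\<close>, \<open>t'\<close>
  leaves gaps on both sides, into which a small \<open>\<delta>\<close> fits; monotonicity then
  removes it.\<close>

private lemma p_increment_le:
  assumes "s' \<in> I" "t'' \<in> I" "s' < s" "s < t" "t < t'" "t' < t''"
  shows "p t - p s \<le> g * (t' - s') * r t''"
proof -
  have in': "s \<in> I" "t \<in> I" "t' \<in> I" using assms in_I[OF assms(1,2)] by auto
  obtain \<delta>\<^sub>0 where \<delta>\<^sub>0: "\<delta>\<^sub>0 > 0" and sw: "\<And>\<delta>. 0 < \<delta> \<Longrightarrow> \<delta> < \<delta>\<^sub>0 \<Longrightarrow>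
      s' - \<delta> \<in> I \<and> t' + \<delta> \<in> I \<and> p (t' - \<delta>) - p (s' + \<delta>) \<le> g * (t' - s') * r (t' + \<delta>)"
    using sandwich[OF assms(1) in'(3)] assms unfolding p_def by force
  define m where "m = min \<delta>\<^sub>0 (min (s - s') (min (t' - t) (t'' - t')))"
  have m: "m > 0" "m \<le> \<delta>\<^sub>0" "m \<le> s - s'" "m \<le> t' - t" "m \<le> t'' - t'"
    using \<delta>\<^sub>0 assms by (simp_all add: m_def)
  define \<delta> where "\<delta> = m / 2"
  have \<delta>: "0 < \<delta>" "\<delta> < \<delta>\<^sub>0" "s' + \<delta> \<le> s" "t \<le> t' - \<delta>" "t' + \<delta> \<le> t''"
    using m unfolding \<delta>_def by linarith+
  note * = sw[OF \<delta>(1,2)]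
  have "s' + \<delta> \<in> I" "t' - \<delta> \<in> I" using \<delta> assms in_I[OF assms(1,2)] by auto
  then have "p t - p s \<le> p (t' - \<delta>) - p (s' + \<delta>)"
    using p_mono[of "s' + \<delta>" s] p_mono[of t "t' - \<delta>"] \<delta> in' by linarith
  also have "\<dots> \<le> g * (t' - s') * r (t' + \<delta>)" using * by blast
  also have "\<dots> \<le> g * (t' - s') * r t''"
    using * \<delta> assms pos by (intro mult_left_mono r) auto
  finally show ?thesis .
qed

text \<open>The widened pair \<open>s - \<epsilon>\<close>, \<open>t + \<epsilon>\<close> shrinks
  back to \<open>s\<close>, \<open>t\<close>, while \<open>t''\<close> stays fixed as the point
  where \<open>r\<close> bounds the slope. No continuity enters, and \<open>p\<close> becomes
  locally Lipschitz.\<close>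

private lemma p_lipschitz:
  assumes "t'' \<in> I" "s \<in> I" "s < t" "t < t''"
  shows "p t - p s \<le> g * (t - s) * r t''"
proof -
  obtain d where d: "d > 0" "\<And>y. \<bar>y - s\<bar> \<le> d \<Longrightarrow> y \<in> I" using open_I_cball[OF assms(2)] by blast
  define d' where "d' = min d ((t'' - t) / 2)"
  have "d' > 0" using d assms by (simp add: d'_def)
  then have "\<forall>\<^sub>F \<epsilon> in at_right 0. p t - p s \<le> g * ((t + \<epsilon>) - (s - \<epsilon>)) * r t''"
    unfolding eventually_at_right_field
  proof (intro exI[of _ d'] conjI allI impI)
    fix \<epsilon> :: real assume "0 < \<epsilon>" "\<epsilon> < d'"
    then show "p t - p s \<le> g * ((t + \<epsilon>) - (s - \<epsilon>)) * r t''"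
      using assms d(2)[of "s - \<epsilon>"] by (intro p_increment_le) (auto simp: d'_def)
  qed
  moreover have "((\<lambda>\<epsilon>. g * ((t + \<epsilon>) - (s - \<epsilon>)) * r t'') \<longlongrightarrow> g * ((t + 0) - (s - 0)) * r t'') (at_right 0)"
    by (intro tendsto_intros)
  ultimately show ?thesis
    using tendsto_le[OF trivial_limit_at_right_real _ tendsto_const, of _ _ 0 "p t - p s"] by simp
qed

private lemma p_isCont:
  assumes "x \<in> I" shows "isCont p x"
proof -
  obtain d where d: "d > 0" "\<And>y. \<bar>y - x\<bar> \<le> d \<Longrightarrow> y \<in> I" using open_I_cball[OF assms] by blast
  define L where "L = g * r (x + d)"
  have xd: "x + d \<in> I" using d by simp
  have lip: "p t - p s \<le> L * (t - s)" if "\<bar>s - x\<bar> < d" "\<bar>t - x\<bar> < d" "s < t" for s t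
    using p_lipschitz[OF xd d(2), of s t] that by (simp add: L_def mult_ac)
  have *: "\<bar>p t - p x\<bar> \<le> L * \<bar>t - x\<bar>" if "\<bar>t - x\<bar> < d" for t
  proof -
    have tI: "t \<in> I" using d(2) that by simp
    consider "t < x" | "t = x" | "t > x" by linarith
    then show ?thesis
    proof cases
      case 1 then show ?thesis using lip[of t x] p_mono[of t x] tI assms d(1) that by simp
    next
      case 3 then show ?thesis using lip[of x t] p_mono[of x t] tI assms d(1) that by simp
    qed simp
  qed
  have "((\<lambda>t. p t - p x) \<longlongrightarrow> 0) (at x)"
  proof (rule Lim_null_comparison)
    show "\<forall>\<^sub>F t in at x. norm (p t - p x) \<le> L * \<bar>t - x\<bar>"
      unfolding eventually_at using d(1) * by (intro exI[of _ d]) (auto simp: dist_real_def)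
    have "((\<lambda>t. L * \<bar>t - x\<bar>) \<longlongrightarrow> L * \<bar>x - x\<bar>) (at x)" by (intro tendsto_intros)
    then show "((\<lambda>t. L * \<bar>t - x\<bar>) \<longlongrightarrow> 0) (at x)" by simp
  qed
  then show ?thesis unfolding isCont_def using Lim_null by blast
qed

text \<open>Inverting the pressure law transfers continuity from \<open>p\<close> to
  \<open>r\<close>.\<close>

private lemma r_eq: "t \<in> I \<Longrightarrow> r t = (p t / a) powr (1 / \<gamma>)"
  using pos r(2)[of t] by (simp add: p_def powr_powr)

private lemma p_nonneg: "0 \<le> p t"
  using pos by (simp add: p_def)

private lemma r_isCont:
  assumes "x \<in> I" shows "isCont r x"
proof -
  have "isCont (\<lambda>t. (p t / a) powr (1 / \<gamma>)) x"
    unfolding isCont_def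
    by (rule tendsto_powr') (use p_isCont[OF assms] pos p_nonneg in \<open>auto simp: isCont_def intro!: tendsto_intros\<close>)
  moreover have ev: "\<forall>\<^sub>F t in nhds x. (p t / a) powr (1 / \<gamma>) = r t"
    unfolding eventually_nhds using I(1) assms r_eq by metis
  ultimately show ?thesis using isCont_cong[OF ev] by simp
qed

text \<open>Now that \<open>p\<close> and \<open>r\<close> are continuous, \<open>\<delta>\<close>
  may tend to zero in \<open>sandwich\<close>.\<close>

private lemma p_increment_bounds:
  assumes "s \<in> I" "t \<in> I" "s < t"
  shows "g * (t - s) * r s \<le> p t - p s" "p t - p s \<le> g * (t - s) * r t"
proof -
  obtain \<delta>\<^sub>0 where \<delta>\<^sub>0: "\<delta>\<^sub>0 > 0" and sw: "\<And>\<delta>. 0 < \<delta> \<Longrightarrow> \<delta> < \<delta>\<^sub>0 \<Longrightarrow>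
      p (t - \<delta>) - p (s + \<delta>) \<le> g * (t - s) * r (t + \<delta>) \<and>
       g * (t - s) * r (s - \<delta>) \<le> p (t + \<delta>) - p (s - \<delta>)"
    using sandwich[OF assms] unfolding p_def by force
  have plus: "((\<lambda>\<delta>. x + \<delta>) \<longlongrightarrow> x) (at_right 0)" and minus: "((\<lambda>\<delta>. x - \<delta>) \<longlongrightarrow> x) (at_right 0)" for x :: real
    using tendsto_add[OF tendsto_const tendsto_ident_at, of x 0 "{0<..}"]
      tendsto_diff[OF tendsto_const tendsto_ident_at, of x 0 "{0<..}"] by simp_all
  have c: "((\<lambda>\<delta>. f (x + \<delta>)) \<longlongrightarrow> f x) (at_right 0)" "((\<lambda>\<delta>. f (x - \<delta>)) \<longlongrightarrow> f x) (at_right 0)" if "isCont f x" for f :: "real \<Rightarrow> real" and x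
    by (rule isCont_tendsto_compose[OF that plus], rule isCont_tendsto_compose[OF that minus])
  have ev: "\<forall>\<^sub>F \<delta> in at_right 0. 0 < \<delta> \<and> \<delta> < \<delta>\<^sub>0"
    unfolding eventually_at_right_field using \<delta>\<^sub>0 by blast
  show "g * (t - s) * r s \<le> p t - p s"
    by (rule tendsto_le[OF trivial_limit_at_right_real
         tendsto_diff[OF c(1)[OF p_isCont[OF assms(2)]] c(2)[OF p_isCont[OF assms(1)]]]
         tendsto_mult[OF tendsto_const c(2)[OF r_isCont[OF assms(1)]]]])
      (use ev in eventually_elim, use sw in blast)
  show "p t - p s \<le> g * (t - s) * r t"
    by (rule tendsto_le[OF trivial_limit_at_right_real
         tendsto_mult[OF tendsto_const c(1)[OF r_isCont[OF assms(2)]]]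
         tendsto_diff[OF c(2)[OF p_isCont[OF assms(2)]] c(1)[OF p_isCont[OF assms(1)]]]])
      (use ev in eventually_elim, use sw in blast)
qed

text \<open>The difference quotient lies between \<open>g * r x\<close> and \<open>g * r y\<close>,
  on either side of \<open>x\<close>, and \<open>r\<close> is continuous.\<close>

private lemma p_DERIV:
  assumes "x \<in> I" shows "(p has_real_derivative g * r x) (at x)"
proof -
  obtain d where d: "d > 0" "\<And>y. \<bar>y - x\<bar> \<le> d \<Longrightarrow> y \<in> I" using open_I_cball[OF assms] by blast
  have *: "\<bar>(p y - p x) / (y - x) - g * r x\<bar> \<le> g * \<bar>r y - r x\<bar>" if "\<bar>y - x\<bar> < d" "y \<noteq> x" for y
  proof -
    have yI: "y \<in> I" using d(2) that by simp
    show ?thesis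
    proof (cases "x < y")
      case True
      have "g * r x \<le> (p y - p x) / (y - x)" "(p y - p x) / (y - x) \<le> g * r y"
        using p_increment_bounds[OF assms yI True] True by (simp_all add: field_simps)
      then show ?thesis
        using mult_left_mono[OF abs_ge_self less_imp_le[OF pos(1)], of "r y - r x"]
        unfolding right_diff_distrib by linarith
    next
      case False
      then have "y < x" using that by simp
      have "g * r y \<le> (p x - p y) / (x - y)" "(p x - p y) / (x - y) \<le> g * r x"
        using p_increment_bounds[OF yI assms \<open>y < x\<close>] \<open>y < x\<close> by (simp_all add: field_simps)
      moreover have "(p x - p y) / (x - y) = (p y - p x) / (y - x)"
        using minus_divide_divide[of "p y - p x" "y - x"] by simp
      ultimately show ?thesis
        using mult_left_mono[OF abs_ge_self less_imp_le[OF pos(1)], of "r x - r y"]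
        unfolding right_diff_distrib abs_minus_commute[of "r x" "r y"] by linarith
    qed
  qed
  have "((\<lambda>y. (p y - p x) / (y - x) - g * r x) \<longlongrightarrow> 0) (at x)"
  proof (rule Lim_null_comparison)
    show "\<forall>\<^sub>F y in at x. norm ((p y - p x) / (y - x) - g * r x) \<le> g * \<bar>r y - r x\<bar>"
      unfolding eventually_at using d(1) * by (intro exI[of _ d]) (auto simp: dist_real_def)
    have "((\<lambda>y. g * \<bar>r y - r x\<bar>) \<longlongrightarrow> g * \<bar>r x - r x\<bar>) (at x)"
      by (intro tendsto_intros) (use r_isCont[OF assms] in \<open>simp add: isCont_def\<close>)
    then show "((\<lambda>y. g * \<bar>r y - r x\<bar>) \<longlongrightarrow> 0) (at x)" by simp
  qed
  then have "((\<lambda>y. (p y - p x) / (y - x)) \<longlongrightarrow> g * r x) (at x)"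
    using Lim_null by blast
  then show ?thesis by (simp add: has_field_derivative_iff)
qed

private definition k where "k = (\<gamma> - 1) / (a * \<gamma>) * g"

private lemma k_pos: "k > 0" using pos by (simp add: k_def)

text \<open>The function is \<open>r powr (\<gamma> - 1)\<close> on \<open>I\<close>, written
  through \<open>p\<close> because \<open>p\<close> is the quantity known to be differentiable. The
  factor \<open>r x\<close> in the derivative of \<open>p\<close> cancels the \<open>1 / r x\<close>
  of the chain rule, which leaves the constant slope \<open>k\<close>.\<close>

private lemma r_powr_DERIV:
  assumes "x \<in> I" "r x > 0"
  shows "((\<lambda>t. (p t / a) powr ((\<gamma> - 1) / \<gamma>)) has_real_derivative k) (at x)"
proof -
  have px: "p x / a > 0" using assms pos by (simp add: p_def)
  have "((\<lambda>t. (p t / a) powr ((\<gamma> - 1) / \<gamma>)) has_real_derivative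
     ((\<gamma> - 1) / \<gamma>) * (p x / a) powr ((\<gamma> - 1) / \<gamma> - 1) * (g * r x / a)) (at x)"
    using p_DERIV[OF assms(1)] px pos
    by (auto intro!: derivative_eq_intros DERIV_cdivide simp: has_real_derivative_powr)
  moreover have "(p x / a) powr ((\<gamma> - 1) / \<gamma> - 1) = 1 / r x"
  proof -
    have "(\<gamma> - 1) / \<gamma> - 1 = - (1 / \<gamma>)" using pos by (simp add: field_simps)
    then show ?thesis by (simp add: powr_minus_divide r_eq[OF assms(1)])
  qed
  ultimately show ?thesis using assms(2) pos by (simp add: k_def field_simps)
qed

lemma hydrostatic_ode:
  assumes "bdd_above I"
  shows "\<exists>c. \<forall>t\<in>I. r t = rest_density g a \<gamma> c t"
proof -
  define q where "q t = r t powr (\<gamma> - 1)" for t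
  have q_eq: "q t = (p t / a) powr ((\<gamma> - 1) / \<gamma>)" if "t \<in> I" for t
    using r_eq[OF that] pos by (simp add: q_def powr_powr field_simps)
  have r_q: "r t = q t powr (1 / (\<gamma> - 1))" if "t \<in> I" for t
    using r(2)[OF that] pos by (simp add: q_def powr_powr)
  define J where "J = {t \<in> I. r t > 0}"
  show ?thesis
  proof (cases "J = {}")
    case True
    obtain B where B: "\<And>t. t \<in> I \<Longrightarrow> t \<le> B" using assms unfolding bdd_above_def by blast
    \<comment> \<open>In the vacuum case the constant is chosen so that the affine function first
      reaches zero at the upper bound \<open>B\<close> of \<open>I\<close>.\<close>
    have "r t = rest_density g a \<gamma> (- k * B) t" if "t \<in> I" for t
    proof -
      have "r t = 0" using True r(2)[OF that] that unfolding J_def by force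
      moreover have "k * t - k * B \<le> 0" using B[OF that] k_pos by simp
      ultimately show ?thesis using pos by (simp add: rest_density_def k_def max_def)
    qed
    then show ?thesis by blast
  next
    case False
    then obtain u0 where u0: "u0 \<in> I" "r u0 > 0" by (auto simp: J_def)
    have up: "t \<in> J" if "s \<in> J" "t \<in> I" "s \<le> t" for s t
      using that r(1)[of s t] by (auto simp: J_def)
    have conv: "convex J"
      unfolding is_interval_convex_1[symmetric] is_interval_1
    proof (intro ballI allI impI)
      fix s t x assume "s \<in> J" "t \<in> J" "s \<le> x \<and> x \<le> t"
      then show "x \<in> J" using up[of s x] in_I[of s t x] by (simp add: J_def)
    qed
    have "\<exists>c. \<forall>t\<in>J. (p t / a) powr ((\<gamma> - 1) / \<gamma>) - k * t = c"
    proof (rule has_field_derivative_zero_constant[OF conv])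
      fix t assume t: "t \<in> J"
      have "((\<lambda>t. (p t / a) powr ((\<gamma> - 1) / \<gamma>) - k * t) has_real_derivative k - k * 1) (at t)"
        using t by (intro DERIV_diff r_powr_DERIV DERIV_cmult DERIV_ident) (auto simp: J_def)
      then show "((\<lambda>t. (p t / a) powr ((\<gamma> - 1) / \<gamma>) - k * t) has_field_derivative 0) (at t within J)"
        by (simp add: has_field_derivative_at_within)
    qed
    then obtain c where c: "\<And>t. t \<in> J \<Longrightarrow> q t = k * t + c"
      using q_eq by (force simp: J_def algebra_simps)
    have "r t = rest_density g a \<gamma> c t" if t: "t \<in> I" for t
    proof (cases "t \<in> J")
      case True
      then have "q t > 0" by (simp add: J_def q_def)
      then show ?thesis
        using c[OF True] r_q[OF t] by (simp add: rest_density_def k_def)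
    next
      case False
      have rt: "r t = 0" using False t r(2)[OF t] by (auto simp: J_def)
      \<comment> \<open>If the affine function were positive at a vacuum point \<open>t\<close>, the
        continuous \<open>q\<close> would climb from 0 to \<open>k * u0 + c\<close> and meet half of
        \<open>k * t + c\<close> on the way. There \<open>r\<close> is positive, so \<open>q\<close>
        is affine and at least \<open>k * t + c\<close>, a contradiction.\<close>
      have "k * t + c \<le> 0"
      proof (rule ccontr)
        assume neg: "\<not> k * t + c \<le> 0"
        have "t < u0" using up[of u0 t] False u0 t by (force simp: J_def)
        have qu0: "q u0 = k * u0 + c" using c u0 by (simp add: J_def)
        have cont: "continuous_on {t..u0} q"
        proof -
          have "isCont (\<lambda>t. r t powr (\<gamma> - 1)) x" if "x \<in> I" for x
          proof -
            have "\<forall>\<^sub>F t in at x. 0 \<le> r t"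
              unfolding eventually_at_topological using I(1) that r(2) by blast
            then show ?thesis
              using r_isCont[OF that] pos tendsto_powr'[of r "r x" "at x" "\<lambda>_. \<gamma> - 1" "\<gamma> - 1"]
              by (simp add: isCont_def)
          qed
          then show ?thesis
            unfolding q_def using in_I[OF t u0(1)]
            by (intro continuous_at_imp_continuous_on) auto
        qed
        have v: "k * t < k * u0" using \<open>t < u0\<close> k_pos by simp
        have "\<exists>x\<ge>t. x \<le> u0 \<and> q x = (k * t + c) / 2"
          by (rule IVT'[OF _ _ _ cont]) (use \<open>t < u0\<close> neg v qu0 rt in \<open>auto simp: q_def\<close>)
        then obtain x where x: "t \<le> x" "x \<le> u0" "q x = (k * t + c) / 2" by blast
        then have "x \<in> I" using in_I[OF t u0(1)] by simp
        moreover have "q x > 0" using x(3) neg by simp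
        ultimately have "x \<in> J" using r(2)[of x] by (auto simp: J_def q_def less_le)
        then have "q x = k * x + c" by (rule c)
        moreover have "k * t \<le> k * x" using x(1) k_pos by simp
        ultimately show False using x(3) neg by simp
      qed
      then show ?thesis using rt pos by (simp add: rest_density_def k_def max_def)
    qed
    then show ?thesis by blast
  qed
qed

end

subsection \<open>Monotonicity along gravity\<close>

lemma AE_lborel_obtain_in_open:
  fixes U :: "('a::euclidean_space) set"
  assumes "open U" "U \<noteq> {}" "AE x in lborel. P x"
  obtains x where "x \<in> U" "P x"
proof -
  have "\<exists>x\<in>U. P x"
  proof (rule ccontr)
    assume none: "\<not> (\<exists>x\<in>U. P x)"
    have "AE x in lborel. x \<in> - U"
      using assms(3) by eventually_elim (use none in auto)
    then have "AE x in lebesgue. x \<in> - U" by (rule AE_completion)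
    then have "x \<in> - U" for x
      using mem_closed_if_AE_lebesgue[of "- U"] assms(1) by (simp add: closed_Compl)
    then show False using assms(2) by blast
  qed
  then show thesis using that by blast
qed

text \<open>The mean value theorem applied to the integral of \<open>P x * \<phi> (x - t k)\<close>
  on the unit interval. The minus sign of the backward translation cancels the one in
  \<open>eq\<close>, leaving the force component \<open>k \<bullet> b\<close>. Since the
  intermediate \<open>\<xi>\<close> again denotes a translate of \<open>\<phi>\<close>, the right
  side can be estimated in the same way as the left.\<close>

lemma shifted_integral_identity:
  fixes P R :: "real^'n::finite \<Rightarrow> real" and C :: "(real^'n) set"
  assumes C: "convex C" and P: "integrable lebesgue P"
    and eq: "\<And>\<phi> j. test_function C \<phi> \<Longrightarrow> (\<integral>x. P x * partial_deriv j \<phi> x \<partial>lebesgue) = - (b $ j * (\<integral>x. R x * \<phi> x \<partial>lebesgue))"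
    and \<phi>: "\<And>m. Ck m \<phi>" and K: "compact K" "\<And>x. x \<notin> K \<Longrightarrow> \<phi> x = 0" "\<And>x. x \<in> K \<Longrightarrow> x \<in> C \<and> x + k \<in> C"
  obtains \<xi> where "0 < \<xi>" "\<xi> < 1"
    "(\<integral>x. P x * \<phi> (x - k) \<partial>lebesgue) - (\<integral>x. P x * \<phi> x \<partial>lebesgue) =
      (k \<bullet> b) * (\<integral>x. R x * \<phi> (x - \<xi> *\<^sub>R k) \<partial>lebesgue)"
proof -
  define F where "F t = (\<integral>x. P x * \<phi> (x + t *\<^sub>R (- k)) \<partial>lebesgue)" for t
  define F' where "F' t = (k \<bullet> b) * (\<integral>x. R x * \<phi> (x - t *\<^sub>R k) \<partial>lebesgue)" for t
  have "(F has_real_derivative F' t) (at t)" if t: "0 \<le> t" "t \<le> 1" for t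
  proof -
    let ?T = "\<lambda>x. \<phi> (x + t *\<^sub>R (- k))"
    have tr: "partial_deriv j ?T = (\<lambda>x. partial_deriv j \<phi> (x + t *\<^sub>R (- k)))" for j
      by (rule Ck_SucI(2)[OF partial_deriv_translate, where k = 0])
        (rule Ck_differentiable[OF \<phi>[of "Suc 0"]], rule Ck_translate, use \<phi>[of "Suc 0"] in simp)
    have test: "test_function C ?T"
    proof (rule test_functionI[where K = "(\<lambda>x. t *\<^sub>R k + x) ` K"])
      show "Ck m ?T" for m by (rule Ck_translate[OF \<phi>])
      show "compact ((\<lambda>x. t *\<^sub>R k + x) ` K)" by (rule compact_translation[OF K(1)])
      show "(\<lambda>x. t *\<^sub>R k + x) ` K \<subseteq> C"
      proof clarify
        fix x assume x: "x \<in> K"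
        \<comment> \<open>A translated point of the support is a convex combination of two points of
          \<open>C\<close>.\<close>
        have "(1 - t) *\<^sub>R x + t *\<^sub>R (x + k) \<in> C"
          using C K(3)[OF x] t unfolding convex_alt by blast
        moreover have "(1 - t) *\<^sub>R x + t *\<^sub>R (x + k) = t *\<^sub>R k + x"
          by (simp add: algebra_simps)
        ultimately show "t *\<^sub>R k + x \<in> C" by simp
      qed
      fix x assume x: "x \<notin> (\<lambda>x. t *\<^sub>R k + x) ` K"
      have "x + t *\<^sub>R (- k) \<notin> K"
      proof
        assume "x + t *\<^sub>R (- k) \<in> K"
        then have "t *\<^sub>R k + (x + t *\<^sub>R (- k)) \<in> (\<lambda>x. t *\<^sub>R k + x) ` K" by blast
        then show False using x by simp
      qed
      then show "?T x = 0" by (rule K(2))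
    qed
    have int: "integrable lebesgue (\<lambda>x. P x * partial_deriv j ?T x)" for j
    proof -
      have test': "test_function C (partial_deriv j ?T)" by (rule test_function_partial_deriv[OF test])
      obtain L where L: "compact L" "L \<subseteq> C" "\<And>x. x \<notin> L \<Longrightarrow> partial_deriv j ?T x = 0"
        using test' test_functionE by blast
      have cont: "continuous_on UNIV (partial_deriv j ?T)" using Ck_continuous[OF test_function_Ck[OF test']] .
      obtain B where "\<And>x. \<bar>partial_deriv j ?T x\<bar> \<le> B"
        using compact_support_bounded[OF cont L(1,3)] by blast
      then show ?thesis by (rule integrable_mult_bounded_continuous[OF P cont])
    qed
    have "(\<integral>x. P x * (\<Sum>j\<in>UNIV. (- k) $ j * partial_deriv j \<phi> (x + t *\<^sub>R (- k))) \<partial>lebesgue) =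
       (\<integral>x. (\<Sum>j\<in>UNIV. (- k) $ j * (P x * partial_deriv j ?T x)) \<partial>lebesgue)"
      unfolding tr by (simp add: sum_distrib_left mult_ac)
    also have "\<dots> = (\<Sum>j\<in>UNIV. (- k) $ j * (\<integral>x. P x * partial_deriv j ?T x \<partial>lebesgue))"
      using int by (subst Bochner_Integration.integral_sum) auto
    also have "\<dots> = (\<Sum>j\<in>UNIV. k $ j * b $ j * (\<integral>x. R x * ?T x \<partial>lebesgue))"
      unfolding eq[OF test] by (simp add: mult_ac)
    also have "\<dots> = F' t"
      by (simp add: F'_def inner_vec_def flip: sum_distrib_right)
    finally have "(\<integral>x. P x * (\<Sum>j\<in>UNIV. (- k) $ j * partial_deriv j \<phi> (x + t *\<^sub>R (- k))) \<partial>lebesgue) = F' t" .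
    with integral_translate_deriv[OF P \<phi> K(1,2), of "- k" t] show ?thesis
      unfolding F_def by simp
  qed
  from MVT2[of 0 1 F F', OF _ this] obtain \<xi> where "0 < \<xi>" "\<xi> < 1" "F 1 - F 0 = (1 - 0) * F' \<xi>" by auto
  then show thesis using that by (simp add: F_def F'_def)
qed

text \<open>On the open set of points that stay in \<open>C\<close> after the shift, the increment
  of \<open>P\<close> is a nonnegative distribution: tested with \<open>\<phi>\<close> it equals
  \<open>k \<bullet> b\<close> times an integral of nonnegative functions.\<close>

lemma nonneg_increment_AE:
  fixes P R :: "real^'n::finite \<Rightarrow> real" and C :: "(real^'n) set"
  assumes C: "open C" "convex C" and [measurable]: "P \<in> borel_measurable borel" and P: "integrable lebesgue P"
    and eq: "\<And>\<phi> j. test_function C \<phi> \<Longrightarrow> (\<integral>x. P x * partial_deriv j \<phi> x \<partial>lebesgue) = - (b $ j * (\<integral>x. R x * \<phi> x \<partial>lebesgue))"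
    and R: "\<And>x. 0 \<le> R x" and k: "0 \<le> k \<bullet> b"
  shows "AE y in lborel. y \<in> C \<longrightarrow> y + k \<in> C \<longrightarrow> P y \<le> P (y + k)"
proof -
  define U where "U = C \<inter> (\<lambda>y. y + k) -` C"
  have "open ((\<lambda>y. y + k) -` C)"
    by (intro open_vimage C continuous_intros)
  then have U: "open U" unfolding U_def using C(1) by blast
  have U': "U \<in> sets lebesgue" using U by simp
  have Pk: "integrable lebesgue (\<lambda>y. P (y + k))"
  proof -
    have "integrable lborel P" using P by (simp add: integrable_completion)
    then have "integrable (distr lborel borel ((+) k)) P" by (simp add: lborel_distr_plus)
    then have "integrable lborel (\<lambda>y. P (k + y))" by (subst (asm) integrable_distr_eq) auto
    then show ?thesis by (simp add: integrable_completion add.commute)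
  qed
  have li: "locally_integrable U (\<lambda>y. P (y + k) - P y)"
    unfolding locally_integrable_def
  proof (intro allI impI, elim conjE)
    fix K :: "(real^'n) set" assume "compact K"
    then have K: "K \<in> sets lebesgue" by (simp add: compact_imp_closed)
    show "integrable (lebesgue_on K) (\<lambda>y. P (y + k) - P y)"
      using K integrable_mult_indicator[OF K, of "\<lambda>y. P (y + k) - P y"] Pk P
      by (simp add: integrable_restrict_space)
  qed
  have "AE y in lebesgue_on U. 0 \<le> P (y + k) - P y"
  proof (rule nonneg_distr_imp_nonneg_AE[OF U li])
    fix \<phi> :: "real^'n \<Rightarrow> real" assume \<phi>: "test_function U \<phi>" "\<And>x. 0 \<le> \<phi> x"
    obtain K where K: "compact K" "K \<subseteq> U" "\<And>x. x \<notin> K \<Longrightarrow> \<phi> x = 0"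
      using \<phi>(1) test_functionE by blast
    have cont: "continuous_on UNIV \<phi>" using Ck_continuous[OF test_function_Ck[OF \<phi>(1)]] .
    then have [measurable]: "\<phi> \<in> borel_measurable borel" by (rule borel_measurable_continuous_onI)
    obtain B where B: "\<And>x. \<bar>\<phi> x\<bar> \<le> B"
      using compact_support_bounded[OF cont K(1,3)] by blast
    have KC: "x \<in> C \<and> x + k \<in> C" if "x \<in> K" for x
      using that K(2) by (auto simp: U_def)
    obtain \<xi> where \<xi>: "(\<integral>x. P x * \<phi> (x - k) \<partial>lebesgue) - (\<integral>x. P x * \<phi> x \<partial>lebesgue) =
      (k \<bullet> b) * (\<integral>x. R x * \<phi> (x - \<xi> *\<^sub>R k) \<partial>lebesgue)"
      by (rule shifted_integral_identity[OF C(2) P eq test_function_Ck[OF \<phi>(1)] K(1,3) KC])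
    have "regular_distr U (\<lambda>y. P (y + k) - P y) \<phi> = (\<integral>y. (P (y + k) - P y) * \<phi> y \<partial>lebesgue)"
      unfolding regular_distr_def
      by (rule integral_lebesgue_on_eq[OF U']) (simp add: test_function_eq_0[OF \<phi>(1)])
    also have "\<dots> = (\<integral>y. P (y + k) * \<phi> y \<partial>lebesgue) - (\<integral>y. P y * \<phi> y \<partial>lebesgue)"
      unfolding left_diff_distrib
      by (intro Bochner_Integration.integral_diff integrable_mult_bounded_continuous[OF _ cont B] P Pk)
    also have "(\<integral>y. P (y + k) * \<phi> y \<partial>lebesgue) = (\<integral>x. P x * \<phi> (x - k) \<partial>lebesgue)"
      using integral_lebesgue_translate[of "\<lambda>x. P x * \<phi> (x - k)" k] by simp
    also have "\<dots> - (\<integral>y. P y * \<phi> y \<partial>lebesgue) = (k \<bullet> b) * (\<integral>x. R x * \<phi> (x - \<xi> *\<^sub>R k) \<partial>lebesgue)"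
      by (rule \<xi>)
    also have "\<dots> \<ge> 0"
      using k R \<phi>(2) by (intro mult_nonneg_nonneg integral_nonneg_AE) auto
    finally show "0 \<le> regular_distr U (\<lambda>y. P (y + k) - P y) \<phi>" .
  qed
  then have "AE y in lebesgue. y \<in> U \<longrightarrow> 0 \<le> P (y + k) - P y"
    by (simp add: AE_lebesgue_on[OF U'])
  then have "AE y in lborel. y \<in> U \<longrightarrow> 0 \<le> P (y + k) - P y"
    by (simp add: AE_completion_iff)
  then show ?thesis
    by eventually_elim (auto simp: U_def)
qed

text \<open>The null set in \<open>shift\<close> depends on \<open>k\<close>, and uncountably many
  of them cannot be united. Fubini exchanges the order of \<open>y\<close> and \<open>k\<close>, and
  for fixed \<open>y\<close> translation invariance turns almost every \<open>k\<close> into almost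
  every endpoint \<open>z\<close>.\<close>

lemma AE_lborel_pairs_from_shifts:
  fixes Q :: "'a::euclidean_space \<Rightarrow> 'a \<Rightarrow> bool"
  assumes [measurable]: "Measurable.pred (borel \<Otimes>\<^sub>M borel) (\<lambda>p. Q (fst p) (snd p))"
    and shift: "\<And>k. AE y in lborel. Q y (y + k)"
  shows "AE y in lborel. AE z in lborel. Q y z" "AE z in lborel. AE y in lborel. Q y z"
proof -
  have m: "Measurable.pred (borel \<Otimes>\<^sub>M borel) (\<lambda>p. Q (snd p) (snd p + fst p))"
    using measurable_compose[of "\<lambda>p. (snd p, snd p + fst p)" "borel \<Otimes>\<^sub>M borel" "borel \<Otimes>\<^sub>M borel" "\<lambda>p. Q (fst p) (snd p)" "count_space UNIV"]
    by simp
  have "AE k in lborel. AE y in lborel. Q y (y + k)"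
    using shift by simp
  then have "AE y in lborel. AE k in lborel. Q y (y + k)"
    using m by (subst (asm) lborel_pair.AE_commute) (simp_all add: pred_def space_pair_measure)
  then show 1: "AE y in lborel. AE z in lborel. Q y z"
  proof eventually_elim
    case (elim y)
    have "Measurable.pred borel (Q y)"
      using measurable_compose[of "\<lambda>z. (y, z)" borel "borel \<Otimes>\<^sub>M borel" "\<lambda>p. Q (fst p) (snd p)" "count_space UNIV"]
      by simp
    then have "(AE z in distr lborel borel ((+) y). Q y z) \<longleftrightarrow> (AE k in lborel. Q y (y + k))"
      by (intro AE_distr_iff) (auto simp: pred_def)
    from this[unfolded lborel_distr_plus] elim show ?case by blast
  qed
  then show "AE z in lborel. AE y in lborel. Q y z"
    by (subst (asm) lborel_pair.AE_commute) (use assms(1) in \<open>simp_all add: pred_def space_pair_measure\<close>)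
qed

text \<open>\<open>G\<close> consists of the points that compare correctly with almost every other
  point, from both sides. Two of them may still form an exceptional pair, so the comparison passes
  through a third point.\<close>

lemma monotone_off_null_set:
  fixes C :: "('a::euclidean_space) set" and R :: "'a \<Rightarrow> real"
  assumes C: "open C" "convex C" and [measurable]: "R \<in> borel_measurable borel"
    and shift: "\<And>k. 0 \<le> e \<bullet> k \<Longrightarrow> AE y in lborel. y \<in> C \<longrightarrow> y + k \<in> C \<longrightarrow> R y \<le> R (y + k)"
  obtains G where "G \<subseteq> C" "AE y in lborel. y \<in> C \<longrightarrow> y \<in> G"
    "\<And>y z. y \<in> G \<Longrightarrow> z \<in> G \<Longrightarrow> e \<bullet> y < e \<bullet> z \<Longrightarrow> R y \<le> R z"
proof -
  define Q where "Q y z \<longleftrightarrow> (y \<in> C \<and> z \<in> C \<and> e \<bullet> y \<le> e \<bullet> z \<longrightarrow> R y \<le> R z)" for y z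
  have [measurable]: "C \<in> sets borel" using C(1) by simp
  have "Measurable.pred (borel \<Otimes>\<^sub>M borel) (\<lambda>p. Q (fst p) (snd p))"
    unfolding Q_def by measurable
  moreover have "AE y in lborel. Q y (y + k)" for k
  proof (cases "0 \<le> e \<bullet> k")
    case True
    from shift[OF True] show ?thesis by eventually_elim (auto simp: Q_def)
  qed (simp add: Q_def inner_add_right)
  ultimately have Q: "AE y in lborel. AE z in lborel. Q y z" "AE z in lborel. AE y in lborel. Q y z"
    by (rule AE_lborel_pairs_from_shifts)+
  define G where "G = {y \<in> C. (AE z in lborel. Q y z) \<and> (AE z in lborel. Q z y)}"
  show thesis
  proof
    show "G \<subseteq> C" by (auto simp: G_def)
    show "AE y in lborel. y \<in> C \<longrightarrow> y \<in> G"
      using Q by eventually_elim (simp add: G_def)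
    fix y z assume y: "y \<in> G" and z: "z \<in> G" and less: "e \<bullet> y < e \<bullet> z"
    \<comment> \<open>The points of \<open>C\<close> with height strictly between those of
      \<open>y\<close> and \<open>z\<close> form an open set, nonempty by the midpoint; hence one of
      them is comparable with both.\<close>
    define U where "U = C \<inter> {x. e \<bullet> y < e \<bullet> x} \<inter> {x. e \<bullet> x < e \<bullet> z}"
    have "open U" unfolding U_def
      by (intro open_Int C open_Collect_less continuous_intros)
    moreover have "midpoint y z \<in> U"
    proof -
      have "midpoint y z \<in> C"
        using C(2) y z midpoint_in_closed_segment[of y z] unfolding convex_contains_segment G_def by blast
      then show ?thesis using less by (simp add: U_def midpoint_def inner_add_right)
    qed
    moreover have "AE w in lborel. Q y w \<and> Q w z"
      using y z by (simp add: G_def)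
    ultimately obtain w where w: "w \<in> U" "Q y w \<and> Q w z"
      using AE_lborel_obtain_in_open[of U "\<lambda>w. Q y w \<and> Q w z"] by blast
    then have "R y \<le> R w" "R w \<le> R z"
      using y z by (auto simp: Q_def U_def G_def)
    then show "R y \<le> R z" by simp
  qed
qed

section \<open>Averages against bumps\<close>

lemma bump_translate: "bump c r (x - a) = bump (c + a) r x"
  by (simp add: bump_def algebra_simps)

lemma integrable_bump: "r > 0 \<Longrightarrow> integrable lebesgue (bump c r)"
  using Ck_continuous[OF Ck_bump] bump_eq_0_iff[of r c]
  by (intro integrable_compact_support[of _ "cball c r"]) auto

lemma integral_bump_pos:
  assumes "r > 0" shows "0 < (\<integral>x. bump c r x \<partial>lebesgue)"
proof -
  have "(\<integral>x. bump c r x \<partial>lebesgue) \<noteq> 0"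
  proof
    assume "(\<integral>x. bump c r x \<partial>lebesgue) = 0"
    then have "AE x in lebesgue. bump c r x = 0"
      using integral_nonneg_eq_0_iff_AE[OF integrable_bump[OF assms, of c]] bump_nonneg by auto
    then have "AE x in lborel. bump c r x = 0" by (simp add: AE_completion_iff)
    then obtain x where "x \<in> ball c r" "bump c r x = 0"
      using AE_lborel_obtain_in_open[of "ball c r" "\<lambda>x. bump c r x = 0"] assms by auto
    then show False using bump_eq_0_iff[OF assms, of c x] by simp
  qed
  moreover have "0 \<le> (\<integral>x. bump c r x \<partial>lebesgue)"
    by (intro integral_nonneg_AE) (simp add: bump_nonneg)
  ultimately show ?thesis by simp
qed

lemma integral_bump_center: "(\<integral>x. bump (c + a) r x \<partial>lebesgue) = (\<integral>x. bump c r x \<partial>lebesgue)"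
  using integral_lebesgue_translate[OF borel_measurable_continuous_onI[OF Ck_continuous[OF Ck_bump]], of c r "- a"]
  by (simp add: bump_translate)

lemma integral_mult_bump_bounds:
  fixes f :: "real^'n::finite \<Rightarrow> real"
  assumes f: "integrable lebesgue f" and r: "r > 0"
    and bd: "AE x in lebesgue. x \<in> ball c r \<longrightarrow> A \<le> f x \<and> f x \<le> B"
  shows "A * (\<integral>x. bump c r x \<partial>lebesgue) \<le> (\<integral>x. f x * bump c r x \<partial>lebesgue)"
    "(\<integral>x. f x * bump c r x \<partial>lebesgue) \<le> B * (\<integral>x. bump c r x \<partial>lebesgue)"
proof -
  have cont: "continuous_on UNIV (bump c r)" by (rule Ck_continuous[OF Ck_bump])
  have z: "bump c r x = 0" if "x \<notin> cball c r" for x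
    using that bump_eq_0_iff[OF r, of c x] by auto
  obtain L where L: "\<And>x. \<bar>bump c r x\<bar> \<le> L"
    using compact_support_bounded[OF cont compact_cball z] by blast
  have i: "integrable lebesgue (\<lambda>x. f x * bump c r x)"
    by (rule integrable_mult_bounded_continuous[OF f cont L])
  have "(\<integral>x. A * bump c r x \<partial>lebesgue) \<le> (\<integral>x. f x * bump c r x \<partial>lebesgue)"
  proof (rule integral_mono_AE)
    show "AE x in lebesgue. A * bump c r x \<le> f x * bump c r x"
      using bd
    proof eventually_elim
      case (elim x)
      then show ?case
        using bump_eq_0_iff[OF r, of c x] bump_nonneg[of c r x]
        by (cases "x \<in> ball c r") (auto intro: mult_right_mono)
    qed
  qed (use i integrable_bump[OF r, of c] in auto)
  then show "A * (\<integral>x. bump c r x \<partial>lebesgue) \<le> (\<integral>x. f x * bump c r x \<partial>lebesgue)" by simp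
  have "(\<integral>x. f x * bump c r x \<partial>lebesgue) \<le> (\<integral>x. B * bump c r x \<partial>lebesgue)"
  proof (rule integral_mono_AE)
    show "AE x in lebesgue. f x * bump c r x \<le> B * bump c r x"
      using bd
    proof eventually_elim
      case (elim x)
      then show ?case
        using bump_eq_0_iff[OF r, of c x] bump_nonneg[of c r x]
        by (cases "x \<in> ball c r") (auto intro: mult_right_mono)
    qed
  qed (use i integrable_bump[OF r, of c] in auto)
  then show "(\<integral>x. f x * bump c r x \<partial>lebesgue) \<le> B * (\<integral>x. bump c r x \<partial>lebesgue)" by simp
qed

subsection \<open>The hydrostatic density\<close>

lemma continuous_on_rest_density:
  assumes "\<gamma> > 1" shows "continuous_on A (rest_density g a \<gamma> c)"
  unfolding rest_density_def
proof (rule continuous_on_powr')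
  show "continuous_on A (\<lambda>s. max 0 ((\<gamma> - 1) / (a * \<gamma>) * g * s + c))"
    by (intro continuous_on_max continuous_on_add continuous_on_mult continuous_on_const continuous_on_id)
qed (use assms in auto)

lemma powr_le_imp_le_base:
  fixes x y :: real
  assumes "x powr \<gamma> \<le> y powr \<gamma>" "0 < \<gamma>" "0 \<le> y"
  shows "x \<le> y"
  using powr_less_mono2[of \<gamma> y x] assms by linarith

theorem hydrostatic_density:
  fixes C :: "(real^'n::finite) set" and R :: "real^'n \<Rightarrow> real" and e :: "real^'n"
  assumes C: "open C" "convex C" "bounded C" and e: "norm e = 1"
    and pos: "g > 0" "a > 0" "\<gamma> > 1"
    and Rm [measurable]: "R \<in> borel_measurable borel" and R0: "\<And>x. 0 \<le> R x"
    and Ri: "integrable lebesgue R" and Pi: "integrable lebesgue (\<lambda>x. a * R x powr \<gamma>)"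
    and eq: "\<And>\<phi> j. test_function C \<phi> \<Longrightarrow> (\<integral>x. a * R x powr \<gamma> * partial_deriv j \<phi> x \<partial>lebesgue) =
        - ((g *\<^sub>R e) $ j * (\<integral>x. R x * \<phi> x \<partial>lebesgue))"
  shows "\<exists>c. AE x in lborel. x \<in> C \<longrightarrow> R x = rest_density g a \<gamma> c (e \<bullet> x)"
proof -
  have ee: "e \<bullet> e = 1" using e by (simp add: norm_eq_1)
  define P where "P x = a * R x powr \<gamma>" for x
  have Pm [measurable]: "P \<in> borel_measurable borel" unfolding P_def by measurable
  have Pi': "integrable lebesgue P" using Pi by (simp add: P_def[abs_def])
  have eq': "(\<integral>x. P x * partial_deriv j \<phi> x \<partial>lebesgue) = - ((g *\<^sub>R e) $ j * (\<integral>x. R x * \<phi> x \<partial>lebesgue))"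
    if "test_function C \<phi>" for \<phi> j
    using eq[OF that] by (simp add: P_def)
  have P_le: "R x \<le> R y" if "P x \<le> P y" for x y
    using that pos R0 powr_le_imp_le_base[of "R x" \<gamma> "R y"] by (simp add: P_def)
  have shift: "AE y in lborel. y \<in> C \<longrightarrow> y + k \<in> C \<longrightarrow> R y \<le> R (y + k)" if "0 \<le> e \<bullet> k" for k
  proof -
    have "0 \<le> k \<bullet> (g *\<^sub>R e)" using that pos by (simp add: inner_commute)
    have "AE y in lborel. y \<in> C \<longrightarrow> y + k \<in> C \<longrightarrow> P y \<le> P (y + k)"
      by (rule nonneg_increment_AE[OF C(1,2) Pm Pi' eq' R0 \<open>0 \<le> k \<bullet> (g *\<^sub>R e)\<close>])
    then show ?thesis
      by eventually_elim (use P_le in blast)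
  qed
  have "\<exists>G. G \<subseteq> C \<and> (AE y in lborel. y \<in> C \<longrightarrow> y \<in> G) \<and> (\<forall>y\<in>G. \<forall>z\<in>G. e \<bullet> y < e \<bullet> z \<longrightarrow> R y \<le> R z)"
  proof (rule monotone_off_null_set[OF C(1,2) Rm shift])
    fix G assume "G \<subseteq> C" "AE y in lborel. y \<in> C \<longrightarrow> y \<in> G"
      "\<And>y z. y \<in> G \<Longrightarrow> z \<in> G \<Longrightarrow> e \<bullet> y < e \<bullet> z \<Longrightarrow> R y \<le> R z"
    then show ?thesis by (intro exI[of _ G]) simp
  qed
  then obtain G where "G \<subseteq> C \<and> (AE y in lborel. y \<in> C \<longrightarrow> y \<in> G) \<and> (\<forall>y\<in>G. \<forall>z\<in>G. e \<bullet> y < e \<bullet> z \<longrightarrow> R y \<le> R z)"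
    by (elim exE)
  then have G: "G \<subseteq> C" "AE y in lborel. y \<in> C \<longrightarrow> y \<in> G"
    "\<And>y z. y \<in> G \<Longrightarrow> z \<in> G \<Longrightarrow> e \<bullet> y < e \<bullet> z \<Longrightarrow> R y \<le> R z"
    by simp_all
  define I where "I = (\<lambda>x. e \<bullet> x) ` C"
  \<comment> \<open>Since \<open>e\<close> is a unit vector, moving along it changes the height by
    exactly the distance moved.\<close>
  have near: "e \<bullet> x + \<tau> \<in> I" if "cball x d \<subseteq> C" "\<bar>\<tau>\<bar> \<le> d" for x d \<tau>
  proof -
    have "x + \<tau> *\<^sub>R e \<in> cball x d" using that(2) e by (simp add: dist_norm)
    then have "e \<bullet> (x + \<tau> *\<^sub>R e) \<in> I" using that(1) unfolding I_def by blast
    then show ?thesis using ee by (simp add: inner_add_right)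
  qed
  have room: "\<exists>d>0. cball x d \<subseteq> C" if "x \<in> C" for x
    using C(1) that open_contains_cball by blast
  have I_open: "open I"
    unfolding open_contains_cball
  proof
    fix t assume "t \<in> I"
    then obtain x where x: "x \<in> C" "t = e \<bullet> x" by (auto simp: I_def)
    obtain d where d: "d > 0" "cball x d \<subseteq> C" using room[OF x(1)] by blast
    have "cball t d \<subseteq> I"
    proof
      fix u assume "u \<in> cball t d"
      then have "\<bar>u - t\<bar> \<le> d" by (simp add: dist_real_def abs_minus_commute)
      from near[OF d(2) this] show "u \<in> I" by (simp add: x(2))
    qed
    then show "\<exists>d>0. cball t d \<subseteq> I" using d(1) by blast
  qed
  have I_int: "is_interval I"
    unfolding is_interval_convex_1 I_def
    by (rule convex_linear_image) (simp_all add: C bounded_linear_inner_right bounded_linear.linear)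
  have I_bdd: "bdd_above I"
    unfolding I_def
    by (intro bounded_imp_bdd_above bounded_linear_image C bounded_linear_inner_right)
  have below: "\<exists>y\<in>G. e \<bullet> y < t" and above: "\<exists>y\<in>G. t < e \<bullet> y" if t: "t \<in> I" for t
  proof -
    obtain x where x: "x \<in> C" "t = e \<bullet> x" using t by (auto simp: I_def)
    obtain d where d: "d > 0" "cball x d \<subseteq> C" using room[OF x(1)] by blast
    have "t - d \<in> I" "t + d \<in> I" using near[OF d(2), of "-d"] near[OF d(2), of d] d(1) x(2) by simp_all
    then have ne: "C \<inter> {y. e \<bullet> y < t} \<noteq> {}" "C \<inter> {y. t < e \<bullet> y} \<noteq> {}"
      using d(1) by (force simp: I_def)+
    have op: "open (C \<inter> {y. e \<bullet> y < t})" "open (C \<inter> {y. t < e \<bullet> y})"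
      by (intro open_Int C open_Collect_less continuous_intros)+
    obtain y1 where "y1 \<in> C \<inter> {y. e \<bullet> y < t}" "y1 \<in> C \<longrightarrow> y1 \<in> G"
      using AE_lborel_obtain_in_open[OF op(1) ne(1) G(2)] by blast
    then show "\<exists>y\<in>G. e \<bullet> y < t" by blast
    obtain y2 where "y2 \<in> C \<inter> {y. t < e \<bullet> y}" "y2 \<in> C \<longrightarrow> y2 \<in> G"
      using AE_lborel_obtain_in_open[OF op(2) ne(2) G(2)] by blast
    then show "\<exists>y\<in>G. t < e \<bullet> y" by blast
  qed
  \<comment> \<open>Taking strictly lower points only gives both \<open>R y \<le> r t\<close> for
    heights below \<open>t\<close> and \<open>r (e \<bullet> y) \<le> R y\<close>. At a good point
    \<open>R\<close> thus lies between \<open>r\<close> at its height and \<open>r\<close> at any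
    greater height in \<open>I\<close>.\<close>
  define r where "r t = Sup (R ` {y \<in> G. e \<bullet> y < t})" for t
  have bdd: "bdd_above (R ` {y \<in> G. e \<bullet> y < t})" if "t \<in> I" for t
  proof -
    obtain z where z: "z \<in> G" "t < e \<bullet> z" using above[OF \<open>t \<in> I\<close>] by blast
    have "R y \<le> R z" if "y \<in> G" "e \<bullet> y < t" for y
      using G(3)[OF that(1) z(1)] that(2) z(2) by simp
    then show ?thesis by (intro bdd_aboveI2[where M = "R z"]) auto
  qed
  have r_up: "R y \<le> r t" if "y \<in> G" "t \<in> I" "e \<bullet> y < t" for y t
    unfolding r_def by (rule cSup_upper[OF _ bdd[OF that(2)]]) (use that in blast)
  have r_low: "r (e \<bullet> y) \<le> R y" if y: "y \<in> G" for y
  proof -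
    have "e \<bullet> y \<in> I" using y G(1) by (auto simp: I_def)
    then have "R ` {z \<in> G. e \<bullet> z < e \<bullet> y} \<noteq> {}" using below by blast
    then show ?thesis
      unfolding r_def by (rule cSup_least) (use G(3) y in blast)
  qed
  have r_mono: "r s \<le> r t" if st: "s \<in> I" "t \<in> I" "s \<le> t" for s t
    unfolding r_def
  proof (rule cSup_subset_mono[OF _ bdd[OF st(2)]])
    show "R ` {y \<in> G. e \<bullet> y < s} \<noteq> {}" using below[OF st(1)] by blast
    show "R ` {y \<in> G. e \<bullet> y < s} \<subseteq> R ` {y \<in> G. e \<bullet> y < t}" using st(3) by (intro image_mono) auto
  qed
  have r_nonneg: "0 \<le> r t" if tI: "t \<in> I" for t
  proof -
    obtain y where y: "y \<in> G" "e \<bullet> y < t" using below[OF tI] by blast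
    show ?thesis using order_trans[OF R0 r_up[OF y(1) tI y(2)]] .
  qed
  \<comment> \<open>By Cauchy-Schwarz the height varies by less than \<open>\<delta>\<close> inside
    the ball.\<close>
  have ball_bounds: "AE x in lebesgue. x \<in> ball c \<delta> \<longrightarrow> r (e \<bullet> c - \<delta>) \<le> R x \<and> R x \<le> r (e \<bullet> c + \<delta>)"
    if c: "cball c \<delta> \<subseteq> C" "\<delta> > 0" for c \<delta>
  proof -
    have I': "e \<bullet> c - \<delta> \<in> I" "e \<bullet> c + \<delta> \<in> I"
      using near[OF c(1), of "- \<delta>"] near[OF c(1), of \<delta>] c(2) by simp_all
    have "AE x in lborel. x \<in> ball c \<delta> \<longrightarrow> r (e \<bullet> c - \<delta>) \<le> R x \<and> R x \<le> r (e \<bullet> c + \<delta>)"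
      using G(2)
    proof eventually_elim
      case (elim x)
      show ?case
      proof
        assume x: "x \<in> ball c \<delta>"
        then have xG: "x \<in> G" using elim c(1) ball_subset_cball by blast
        have xI: "e \<bullet> x \<in> I" using xG G(1) by (auto simp: I_def)
        have "\<bar>e \<bullet> (x - c)\<bar> \<le> norm e * norm (x - c)" by (rule Cauchy_Schwarz_ineq2)
        then have "\<bar>e \<bullet> x - e \<bullet> c\<bar> < \<delta>"
          using x e by (simp add: inner_diff_right dist_norm norm_minus_commute)
        then have "e \<bullet> c - \<delta> \<le> e \<bullet> x" "e \<bullet> x < e \<bullet> c + \<delta>" by linarith+
        then show "r (e \<bullet> c - \<delta>) \<le> R x \<and> R x \<le> r (e \<bullet> c + \<delta>)"
          using r_mono[OF I'(1) xI] r_low[OF xG] r_up[OF xG I'(2)] by linarith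
      qed
    qed
    then show ?thesis by (rule AE_completion)
  qed
  have pw: "a * u powr \<gamma> \<le> a * v powr \<gamma>" if "0 \<le> u" "u \<le> v" for u v
    using that pos by (intro mult_left_mono powr_mono2) auto
  have sandwich: "\<exists>\<delta>\<^sub>0>0. \<forall>\<delta>. 0 < \<delta> \<and> \<delta> < \<delta>\<^sub>0 \<longrightarrow>
       s - \<delta> \<in> I \<and> t + \<delta> \<in> I \<and>
       a * r (t - \<delta>) powr \<gamma> - a * r (s + \<delta>) powr \<gamma> \<le> g * (t - s) * r (t + \<delta>) \<and>
       g * (t - s) * r (s - \<delta>) \<le> a * r (t + \<delta>) powr \<gamma> - a * r (s - \<delta>) powr \<gamma>"
    if st: "s \<in> I" "t \<in> I" "s < t" for s t
  proof -
    obtain Y Z where Y: "Y \<in> C" "s = e \<bullet> Y" and Z: "Z \<in> C" "t = e \<bullet> Z" using st by (auto simp: I_def)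
    obtain d1 d2 where d: "d1 > 0" "cball Y d1 \<subseteq> C" "d2 > 0" "cball Z d2 \<subseteq> C"
      using room[OF Y(1)] room[OF Z(1)] by blast
    show ?thesis
    proof (intro exI[of _ "min d1 d2"] conjI allI impI)
      show "min d1 d2 > 0" using d by simp
      fix \<delta> assume \<delta>: "0 < \<delta> \<and> \<delta> < min d1 d2"
      have YC: "cball Y \<delta> \<subseteq> C"
        using subset_cball[of \<delta> d1 Y] d(2) \<delta> by (meson less_imp_le min_less_iff_conj subset_trans)
      have ZC: "cball Z \<delta> \<subseteq> C"
        using subset_cball[of \<delta> d2 Z] d(4) \<delta> by (meson less_imp_le min_less_iff_conj subset_trans)
      have in_I: "s - \<delta> \<in> I" "s + \<delta> \<in> I" "t - \<delta> \<in> I" "t + \<delta> \<in> I"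
        using near[OF YC, of "- \<delta>"] near[OF YC, of \<delta>] near[OF ZC, of "- \<delta>"] near[OF ZC, of \<delta>] \<delta> Y Z by simp_all
      then show "s - \<delta> \<in> I" "t + \<delta> \<in> I" by blast+
      define k where "k = Z - Y"
      have YK: "bump Y \<delta> x = 0" if "x \<notin> cball Y \<delta>" for x
        using that bump_eq_0_iff[of \<delta> Y x] \<delta> by auto
      have KC: "x \<in> C \<and> x + k \<in> C" if "x \<in> cball Y \<delta>" for x
      proof -
        have "x + k \<in> cball Z \<delta>" using that by (simp add: k_def dist_norm algebra_simps)
        then show ?thesis using that YC ZC by blast
      qed
      \<comment> \<open>The bump at \<open>Y\<close> is moved onto the bump at \<open>Z\<close>.
        Pressure is averaged over the two end balls, density over the intermediate ball at
        \<open>W\<close>; all three bumps have the same integral \<open>m\<close>, which divides out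
        at the end.\<close>
      obtain \<xi> where \<xi>: "0 < \<xi>" "\<xi> < 1"
        and id: "(\<integral>x. P x * bump Y \<delta> (x - k) \<partial>lebesgue) - (\<integral>x. P x * bump Y \<delta> x \<partial>lebesgue) =
          (k \<bullet> (g *\<^sub>R e)) * (\<integral>x. R x * bump Y \<delta> (x - \<xi> *\<^sub>R k) \<partial>lebesgue)"
        by (rule shifted_integral_identity[OF C(2) Pi' eq' Ck_bump compact_cball YK KC])
      define W where "W = Y + \<xi> *\<^sub>R k"
      define m where "m = (\<integral>x. bump Y \<delta> x \<partial>lebesgue)"
      have m: "m > 0" unfolding m_def using \<delta> by (intro integral_bump_pos) simp
      have mZ: "(\<integral>x. bump Z \<delta> x \<partial>lebesgue) = m" and mW: "(\<integral>x. bump W \<delta> x \<partial>lebesgue) = m"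
        using integral_bump_center[of Y k \<delta>] integral_bump_center[of Y "\<xi> *\<^sub>R k" \<delta>] by (simp_all add: m_def W_def k_def)
      have WC: "cball W \<delta> \<subseteq> C"
      proof
        fix x assume x: "x \<in> cball W \<delta>"
        define h where "h = x - W"
        have "Y + h \<in> cball Y \<delta>" "Z + h \<in> cball Z \<delta>"
          using x by (simp_all add: h_def dist_norm norm_minus_commute)
        then have "Y + h \<in> C" "Z + h \<in> C" using YC ZC by blast+
        then have "(1 - \<xi>) *\<^sub>R (Y + h) + \<xi> *\<^sub>R (Z + h) \<in> C"
          using C(2) \<xi> unfolding convex_alt by simp
        moreover have "(1 - \<xi>) *\<^sub>R (Y + h) + \<xi> *\<^sub>R (Z + h) = x"
          by (simp add: h_def W_def k_def algebra_simps)
        ultimately show "x \<in> C" by simp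
      qed
      have kb: "k \<bullet> (g *\<^sub>R e) = g * (t - s)"
        by (simp add: k_def Y Z inner_diff_left inner_diff_right inner_commute)
      have eW: "e \<bullet> W = s + \<xi> * (t - s)"
        by (simp add: W_def k_def Y Z inner_add_right inner_diff_right)
      have "0 \<le> \<xi> * (t - s)" "\<xi> * (t - s) \<le> t - s"
        using \<xi> st mult_right_mono[of \<xi> 1 "t - s"] by simp_all
      then have W_in: "s - \<delta> \<le> e \<bullet> W - \<delta>" "e \<bullet> W + \<delta> \<le> t + \<delta>" by (simp_all only: eW)
      have WI: "e \<bullet> W - \<delta> \<in> I" "e \<bullet> W + \<delta> \<in> I"
        using near[OF WC, of "- \<delta>"] near[OF WC, of \<delta>] \<delta> by simp_all
      have id': "(\<integral>x. P x * bump Z \<delta> x \<partial>lebesgue) - (\<integral>x. P x * bump Y \<delta> x \<partial>lebesgue) =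
          g * (t - s) * (\<integral>x. R x * bump W \<delta> x \<partial>lebesgue)"
        using id unfolding kb bump_translate W_def[symmetric] by (simp add: k_def)
      have Pb: "AE x in lebesgue. x \<in> ball c \<delta> \<longrightarrow> a * r (e \<bullet> c - \<delta>) powr \<gamma> \<le> P x \<and> P x \<le> a * r (e \<bullet> c + \<delta>) powr \<gamma>"
        if c: "cball c \<delta> \<subseteq> C" for c
      proof -
        have I': "e \<bullet> c - \<delta> \<in> I" using near[OF c, of "- \<delta>"] \<delta> by simp
        from \<delta> have "\<delta> > 0" by blast
        from ball_bounds[OF c this] show ?thesis
          by eventually_elim (use pw r_nonneg[OF I'] R0 in \<open>simp add: P_def\<close>)
      qed
      have \<delta>': "\<delta> > 0" using \<delta> by blast
      note PZ = integral_mult_bump_bounds[OF Pi' \<delta>' Pb[OF ZC], unfolded mZ, folded Z(2)]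
      note PY = integral_mult_bump_bounds[OF Pi' \<delta>' Pb[OF YC], folded m_def, folded Y(2)]
      note RW = integral_mult_bump_bounds[OF Ri \<delta>' ball_bounds[OF WC \<delta>'], unfolded mW]
      have gts: "0 \<le> g * (t - s)" using pos st by simp
      have "(a * r (t - \<delta>) powr \<gamma> - a * r (s + \<delta>) powr \<gamma>) * m \<le> g * (t - s) * (\<integral>x. R x * bump W \<delta> x \<partial>lebesgue)"
        using PZ(1) PY(2) id' by (simp add: left_diff_distrib)
      also have "\<dots> \<le> g * (t - s) * (r (t + \<delta>) * m)"
        using order_trans[OF RW(2) mult_right_mono[OF r_mono[OF WI(2) in_I(4) W_in(2)]]] m gts
        by (intro mult_left_mono) auto
      finally show "a * r (t - \<delta>) powr \<gamma> - a * r (s + \<delta>) powr \<gamma> \<le> g * (t - s) * r (t + \<delta>)"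
        using m by (simp flip: mult.assoc)
      have "g * (t - s) * (r (s - \<delta>) * m) \<le> g * (t - s) * (\<integral>x. R x * bump W \<delta> x \<partial>lebesgue)"
        using order_trans[OF mult_right_mono[OF r_mono[OF in_I(1) WI(1) W_in(1)]] RW(1)] m gts
        by (intro mult_left_mono) auto
      also have "\<dots> \<le> (a * r (t + \<delta>) powr \<gamma> - a * r (s - \<delta>) powr \<gamma>) * m"
        using PZ(2) PY(1) id' by (simp add: left_diff_distrib)
      finally show "g * (t - s) * r (s - \<delta>) \<le> a * r (t + \<delta>) powr \<gamma> - a * r (s - \<delta>) powr \<gamma>"
        using m by (simp flip: mult.assoc)
    qed
  qed
  obtain c where c: "\<And>t. t \<in> I \<Longrightarrow> r t = rest_density g a \<gamma> c t"
    using hydrostatic_ode[OF I_open I_int r_mono r_nonneg pos sandwich I_bdd] by blast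
  have "R y = rest_density g a \<gamma> c (e \<bullet> y)" if y: "y \<in> G" for y
  proof (rule antisym)
    have yI: "e \<bullet> y \<in> I" using y G(1) by (auto simp: I_def)
    show "rest_density g a \<gamma> c (e \<bullet> y) \<le> R y" using r_low[OF y] c[OF yI] by simp
    obtain d where d: "d > 0" "cball (e \<bullet> y) d \<subseteq> I" using I_open yI open_contains_cball by blast
    \<comment> \<open>The bound from above holds only at heights greater than that of
      \<open>y\<close>; continuity of the rest density extends it to the height of
      \<open>y\<close>.\<close>
    have "(rest_density g a \<gamma> c \<longlongrightarrow> rest_density g a \<gamma> c (e \<bullet> y)) (at (e \<bullet> y))"
      using continuous_on_rest_density[OF pos(3), of UNIV g a c] by (simp add: continuous_on_def)
    then have lim: "(rest_density g a \<gamma> c \<longlongrightarrow> rest_density g a \<gamma> c (e \<bullet> y)) (at_right (e \<bullet> y))"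
      by (rule tendsto_mono[OF at_le, rotated]) simp
    have "\<forall>\<^sub>F t in at_right (e \<bullet> y). R y \<le> rest_density g a \<gamma> c t"
      unfolding eventually_at_right_field
    proof (intro exI[of _ "e \<bullet> y + d"] conjI allI impI)
      fix t assume t: "e \<bullet> y < t" "t < e \<bullet> y + d"
      then have "t \<in> cball (e \<bullet> y) d" by (simp add: dist_real_def)
      then have "t \<in> I" using d(2) by blast
      then show "R y \<le> rest_density g a \<gamma> c t" using r_up[OF y _ t(1)] c by simp
    qed (use d in simp)
    then show "R y \<le> rest_density g a \<gamma> c (e \<bullet> y)"
      by (rule tendsto_lowerbound[OF lim]) simp
  qed
  then have "AE x in lborel. x \<in> C \<longrightarrow> R x = rest_density g a \<gamma> c (e \<bullet> x)"
    using G(2) by (auto elim: eventually_mono)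
  then show ?thesis by blast
qed

text \<open>The Fubini argument works with Borel functions on the whole space, while
  \<open>\<rho>\<close> is a Lebesgue class on \<open>C\<close>. It is replaced by a Borel
  representative, made nonnegative by truncation and set to zero outside \<open>C\<close>.\<close>

lemma hydrostatic_density_distr:
  fixes C :: "(real^'n::finite) set" and \<rho> :: "real^'n \<Rightarrow> real"
  assumes C: "open C" "convex C" "bounded C" and e: "norm e = 1"
    and pos: "g > 0" "a > 0" "\<gamma> > 1"
    and Lp: "in_Lp \<gamma> C \<rho>" and nonneg: "AE x in lebesgue_on C. 0 \<le> \<rho> x"
    and eq: "\<And>\<phi> j. test_function C \<phi> \<Longrightarrow> distr_deriv j (regular_distr C (\<lambda>x. a * \<rho> x powr \<gamma>)) \<phi> =
        regular_distr C (\<lambda>x. \<rho> x * (g *\<^sub>R e) $ j) \<phi>"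
  shows "\<exists>c. AE x in lebesgue_on C. \<rho> x = rest_density g a \<gamma> c (e \<bullet> x)"
proof -
  have C': "C \<in> sets lebesgue" using C by simp
  have \<rho>m: "(\<lambda>x. indicator C x * \<rho> x) \<in> borel_measurable lebesgue"
    using Lp C' borel_measurable_restrict_space_iff[of C lebesgue \<rho>] by (simp add: in_Lp_def)
  obtain R0 where R0 [measurable]: "R0 \<in> borel_measurable lborel" and R0_eq: "AE x in lborel. indicator C x * \<rho> x = R0 x"
    using completion_ex_borel_measurable_real[OF \<rho>m] by blast
  define R where "R x = indicator C x * max 0 (R0 x)" for x
  have [measurable]: "C \<in> sets borel" using C by simp
  have Rm [measurable]: "R \<in> borel_measurable borel"
    using R0 unfolding R_def by simp
  then have Rm' [measurable]: "R \<in> borel_measurable lebesgue"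
    by (simp add: measurable_completion)
  have R_nonneg: "0 \<le> R x" for x by (simp add: R_def)
  have R_out: "R x = 0" if "x \<notin> C" for x using that by (simp add: R_def)
  have R_eq: "AE x in lebesgue. x \<in> C \<longrightarrow> R x = \<rho> x"
  proof -
    have "AE x in lebesgue. x \<in> C \<longrightarrow> 0 \<le> \<rho> x" using nonneg by (simp add: AE_lebesgue_on[OF C'])
    then show ?thesis using AE_completion[OF R0_eq]
      by eventually_elim (auto simp: R_def max_def)
  qed
  have Rp_int: "integrable lebesgue (\<lambda>x. R x powr \<gamma>)"
  proof -
    have i: "integrable lebesgue (\<lambda>x. indicator C x * \<bar>\<rho> x\<bar> powr \<gamma>)"
      using Lp C' by (simp add: in_Lp_def integrable_restrict_space)
    have "AE x in lebesgue. R x powr \<gamma> = indicator C x * \<bar>\<rho> x\<bar> powr \<gamma>"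
      using R_eq
    proof eventually_elim
      case (elim x)
      then show ?case using R_out[of x] R_nonneg[of x] by (cases "x \<in> C") auto
    qed
    moreover have "(\<lambda>x. R x powr \<gamma>) \<in> borel_measurable lebesgue" by measurable
    ultimately show ?thesis
      using i integrable_cong_AE borel_measurable_integrable[OF i] by blast
  qed
  \<comment> \<open>On a set of finite measure \<open>R \<le> 1 + R powr \<gamma>\<close> gives
    integrability, since \<open>\<gamma> > 1\<close>.\<close>
  have R_int: "integrable lebesgue R"
  proof (rule Bochner_Integration.integrable_bound)
    have "C \<in> lmeasurable" using C by (intro bounded_set_imp_lmeasurable) auto
    then have "integrable lebesgue (indicator C :: _ \<Rightarrow> real)" using lmeasurable_iff_integrable by blast
    then show "integrable lebesgue (\<lambda>x. indicator C x + R x powr \<gamma>)"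
      using Rp_int by (intro Bochner_Integration.integrable_add)
    have "R x \<le> indicator C x + R x powr \<gamma>" for x
    proof (cases "x \<in> C")
      case True
      have "R x \<le> R x powr \<gamma>" if "R x \<ge> 1"
        using powr_mono[of 1 \<gamma> "R x"] that pos R_nonneg[of x] by simp
      moreover have "(indicator C x :: real) = 1" using True by simp
      moreover note powr_ge_zero[of "R x" \<gamma>]
      ultimately show ?thesis by linarith
    qed (simp add: R_out)
    then show "AE x in lebesgue. norm (R x) \<le> norm (indicator C x + R x powr \<gamma>)"
      using R_nonneg by (intro AE_I2) (simp add: add_nonneg_nonneg)
  qed (rule Rm')
  have to_R: "regular_distr C (\<lambda>x. h (\<rho> x)) \<phi> = (\<integral>x. h (R x) * \<phi> x \<partial>lebesgue)"
    if \<phi>: "test_function C \<phi>" and [measurable]: "h \<in> borel_measurable borel" for h \<phi>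
  proof -
    have \<phi>m [measurable]: "\<phi> \<in> borel_measurable lebesgue"
      using Ck_continuous[OF test_function_Ck[OF \<phi>]] by (rule continuous_borel_measurable_lebesgue)
    have "regular_distr C (\<lambda>x. h (\<rho> x)) \<phi> = (\<integral>x. indicator C x * (h (\<rho> x) * \<phi> x) \<partial>lebesgue)"
      by (rule regular_distr_lebesgue[OF C'])
    also have "\<dots> = (\<integral>x. h (indicator C x * \<rho> x) * \<phi> x \<partial>lebesgue)"
    proof (rule Bochner_Integration.integral_cong[OF refl])
      show "indicator C x * (h (\<rho> x) * \<phi> x) = h (indicator C x * \<rho> x) * \<phi> x" for x
        using test_function_eq_0[OF \<phi>, of x] by (cases "x \<in> C") auto
    qed
    also have "\<dots> = (\<integral>x. h (R x) * \<phi> x \<partial>lebesgue)"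
    proof (rule integral_cong_AE)
      show "(\<lambda>x. h (indicator C x * \<rho> x) * \<phi> x) \<in> borel_measurable lebesgue"
        using measurable_compose[OF \<rho>m, of h borel] by simp
      show "AE x in lebesgue. h (indicator C x * \<rho> x) * \<phi> x = h (R x) * \<phi> x"
        using R_eq
      proof eventually_elim
        case (elim x)
        then show ?case using R_out[of x] by (cases "x \<in> C") auto
      qed
    qed measurable
    finally show ?thesis .
  qed
  have "\<exists>c. AE x in lborel. x \<in> C \<longrightarrow> R x = rest_density g a \<gamma> c (e \<bullet> x)"
  proof (rule hydrostatic_density[OF C e pos Rm R_nonneg R_int])
    show "integrable lebesgue (\<lambda>x. a * R x powr \<gamma>)" using Rp_int by simp
    fix \<phi> j assume \<phi>: "test_function C \<phi>"
    have "- (\<integral>x. a * R x powr \<gamma> * partial_deriv j \<phi> x \<partial>lebesgue) = (\<integral>x. (R x * (g *\<^sub>R e) $ j) * \<phi> x \<partial>lebesgue)"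
      using eq[OF \<phi>, of j] to_R[OF test_function_partial_deriv[OF \<phi>], of "\<lambda>r. a * r powr \<gamma>" j]
        to_R[OF \<phi>, of "\<lambda>r. r * (g *\<^sub>R e) $ j"]
      by (simp add: distr_deriv_def)
    also have "\<dots> = (\<integral>x. (g *\<^sub>R e) $ j * (R x * \<phi> x) \<partial>lebesgue)"
      by (simp only: mult_ac)
    finally show "(\<integral>x. a * R x powr \<gamma> * partial_deriv j \<phi> x \<partial>lebesgue) =
        - ((g *\<^sub>R e) $ j * (\<integral>x. R x * \<phi> x \<partial>lebesgue))"
      by simp
  qed
  then obtain c where "AE x in lborel. x \<in> C \<longrightarrow> R x = rest_density g a \<gamma> c (e \<bullet> x)" by blast
  from AE_completion[OF this] R_eq have "AE x in lebesgue. x \<in> C \<longrightarrow> \<rho> x = rest_density g a \<gamma> c (e \<bullet> x)"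
    by eventually_elim auto
  then show ?thesis by (auto simp: AE_lebesgue_on[OF C'])
qed

subsection \<open>Fields at rest\<close>

text \<open>Preimages under \<open>f\<close> and \<open>g\<close> differ only inside a null set, all
  of whose subsets are measurable by completeness. This supplies measurability for arbitrary
  representatives of the rest state.\<close>

lemma borel_measurable_AE_eq:
  fixes f g :: "'a \<Rightarrow> 'b::topological_space"
  assumes M: "complete_measure M" and g: "g \<in> borel_measurable M" and eq: "AE x in M. f x = g x"
  shows "f \<in> borel_measurable M"
proof (rule borel_measurableI)
  interpret complete_measure M by (rule M)
  obtain N where N: "N \<in> null_sets M" "{x \<in> space M. f x \<noteq> g x} \<subseteq> N"
    using eq by (auto elim!: AE_E intro: null_setsI)
  fix S :: "'b set" assume S: "open S"
  have "f -` S \<inter> space M = (g -` S \<inter> space M - N) \<union> (f -` S \<inter> space M \<inter> N)"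
    using N(2) by auto
  moreover have "g -` S \<inter> space M - N \<in> sets M"
    using null_setsD2[OF N(1)] measurable_sets[OF g, of S] S by (intro sets.Diff) simp_all
  moreover have "f -` S \<inter> space M \<inter> N \<in> sets M"
    using complete[of "f -` S \<inter> space M \<inter> N" N] N(1) by simp
  ultimately show "f -` S \<inter> space M \<in> sets M"
    by (metis sets.Un)
qed

lemma complete_measure_lebesgue_on:
  assumes "\<Omega> \<in> sets lebesgue" shows "complete_measure (lebesgue_on \<Omega>)"
proof
  fix A B :: "'a set" assume "B \<subseteq> A" "A \<in> null_sets (lebesgue_on \<Omega>)"
  then have "B \<subseteq> \<Omega>" "B \<subseteq> A" "A \<in> null_sets lebesgue"
    using null_sets_restrict_space[OF assms] by auto
  then have "B \<in> sets lebesgue" using null_sets_completion_subset[of B A lborel] by (simp add: null_sets_def)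
  then show "B \<in> sets (lebesgue_on \<Omega>)"
    using \<open>B \<subseteq> \<Omega>\<close> assms by (auto simp: sets_restrict_space)
qed

lemma AE_lebesgue_on_subset:
  assumes "AE x in lebesgue_on \<Omega>. P x" "\<Omega> \<in> sets lebesgue" "K \<in> sets lebesgue" "K \<subseteq> \<Omega>"
  shows "AE x in lebesgue_on K. P x"
  using assms by (auto simp: AE_lebesgue_on elim: eventually_mono)

lemma locally_integrable_cong_AE:
  fixes f g :: "real^'n::finite \<Rightarrow> 'b::{banach, second_countable_topology}"
  assumes \<Omega>: "\<Omega> \<in> sets lebesgue" and g: "locally_integrable \<Omega> g" and eq: "AE x in lebesgue_on \<Omega>. f x = g x"
  shows "locally_integrable \<Omega> f"
  unfolding locally_integrable_def
proof (intro allI impI)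
  fix K :: "(real^'n) set" assume K: "compact K \<and> K \<subseteq> \<Omega>"
  then have K': "K \<in> sets lebesgue" by (simp add: compact_imp_closed)
  have i: "integrable (lebesgue_on K) g" using g K by (simp add: locally_integrable_def)
  have ae: "AE x in lebesgue_on K. f x = g x"
    using AE_lebesgue_on_subset[OF eq \<Omega> K'] K by blast
  have "f \<in> borel_measurable (lebesgue_on K)"
    by (rule borel_measurable_AE_eq[OF complete_measure_lebesgue_on[OF K'] borel_measurable_integrable[OF i] ae])
  then show "integrable (lebesgue_on K) f"
    using integrable_cong_AE[OF _ borel_measurable_integrable[OF i] ae] i by blast
qed

lemma locally_integrable_zero: "locally_integrable \<Omega> (\<lambda>x. 0)"
  by (simp add: locally_integrable_def)

lemma regular_distr_zero_AE:
  assumes "AE x in lebesgue_on \<Omega>. f x = 0" shows "regular_distr \<Omega> f \<phi> = 0"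
  unfolding regular_distr_def
  by (rule integral_eq_zero_AE) (use assms in eventually_elim, simp)

lemma distr_div_zero_AE:
  assumes "AE x in lebesgue_on \<Omega>. F x = 0" shows "distr_div \<Omega> F \<phi> = 0"
proof -
  have "AE x in lebesgue_on \<Omega>. F x $ i = 0" for i
    using assms by eventually_elim simp
  then show ?thesis
    by (simp add: distr_div_def distr_deriv_def regular_distr_zero_AE)
qed

lemma has_weak_partial_zero_AE:
  fixes f :: "real^'n::finite \<Rightarrow> real"
  assumes \<Omega>: "open \<Omega>" and f: "AE x in lebesgue_on \<Omega>. f x = 0"
  shows "has_weak_partial \<Omega> i f (\<lambda>x. 0)"
proof -
  have "locally_integrable \<Omega> f"
    using locally_integrable_cong_AE[OF _ locally_integrable_zero f] \<Omega> by simp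
  then show ?thesis
    using locally_integrable_zero[of \<Omega>]
    by (simp add: has_weak_partial_def distr_deriv_def regular_distr_zero_AE[OF f]) (simp add: regular_distr_def)
qed

lemma weak_partial_zero_AE:
  fixes f :: "real^'n::finite \<Rightarrow> real"
  assumes "open \<Omega>" "AE x in lebesgue_on \<Omega>. f x = 0"
  shows "AE x in lebesgue_on \<Omega>. weak_partial \<Omega> i f x = 0"
  using weak_partial_AE_eq[OF assms(1) has_weak_partial_zero_AE[OF assms]] .

lemma in_W12_0_zero_AE:
  fixes f :: "real^'n::finite \<Rightarrow> real"
  assumes \<Omega>: "open \<Omega>" and f: "AE x in lebesgue_on \<Omega>. f x = 0"
  shows "in_W12_0 \<Omega> f"
proof -
  have \<Omega>': "\<Omega> \<in> sets lebesgue" using \<Omega> by simp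
  have z: "square_integrable (lebesgue_on \<Omega>) (\<lambda>x. 0)" by (simp add: square_integrable_def)
  have "f \<in> borel_measurable (lebesgue_on \<Omega>)"
    by (rule borel_measurable_AE_eq[OF complete_measure_lebesgue_on[OF \<Omega>'] _ f]) simp
  then have "square_integrable (lebesgue_on \<Omega>) f"
    by (rule square_integrable_cong_AE(1)[OF z, rotated]) (use f in eventually_elim, simp)
  then have "in_W12 \<Omega> f"
    unfolding in_W12_def in_Lp_2_iff using z has_weak_partial_zero_AE[OF \<Omega> f] by blast
  moreover have "W12_norm \<Omega> (\<lambda>x. f x - 0) = 0"
  proof -
    have "integral\<^sup>L (lebesgue_on \<Omega>) (\<lambda>x. (f x)\<^sup>2) = 0"
      by (rule integral_eq_zero_AE) (use f in eventually_elim, simp)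
    moreover have "integral\<^sup>L (lebesgue_on \<Omega>) (\<lambda>x. (weak_partial \<Omega> i f x)\<^sup>2) = 0" for i
      by (rule integral_eq_zero_AE) (use weak_partial_zero_AE[OF \<Omega> f, of i] in eventually_elim, simp)
    ultimately show ?thesis by (simp add: W12_norm_def)
  qed
  ultimately show ?thesis
    unfolding in_W12_0_def
    by (intro conjI exI[of _ "\<lambda>n x. 0"]) (simp_all add: test_function_zero)
qed

lemma weak_grad_zero_AE:
  fixes v :: "real^'n::finite \<Rightarrow> real^'n"
  assumes \<Omega>: "open \<Omega>" and v: "AE x in lebesgue_on \<Omega>. v x = 0"
  shows "AE x in lebesgue_on \<Omega>. weak_grad \<Omega> v x = 0"
proof -
  have "AE x in lebesgue_on \<Omega>. v x $ i = 0" for i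
    using v by eventually_elim simp
  then have "AE x in lebesgue_on \<Omega>. weak_partial \<Omega> j (\<lambda>y. v y $ i) x = 0" for i j
    by (rule weak_partial_zero_AE[OF \<Omega>])
  then have "AE x in lebesgue_on \<Omega>. \<forall>i j. weak_partial \<Omega> j (\<lambda>y. v y $ i) x = 0"
    by (intro eventually_all_finite)
  then show ?thesis
    by eventually_elim (simp add: weak_grad_def vec_eq_iff)
qed

section \<open>Calculus and total mass of the rest density\<close>

lemma DERIV_pos_part_powr:
  assumes "\<beta> > 1"
  shows "((\<lambda>z::real. (max 0 z) powr \<beta>) has_real_derivative \<beta> * (max 0 z) powr (\<beta> - 1)) (at z)"
proof -
  consider "z > 0" | "z < 0" | "z = 0" by linarith
  then show ?thesis
  proof cases
    case 1
    have "((\<lambda>z. z powr \<beta>) has_real_derivative \<beta> * (max 0 z) powr (\<beta> - 1)) (at z)"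
      using has_real_derivative_powr[OF 1, of \<beta>] 1 by simp
    then show ?thesis
      by (rule has_field_derivative_transform_within_open[where S = "{0<..}"]) (use 1 in auto)
  next
    case 2
    have "((\<lambda>z. 0) has_real_derivative \<beta> * (max 0 z) powr (\<beta> - 1)) (at z)"
      using 2 by simp
    then show ?thesis
      by (rule has_field_derivative_transform_within_open[where S = "{..<0}"]) (use 2 in auto)
  next
    case 3
    have "continuous_on UNIV (\<lambda>h::real. (max 0 h) powr (\<beta> - 1))"
      by (rule continuous_on_powr') (use assms in \<open>auto intro!: continuous_intros\<close>)
    then have "((\<lambda>h::real. (max 0 h) powr (\<beta> - 1)) \<longlongrightarrow> (max 0 0) powr (\<beta> - 1)) (at 0)"
      unfolding continuous_on_def by (metis UNIV_I)
    then have "((\<lambda>h::real. (max 0 h) powr (\<beta> - 1)) \<longlongrightarrow> 0) (at 0)" by simp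
    then have "((\<lambda>h. ((max 0 (0 + h)) powr \<beta> - (max 0 0) powr \<beta>) / h) \<longlongrightarrow> 0) (at 0)"
    proof (rule Lim_transform_eventually)
      \<comment> \<open>At zero the difference quotient is the power with exponent
        \<open>\<beta> - 1\<close>, still positive, so it tends to zero.\<close>
      have "(max 0 h) powr (\<beta> - 1) = ((max 0 (0 + h)) powr \<beta> - (max 0 0) powr \<beta>) / h" if "h \<noteq> 0" for h :: real
        using that by (cases "h > 0") (auto simp: powr_diff max_def)
      then show "\<forall>\<^sub>F h in at 0. (max 0 h) powr (\<beta> - 1) = ((max 0 (0 + h)) powr \<beta> - (max 0 0) powr \<beta>) / h"
        by (simp add: eventually_at_filter)
    qed
    then show ?thesis using 3 by (simp add: DERIV_def)
  qed
qed

text \<open>Raising the density to the power \<gamma> gives the positive part to the power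
  \<open>\<beta> = \<gamma> / (\<gamma> - 1)\<close>, and differentiation returns the density
  exponent \<open>\<beta> - 1 = 1 / (\<gamma> - 1)\<close>. The slope in the rest density is the one
  for which \<open>a * \<beta> * \<kappa> = g\<close>.\<close>

lemma DERIV_rest_pressure:
  assumes "a > 0" "\<gamma> > 1"
  shows "((\<lambda>s. a * rest_density g a \<gamma> c s powr \<gamma>) has_real_derivative g * rest_density g a \<gamma> c s) (at s)"
proof -
  define \<kappa> where "\<kappa> = (\<gamma> - 1) / (a * \<gamma>) * g"
  define \<beta> where "\<beta> = \<gamma> / (\<gamma> - 1)"
  have \<beta>: "\<beta> > 1" "\<beta> - 1 = 1 / (\<gamma> - 1)" using assms by (simp_all add: \<beta>_def field_simps)
  have eq: "(\<lambda>s. a * rest_density g a \<gamma> c s powr \<gamma>) = (\<lambda>s. a * (max 0 (\<kappa> * s + c)) powr \<beta>)"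
    by (simp add: rest_density_def powr_powr \<beta>_def \<kappa>_def)
  have "((\<lambda>s. \<kappa> * s + c) has_real_derivative \<kappa>) (at s)"
    by (auto intro!: derivative_eq_intros)
  from DERIV_cmult[OF DERIV_chain2[OF DERIV_pos_part_powr[OF \<beta>(1)] this], of a]
  have "((\<lambda>s. a * (max 0 (\<kappa> * s + c)) powr \<beta>) has_real_derivative
      a * (\<beta> * (max 0 (\<kappa> * s + c)) powr (\<beta> - 1) * \<kappa>)) (at s)" .
  moreover have "a * (\<beta> * (max 0 (\<kappa> * s + c)) powr (\<beta> - 1) * \<kappa>) = g * rest_density g a \<gamma> c s"
  proof -
    have "a * \<beta> * \<kappa> = g" using assms by (simp add: \<beta>_def \<kappa>_def)
    moreover have "a * (\<beta> * (max 0 (\<kappa> * s + c)) powr (\<beta> - 1) * \<kappa>) = (a * \<beta> * \<kappa>) * (max 0 (\<kappa> * s + c)) powr (\<beta> - 1)"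
      by simp
    ultimately show ?thesis by (simp add: \<beta>(2) rest_density_def \<kappa>_def)
  qed
  ultimately show ?thesis by (simp add: eq)
qed

lemma continuous_rest_density_inner:
  assumes "\<gamma> > 1" shows "continuous_on UNIV (\<lambda>x. rest_density g a \<gamma> c (e \<bullet> x))"
  by (rule continuous_on_compose2[OF continuous_on_rest_density[OF assms, of UNIV]])
    (auto intro!: continuous_intros)

text \<open>The density may have a kink at the edge of the vacuum, but its pressure is continuously
  differentiable across it. Hence the balance of forces holds classically and passes to
  distributions by parts.\<close>

lemma rest_pressure_gradient:
  fixes e :: "real^'n::finite" and g a \<gamma> c :: real
  assumes "a > 0" "\<gamma> > 1"
  defines "P \<equiv> \<lambda>x. a * rest_density g a \<gamma> c (e \<bullet> x) powr \<gamma>"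
  shows "Ck (Suc 0) P" "partial_deriv j P = (\<lambda>x. rest_density g a \<gamma> c (e \<bullet> x) * (g *\<^sub>R e) $ j)"
proof -
  have der: "(P has_derivative (\<lambda>k. \<Sum>i\<in>UNIV. k $ i * (rest_density g a \<gamma> c (e \<bullet> x) * (g *\<^sub>R e) $ i))) (at x)" for x
  proof -
    have "((\<lambda>x. e \<bullet> x) has_derivative (\<lambda>k. e \<bullet> k)) (at x)"
      by (auto intro!: derivative_eq_intros)
    from has_derivative_compose[OF this DERIV_rest_pressure[OF assms(1,2), THEN has_field_derivative_imp_has_derivative]]
    have "(P has_derivative (\<lambda>k. g * rest_density g a \<gamma> c (e \<bullet> x) * (e \<bullet> k))) (at x)"
      by (simp add: P_def)
    moreover have "g * w * (e \<bullet> k) = (\<Sum>i\<in>UNIV. k $ i * (w * (g *\<^sub>R e) $ i))" for w k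
      by (simp add: inner_vec_def sum_distrib_left mult_ac)
    ultimately show ?thesis by simp
  qed
  have cont: "Ck 0 (\<lambda>x. rest_density g a \<gamma> c (e \<bullet> x) * (g *\<^sub>R e) $ i)" for i
    using continuous_rest_density_inner[OF assms(2)] by (auto intro!: continuous_on_mult continuous_on_const)
  show "Ck (Suc 0) P" "partial_deriv j P = (\<lambda>x. rest_density g a \<gamma> c (e \<bullet> x) * (g *\<^sub>R e) $ j)"
    using Ck_SucI[OF der cont] by auto
qed

lemma integrable_continuous_bounded_set:
  fixes C :: "(real^'n::finite) set" and f :: "real^'n \<Rightarrow> 'b::{banach, second_countable_topology}"
  assumes C: "bounded C" "C \<in> sets lebesgue" and f: "continuous_on UNIV f"
  shows "integrable (lebesgue_on C) f"
proof -
  obtain K where K: "compact K" "C \<subseteq> K"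
    using C(1) by (meson bounded_subset_cbox_symmetric compact_cbox)
  have "integrable lborel (\<lambda>x. indicator K x *\<^sub>R f x)"
    using f K by (intro borel_integrable_compact) (auto intro: continuous_on_subset)
  then have "integrable lebesgue (\<lambda>x. indicator K x *\<^sub>R f x)"
    using borel_measurable_integrable[of lborel] integrable_completion[of _ lborel] by blast
  then have "integrable lebesgue (\<lambda>x. indicator C x *\<^sub>R indicator K x *\<^sub>R f x)"
    by (rule integrable_mult_indicator[OF C(2)])
  also have "(\<lambda>x. indicator C x *\<^sub>R indicator K x *\<^sub>R f x) = (\<lambda>x. indicator C x *\<^sub>R f x)"
  proof
    fix x show "indicator C x *\<^sub>R indicator K x *\<^sub>R f x = indicator C x *\<^sub>R f x"
      using K(2) by (cases "x \<in> C") auto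
  qed
  finally show ?thesis using C(2) by (simp add: integrable_restrict_space)
qed

text \<open>Raising \<open>c\<close> strictly raises the density wherever it is positive. While the
  mass is zero a larger \<open>c\<close> may still give zero mass, hence the hypothesis
  \<open>pos\<close>.\<close>

lemma rest_density_mass_strict_mono:
  fixes C :: "(real^'n::finite) set" and e :: "real^'n"
  assumes C: "bounded C" "C \<in> sets lebesgue" and \<gamma>: "\<gamma> > 1" and "c < c'"
    and pos: "0 < integral\<^sup>L (lebesgue_on C) (\<lambda>x. rest_density g a \<gamma> c (e \<bullet> x))"
  shows "integral\<^sup>L (lebesgue_on C) (\<lambda>x. rest_density g a \<gamma> c (e \<bullet> x)) <
     integral\<^sup>L (lebesgue_on C) (\<lambda>x. rest_density g a \<gamma> c' (e \<bullet> x))"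
proof (rule ccontr)
  let ?f = "\<lambda>c x. rest_density g a \<gamma> c (e \<bullet> x)"
  assume "\<not> ?thesis"
  then have le: "integral\<^sup>L (lebesgue_on C) (?f c') - integral\<^sup>L (lebesgue_on C) (?f c) \<le> 0" by simp
  have int: "integrable (lebesgue_on C) (?f c)" for c
    by (rule integrable_continuous_bounded_set[OF C continuous_rest_density_inner[OF \<gamma>]])
  have mono: "?f c x \<le> ?f c' x" for x
    unfolding rest_density_def using \<open>c < c'\<close> \<gamma> by (intro powr_mono2) auto
  have strict: "?f c x < ?f c' x" if "?f c x > 0" for x
    unfolding rest_density_def using \<open>c < c'\<close> \<gamma> that
    by (intro powr_less_mono2) (auto simp: rest_density_def max_def split: if_splits)
  have "integral\<^sup>L (lebesgue_on C) (\<lambda>x. ?f c' x - ?f c x) = 0"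
  proof (rule antisym)
    show "integral\<^sup>L (lebesgue_on C) (\<lambda>x. ?f c' x - ?f c x) \<le> 0" using le int by simp
    show "0 \<le> integral\<^sup>L (lebesgue_on C) (\<lambda>x. ?f c' x - ?f c x)"
      using mono by (intro integral_nonneg_AE) simp
  qed
  then have "AE x in lebesgue_on C. ?f c' x - ?f c x = 0"
    using integral_nonneg_eq_0_iff_AE[where M = "lebesgue_on C" and f = "\<lambda>x. ?f c' x - ?f c x"] int mono by simp
  then have "AE x in lebesgue_on C. ?f c x = 0"
  proof eventually_elim
    case (elim x)
    then show ?case using strict[of x] rest_density_nonneg[of g a \<gamma> c "e \<bullet> x"] by force
  qed
  then have "integral\<^sup>L (lebesgue_on C) (?f c) = 0"
    by (rule integral_eq_zero_AE)
  then show False using pos by simp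
qed

lemma rest_density_mass_unique:
  fixes C :: "(real^'n::finite) set" and e :: "real^'n"
  assumes C: "bounded C" "C \<in> sets lebesgue" and \<gamma>: "\<gamma> > 1" and M: "M > 0"
    and c: "integral\<^sup>L (lebesgue_on C) (\<lambda>x. rest_density g a \<gamma> c (e \<bullet> x)) = M"
  shows "integral\<^sup>L (lebesgue_on C) (\<lambda>x. rest_density g a \<gamma> c' (e \<bullet> x)) = M \<longleftrightarrow> c' = c"
proof
  assume c': "integral\<^sup>L (lebesgue_on C) (\<lambda>x. rest_density g a \<gamma> c' (e \<bullet> x)) = M"
  show "c' = c"
    using rest_density_mass_strict_mono[OF C \<gamma>, of c c' g a e] rest_density_mass_strict_mono[OF C \<gamma>, of c' c g a e] c c' M
    by (cases c c' rule: linorder_cases) simp_all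
qed (use c in simp)

subsection \<open>Rotations and the centre of mass\<close>

text \<open>The measure is determined by its values on boxes, and the preimage of a box is its image
  under the inverse isometry, which preserves measure.\<close>

lemma distr_lborel_orthogonal:
  fixes f :: "real^'n::{finite,wellorder} \<Rightarrow> real^'n::_"
  assumes f: "orthogonal_transformation f"
  shows "distr lborel borel f = lborel"
proof (rule lborel_eqI[symmetric])
  have cont: "continuous_on UNIV f"
    by (rule linear_continuous_on[OF linear_conv_bounded_linear[THEN iffD1, OF orthogonal_transformation_linear[OF f]]])
  then have fm: "f \<in> borel_measurable borel" by (rule borel_measurable_continuous_onI)
  fix l u :: "real^'n::_" assume lu: "\<And>b. b \<in> Basis \<Longrightarrow> l \<bullet> b \<le> u \<bullet> b"
  have vi: "f -` box l u = inv f ` box l u"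
    using bij_vimage_eq_inv_image[OF orthogonal_transformation_bij[OF f]] .
  have "open (f -` box l u)" using cont by (intro open_vimage) auto
  then have b: "f -` box l u \<in> sets borel" by simp
  have meas: "f -` box l u \<in> lmeasurable" "measure lebesgue (f -` box l u) = measure lebesgue (box l u)"
    unfolding vi using measurable_orthogonal_image[OF orthogonal_transformation_inv[OF f] lmeasurable_box]
      measure_orthogonal_image[OF orthogonal_transformation_inv[OF f] lmeasurable_box] by simp_all
  have "emeasure (distr lborel borel f) (box l u) = emeasure lborel (f -` box l u)"
    using fm by (subst emeasure_distr) auto
  also have "\<dots> = emeasure lebesgue (f -` box l u)" using b by simp
  also have "\<dots> = ennreal (measure lebesgue (box l u))"
    using emeasure_eq_measure2[OF meas(1)] meas(2) by simp
  also have "\<dots> = emeasure lborel (box l u)"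
    using emeasure_eq_measure2[OF lmeasurable_box[of l u]] by simp
  also have "\<dots> = ennreal (\<Prod>b\<in>Basis. (u - l) \<bullet> b)"
    using lu by (simp add: emeasure_lborel_box_eq)
  finally show "emeasure (distr lborel borel f) (box l u) = ennreal (\<Prod>b\<in>Basis. (u - l) \<bullet> b)" .
qed simp

lemma lebesgue_orthogonal:
  fixes f :: "real^'n::{finite,wellorder} \<Rightarrow> real^'n::_"
  assumes f: "orthogonal_transformation f"
  shows "f \<in> lebesgue \<rightarrow>\<^sub>M lebesgue" "distr lebesgue lebesgue f = lebesgue"
proof -
  have "f \<in> borel_measurable borel"
    by (rule borel_measurable_continuous_onI[OF
        linear_continuous_on[OF linear_conv_bounded_linear[THEN iffD1, OF orthogonal_transformation_linear[OF f]]]])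
  then have fm: "f \<in> lborel \<rightarrow>\<^sub>M lborel" by simp
  have d: "distr lebesgue lborel f = lborel"
  proof -
    have "distr lebesgue lborel f = distr lborel lborel f"
      using fm by (rule distr_completion)
    also have "\<dots> = distr lborel borel f" by (rule distr_cong) simp_all
    finally show ?thesis by (simp add: distr_lborel_orthogonal[OF f])
  qed
  have eq: "null_sets lborel = null_sets (distr lebesgue lborel f)" by (simp add: d)
  have fm': "f \<in> lebesgue \<rightarrow>\<^sub>M lborel" using fm by (rule measurable_completion)
  show "f \<in> lebesgue \<rightarrow>\<^sub>M lebesgue"
    using fm' eq by (simp add: completion.measurable_completion2)
  have "completion (distr lebesgue lborel f) = distr lebesgue lebesgue f"
    using fm' eq by (subst completion.completion_distr_eq) auto
  then show "distr lebesgue lebesgue f = lebesgue" by (simp add: d)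
qed

lemma lebesgue_on_orthogonal:
  fixes f :: "real^'n::{finite,wellorder} \<Rightarrow> real^'n::_" and F :: "real^'n::_ \<Rightarrow> 'b::{banach, second_countable_topology}"
  assumes f: "orthogonal_transformation f" and C: "C \<in> sets lebesgue"
    and F: "F \<in> borel_measurable (lebesgue_on C)"
  shows "f -` C \<in> sets lebesgue"
    "integral\<^sup>L (lebesgue_on (f -` C)) (\<lambda>y. F (f y)) = integral\<^sup>L (lebesgue_on C) F"
    "integrable (lebesgue_on C) F \<Longrightarrow> integrable (lebesgue_on (f -` C)) (\<lambda>y. F (f y))"
proof -
  note fm = lebesgue_orthogonal(1)[OF f] and fd = lebesgue_orthogonal(2)[OF f]
  show C': "f -` C \<in> sets lebesgue"
    using measurable_sets[OF fm C] by simp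
  define H where "H x = indicator C x *\<^sub>R F x" for x
  have H: "H \<in> borel_measurable lebesgue"
    using F C borel_measurable_restrict_space_iff[of C lebesgue F] by (simp add: H_def[abs_def])
  have ind: "(\<lambda>y. indicator (f -` C) y *\<^sub>R F (f y)) = (\<lambda>y. H (f y))"
    by (simp add: H_def indicator_def fun_eq_iff)
  have "integral\<^sup>L (lebesgue_on (f -` C)) (\<lambda>y. F (f y)) = (\<integral>y. H (f y) \<partial>lebesgue)"
    using C' by (simp add: integral_restrict_space ind)
  also have "\<dots> = integral\<^sup>L (distr lebesgue lebesgue f) H"
    by (rule integral_distr[OF fm H, symmetric])
  also have "\<dots> = integral\<^sup>L (lebesgue_on C) F"
    using C by (simp add: fd integral_restrict_space H_def[abs_def])
  finally show "integral\<^sup>L (lebesgue_on (f -` C)) (\<lambda>y. F (f y)) = integral\<^sup>L (lebesgue_on C) F" .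
  assume "integrable (lebesgue_on C) F"
  then have "integrable (distr lebesgue lebesgue f) H"
    using C by (simp add: fd integrable_restrict_space H_def[abs_def])
  then have "integrable lebesgue (\<lambda>y. H (f y))"
    by (subst (asm) integrable_distr_eq[OF fm H])
  then show "integrable (lebesgue_on (f -` C)) (\<lambda>y. F (f y))"
    using C' by (simp add: integrable_restrict_space ind)
qed

text \<open>The downward vertical \<open>e\<^sub>1\<close> of the inertial frame, seen in the body frame rotated by \<open>\<theta>\<close>.\<close>

definition down :: "real \<Rightarrow> real^3" where
  "down \<theta> = vector [cos \<theta>, - sin \<theta>, 0]"

lemma rot_e3_nth:
  "(rot_e3 \<theta> *v x) $ 1 = cos \<theta> * x $ 1 - sin \<theta> * x $ 2"
  "(rot_e3 \<theta> *v x) $ 2 = sin \<theta> * x $ 1 + cos \<theta> * x $ 2"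
  "(rot_e3 \<theta> *v x) $ 3 = x $ 3"
  by (simp_all add: rot_e3_def matrix_vector_mult_def sum_3 vector_3)

lemma transpose_rot_e3_nth:
  "(transpose (rot_e3 \<theta>) *v x) $ 1 = cos \<theta> * x $ 1 + sin \<theta> * x $ 2"
  "(transpose (rot_e3 \<theta>) *v x) $ 2 = - sin \<theta> * x $ 1 + cos \<theta> * x $ 2"
  "(transpose (rot_e3 \<theta>) *v x) $ 3 = x $ 3"
  by (simp_all add: rot_e3_def transpose_def matrix_vector_mult_def sum_3 vector_3)

lemma cos_sin_1: "cos \<theta> * (cos \<theta> * z) + sin \<theta> * (sin \<theta> * z) = (z :: real)"
  using sin_cos_squared_add2[of \<theta>] by (simp add: power2_eq_square flip: mult.assoc distrib_right)

lemma rot_e3_inverse: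
  "transpose (rot_e3 \<theta>) *v (rot_e3 \<theta> *v x) = x" "rot_e3 \<theta> *v (transpose (rot_e3 \<theta>) *v x) = x"
  by (simp_all add: vec_eq_iff forall_3 rot_e3_nth transpose_rot_e3_nth algebra_simps cos_sin_1
      del: transpose_matrix_vector)

lemma orthogonal_transpose_rot_e3: "orthogonal_transformation (\<lambda>y. transpose (rot_e3 \<theta>) *v y)"
proof -
  have "(transpose (rot_e3 \<theta>) *v x) \<bullet> (transpose (rot_e3 \<theta>) *v y) = x \<bullet> y" for x y
  proof -
    have "(transpose (rot_e3 \<theta>) *v x) \<bullet> (transpose (rot_e3 \<theta>) *v y) =
        (cos \<theta> * cos \<theta> + sin \<theta> * sin \<theta>) * (x $ 1 * y $ 1 + x $ 2 * y $ 2) + x $ 3 * y $ 3"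
      unfolding inner_vec_def sum_3 transpose_rot_e3_nth inner_real_def by algebra
    also have "cos \<theta> * cos \<theta> + sin \<theta> * sin \<theta> = 1"
      using sin_cos_squared_add2[of \<theta>] by (simp add: power2_eq_square)
    also have "1 * (x $ 1 * y $ 1 + x $ 2 * y $ 2) + x $ 3 * y $ 3 = x \<bullet> y"
      by (simp add: inner_vec_def sum_3)
    finally show ?thesis .
  qed
  then show ?thesis
    by (simp add: orthogonal_transformation_def matrix_vector_mul_linear del: transpose_matrix_vector)
qed

text \<open>Change of variables pulls sets back, so the rotated domains are rewritten as preimages
  under the inverse rotation.\<close>

lemma rot_e3_image: "(\<lambda>x. rot_e3 \<theta> *v x) ` A = (\<lambda>y. transpose (rot_e3 \<theta>) *v y) -` A"
proof (intro set_eqI iffI)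
  fix y assume "y \<in> (\<lambda>x. rot_e3 \<theta> *v x) ` A"
  then obtain x where "x \<in> A" "y = rot_e3 \<theta> *v x" by blast
  then show "y \<in> (\<lambda>y. transpose (rot_e3 \<theta>) *v y) -` A"
    by (simp add: rot_e3_inverse del: transpose_matrix_vector)
next
  fix y assume "y \<in> (\<lambda>y. transpose (rot_e3 \<theta>) *v y) -` A"
  then have "rot_e3 \<theta> *v (transpose (rot_e3 \<theta>) *v y) \<in> (\<lambda>x. rot_e3 \<theta> *v x) ` A"
    by blast
  then show "y \<in> (\<lambda>x. rot_e3 \<theta> *v x) ` A"
    by (simp only: rot_e3_inverse(2))
qed

lemma rot_e3_down: "(rot_e3 \<theta> *v x) $ 1 = down \<theta> \<bullet> x"
  by (simp add: rot_e3_nth down_def inner_vec_def sum_3 vector_3)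

lemma norm_down: "norm (down \<theta>) = 1"
  using sin_cos_squared_add2[of \<theta>] by (simp add: norm_eq_1 down_def inner_vec_def sum_3 vector_3 power2_eq_square)

lemma rot_e3_gravity: "rot_e3 \<theta> *v gv = g *\<^sub>R e1 \<longleftrightarrow> gv = g *\<^sub>R down \<theta>"
proof -
  have "rot_e3 \<theta> *v (g *\<^sub>R down \<theta>) = g *\<^sub>R e1"
    by (simp add: vec_eq_iff forall_3 rot_e3_nth down_def vector_3 e1_def axis_def algebra_simps cos_sin_1)
  then show ?thesis by (metis rot_e3_inverse(1))
qed

lemma horizontal_axis_gravity:
  fixes gv :: "real^3"
  assumes "gv $ 3 = 0" "norm gv = g" "g > 0"
  obtains \<theta> where "0 \<le> \<theta>" "\<theta> < 2 * pi" "gv = g *\<^sub>R down \<theta>"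
proof -
  have sq: "g\<^sup>2 = (gv $ 1)\<^sup>2 + (gv $ 2)\<^sup>2"
  proof -
    have "g\<^sup>2 = gv \<bullet> gv" using assms(2) power2_norm_eq_inner[of gv] by simp
    then show ?thesis using assms(1) by (simp add: inner_vec_def sum_3 power2_eq_square)
  qed
  \<comment> \<open>The sign of the second entry matches the \<open>- sin \<theta>\<close> in
    \<open>down\<close>, since the body frame sees the vertical rotated by the opposite
    angle.\<close>
  have "(gv $ 1 / g)\<^sup>2 + (- (gv $ 2) / g)\<^sup>2 = ((gv $ 1)\<^sup>2 + (gv $ 2)\<^sup>2) / g\<^sup>2"
    by (simp add: power_divide add_divide_distrib)
  also have "\<dots> = 1"
    unfolding sq[symmetric] using assms(3) by simp
  finally have "(gv $ 1 / g)\<^sup>2 + (- (gv $ 2) / g)\<^sup>2 = 1" .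
  then obtain \<theta> where "0 \<le> \<theta>" "\<theta> < 2 * pi" "gv $ 1 / g = cos \<theta>" "- (gv $ 2) / g = sin \<theta>"
    using sincos_total_2pi by metis
  moreover from this have "gv = g *\<^sub>R down \<theta>"
    using assms(1,3) by (simp add: vec_eq_iff forall_3 down_def vector_3 field_simps)
  ultimately show thesis using that by blast
qed

lemma torque_down: "e3 \<bullet> cross3 X (g *\<^sub>R down \<theta>) = - g * (rot_e3 \<theta> *v X) $ 2"
  by (simp add: cross3_def e3_def inner_vec_def sum_3 axis_def vector_3 down_def rot_e3_nth algebra_simps)

lemma cross3_e3_down_eq_0:
  assumes "\<omega> *\<^sub>R cross3 e3 (g *\<^sub>R down \<theta>) = 0" "g > 0" shows "\<omega> = 0"
proof (rule ccontr)
  assume "\<omega> \<noteq> 0"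
  then have "cross3 e3 (g *\<^sub>R down \<theta>) = 0" using assms(1) by simp
  then have "sin \<theta> = 0" "cos \<theta> = 0"
    using assms(2) by (simp_all add: cross3_def e3_def axis_def vector_3 down_def vec_eq_iff forall_3)
  then show False using sin_cos_squared_add[of \<theta>] by simp
qed

lemma full_velocity_zero: "full_velocity v 0 = v"
  by (simp add: full_velocity_def fun_eq_iff)

text \<open>Convection, rotation and viscous terms vanish almost everywhere, including the weak
  gradient, whatever representative was chosen. An equivalence lets one reduction serve both
  directions of the theorem.\<close>

lemma momentum_equation_at_rest:
  assumes C: "open C" and v: "AE x in lebesgue_on C. v x = 0"
  shows "momentum_equation C a \<gamma> \<mu> lam \<rho> v 0 gv \<longleftrightarrow>
    (\<forall>j. locally_integrable C (\<lambda>x. pressure a \<gamma> (\<rho> x)) \<and> locally_integrable C (\<lambda>x. \<rho> x * gv $ j) \<and>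
      (\<forall>\<phi>. test_function C \<phi> \<longrightarrow>
        distr_deriv j (regular_distr C (\<lambda>x. pressure a \<gamma> (\<rho> x))) \<phi> = regular_distr C (\<lambda>x. \<rho> x * gv $ j) \<phi>))"
proof -
  have C': "C \<in> sets lebesgue" using C by simp
  have conv: "AE x in lebesgue_on C. (\<rho> x * v x $ j) *\<^sub>R v x = 0" for j
    using v by eventually_elim simp
  have visc: "AE x in lebesgue_on C. column j (stress \<mu> lam C v x) = 0" for j
    using weak_grad_zero_AE[OF C v]
    by eventually_elim (simp add: stress_def Let_def weak_div_def column_def vec_eq_iff trace_def transpose_def)
  have li: "locally_integrable C (\<lambda>x. (\<rho> x * v x $ j) *\<^sub>R v x)" "locally_integrable C (\<lambda>x. column j (stress \<mu> lam C v x))" for j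
    by (rule locally_integrable_cong_AE[OF C' locally_integrable_zero conv],
        rule locally_integrable_cong_AE[OF C' locally_integrable_zero visc])
  show ?thesis
    unfolding momentum_equation_def Let_def full_velocity_zero
    by (simp add: li distr_div_zero_AE[OF conv] distr_div_zero_AE[OF visc] locally_integrable_zero
        regular_distr_zero_AE[where f = "\<lambda>x. 0"])
qed

section \<open>Moments of mass in the rotated frame\<close>

context
  fixes C B :: "(real^3) set" and \<rho>B \<rho> :: "real^3 \<Rightarrow> real" and m M g a \<gamma> c \<theta> :: real
  assumes C: "open C" and CB: "C \<inter> B = {}" and S: "bounded (B \<union> C)" "open (B \<union> C)"
    and \<rho>B: "has_bochner_integral (lebesgue_on B) \<rho>B m"
    and origin: "integral\<^sup>L (lebesgue_on B) (\<lambda>x. \<rho>B x * x $ 3) = 0"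
    and \<gamma>: "\<gamma> > 1" and g: "g > 0" and mass: "M + m > 0"
    and \<rho>: "AE x in lebesgue_on C. \<rho> x = rest_density g a \<gamma> c ((rot_e3 \<theta> *v x) $ 1)"
begin

private abbreviation (input) "Q \<equiv> rot_e3 \<theta>"
private abbreviation (input) "rs \<equiv> rest_density g a \<gamma> c"

private lemma meas: "C \<in> sets lebesgue" "B \<in> sets lebesgue" "bounded C" "bounded B"
proof -
  have "B = (B \<union> C) - C" using CB by blast
  moreover have "(B \<union> C) - C \<in> sets lebesgue" using S(2) C by (intro sets.Diff) simp_all
  ultimately show "B \<in> sets lebesgue" by simp
  show "C \<in> sets lebesgue" using C by simp
  show "bounded C" "bounded B" using S(1) by simp_all
qed

private lemma fluid_moment:
  "integrable (lebesgue_on C) (\<lambda>x. rs (down \<theta> \<bullet> x) *\<^sub>R x)"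
  "integral\<^sup>L (lebesgue_on C) (\<lambda>x. \<rho> x *\<^sub>R x) = integral\<^sup>L (lebesgue_on C) (\<lambda>x. rs (down \<theta> \<bullet> x) *\<^sub>R x)"
  "integrable (lebesgue_on C) (\<lambda>x. \<rho> x *\<^sub>R x)"
proof -
  have "continuous_on UNIV (\<lambda>x. rs (down \<theta> \<bullet> x) *\<^sub>R x)"
    by (intro continuous_on_scaleR continuous_rest_density_inner[OF \<gamma>] continuous_on_id)
  then show i: "integrable (lebesgue_on C) (\<lambda>x. rs (down \<theta> \<bullet> x) *\<^sub>R x)"
    by (rule integrable_continuous_bounded_set[OF meas(3,1)])
  have ae: "AE x in lebesgue_on C. \<rho> x *\<^sub>R x = rs (down \<theta> \<bullet> x) *\<^sub>R x"
    using \<rho> by eventually_elim (simp add: rot_e3_down)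
  have m: "(\<lambda>x. \<rho> x *\<^sub>R x) \<in> borel_measurable (lebesgue_on C)"
    by (rule borel_measurable_AE_eq[OF complete_measure_lebesgue_on[OF meas(1)] borel_measurable_integrable[OF i] ae])
  show "integral\<^sup>L (lebesgue_on C) (\<lambda>x. \<rho> x *\<^sub>R x) = integral\<^sup>L (lebesgue_on C) (\<lambda>x. rs (down \<theta> \<bullet> x) *\<^sub>R x)"
    by (rule integral_cong_AE[OF m borel_measurable_integrable[OF i] ae])
  show "integrable (lebesgue_on C) (\<lambda>x. \<rho> x *\<^sub>R x)"
    using integrable_cong_AE[OF m borel_measurable_integrable[OF i] ae] i by blast
qed

private lemma body_moment: "integrable (lebesgue_on B) (\<lambda>x. \<rho>B x *\<^sub>R x)"
proof -
  obtain r where r: "\<And>x. x \<in> B \<Longrightarrow> norm x \<le> r" using meas(4) unfolding bounded_iff by blast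
  have i: "integrable (lebesgue_on B) \<rho>B" using \<rho>B by (simp add: has_bochner_integral_iff)
  show ?thesis
  proof (rule Bochner_Integration.integrable_bound)
    show "integrable (lebesgue_on B) (\<lambda>x. r * \<rho>B x)" using i by simp
    have "(\<lambda>x. x) \<in> borel_measurable (lebesgue_on B)"
      by (intro measurable_restrict_space1 continuous_borel_measurable_lebesgue continuous_on_id)
    then show "(\<lambda>x. \<rho>B x *\<^sub>R x) \<in> borel_measurable (lebesgue_on B)"
      using borel_measurable_integrable[OF i] by (intro borel_measurable_scaleR)
    have "\<bar>\<rho>B x\<bar> * norm x \<le> \<bar>r * \<rho>B x\<bar>" if "x \<in> B" for x
      using mult_left_mono[OF order_trans[OF r[OF that] abs_ge_self], of "\<bar>\<rho>B x\<bar>"] by (simp add: abs_mult mult.commute)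
    then show "AE x in lebesgue_on B. norm (\<rho>B x *\<^sub>R x) \<le> norm (r * \<rho>B x)"
      by (intro AE_I2) (simp add: space_restrict_space)
  qed
qed

private lemma total_moment:
  "integral\<^sup>L (lebesgue_on (B \<union> C)) (\<lambda>x. total_density C \<rho> \<rho>B x *\<^sub>R x) =
    integral\<^sup>L (lebesgue_on C) (\<lambda>x. rs (down \<theta> \<bullet> x) *\<^sub>R x) + integral\<^sup>L (lebesgue_on B) (\<lambda>x. \<rho>B x *\<^sub>R x)"
proof -
  have iC: "integrable lebesgue (\<lambda>x. indicator C x *\<^sub>R \<rho> x *\<^sub>R x)"
    using fluid_moment(3) meas by (simp add: integrable_restrict_space)
  have iB: "integrable lebesgue (\<lambda>x. indicator B x *\<^sub>R \<rho>B x *\<^sub>R x)"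
    using body_moment meas by (simp add: integrable_restrict_space)
  have "integral\<^sup>L (lebesgue_on (B \<union> C)) (\<lambda>x. total_density C \<rho> \<rho>B x *\<^sub>R x) =
     (\<integral>x. indicator (B \<union> C) x *\<^sub>R total_density C \<rho> \<rho>B x *\<^sub>R x \<partial>lebesgue)"
    using meas by (simp add: integral_restrict_space)
  also have "\<dots> = (\<integral>x. indicator C x *\<^sub>R \<rho> x *\<^sub>R x + indicator B x *\<^sub>R \<rho>B x *\<^sub>R x \<partial>lebesgue)"
  proof (rule Bochner_Integration.integral_cong[OF refl])
    fix x show "indicator (B \<union> C) x *\<^sub>R total_density C \<rho> \<rho>B x *\<^sub>R x = indicator C x *\<^sub>R \<rho> x *\<^sub>R x + indicator B x *\<^sub>R \<rho>B x *\<^sub>R x"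
      using CB by (cases "x \<in> C"; cases "x \<in> B") (auto simp: total_density_def)
  qed
  also have "\<dots> = (\<integral>x. indicator C x *\<^sub>R \<rho> x *\<^sub>R x \<partial>lebesgue) + (\<integral>x. indicator B x *\<^sub>R \<rho>B x *\<^sub>R x \<partial>lebesgue)"
    by (rule Bochner_Integration.integral_add[OF iC iB])
  also have "\<dots> = integral\<^sup>L (lebesgue_on C) (\<lambda>x. \<rho> x *\<^sub>R x) + integral\<^sup>L (lebesgue_on B) (\<lambda>x. \<rho>B x *\<^sub>R x)"
    using meas by (simp add: integral_restrict_space)
  finally show ?thesis by (simp add: fluid_moment(2))
qed

private lemma rotated_moment:
  fixes D :: "(real^3) set"
  assumes D: "D \<in> sets lebesgue" and h: "integrable (lebesgue_on D) (\<lambda>x. h x *\<^sub>R x)"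
  defines "T \<equiv> \<lambda>y. transpose Q *v y"
  shows "integrable (lebesgue_on ((\<lambda>x. Q *v x) ` D)) (\<lambda>y. h (T y) *\<^sub>R y)"
    "integral\<^sup>L (lebesgue_on ((\<lambda>x. Q *v x) ` D)) (\<lambda>y. h (T y) *\<^sub>R y) = Q *v integral\<^sup>L (lebesgue_on D) (\<lambda>x. h x *\<^sub>R x)"
    "integral\<^sup>L (lebesgue_on ((\<lambda>x. Q *v x) ` D)) (\<lambda>y. h (T y) * y $ i) = (Q *v integral\<^sup>L (lebesgue_on D) (\<lambda>x. h x *\<^sub>R x)) $ i"
proof -
  have bl: "bounded_linear (\<lambda>x. Q *v x)"
    by (simp add: matrix_vector_mul_bounded_linear)
  define F where "F x = Q *v (h x *\<^sub>R x)" for x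
  have F: "integrable (lebesgue_on D) F"
    unfolding F_def using integrable_bounded_linear[OF bl h] .
  have FT: "F (T y) = h (T y) *\<^sub>R y" for y
    unfolding F_def T_def by (simp only: rot_e3_inverse(2) matrix_vector_mult_scaleR)
  have ot: "orthogonal_transformation T" unfolding T_def by (rule orthogonal_transpose_rot_e3)
  have im: "(\<lambda>x. Q *v x) ` D = T -` D" unfolding T_def by (rule rot_e3_image)
  note L = lebesgue_on_orthogonal[OF ot D borel_measurable_integrable[OF F], folded im, unfolded FT]
  show 1: "integrable (lebesgue_on ((\<lambda>x. Q *v x) ` D)) (\<lambda>y. h (T y) *\<^sub>R y)"
    using L(3)[OF F] .
  have "integral\<^sup>L (lebesgue_on D) F = Q *v integral\<^sup>L (lebesgue_on D) (\<lambda>x. h x *\<^sub>R x)"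
    unfolding F_def by (rule integral_bounded_linear[OF bl h])
  then show 2: "integral\<^sup>L (lebesgue_on ((\<lambda>x. Q *v x) ` D)) (\<lambda>y. h (T y) *\<^sub>R y) = Q *v integral\<^sup>L (lebesgue_on D) (\<lambda>x. h x *\<^sub>R x)"
    using L(2) by simp
  show "integral\<^sup>L (lebesgue_on ((\<lambda>x. Q *v x) ` D)) (\<lambda>y. h (T y) * y $ i) = (Q *v integral\<^sup>L (lebesgue_on D) (\<lambda>x. h x *\<^sub>R x)) $ i"
    using integral_bounded_linear[OF bounded_linear_vec_nth[of i] 1] by (simp add: 2)
qed

text \<open>The torque is \<open>- g\<close> times the second component of the rotated total moment.
  The displayed formula agrees with the centre of mass in the first component by definition and in
  the third because \<open>origin\<close> removes the body's contribution, which the rotation about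
  \<open>e3\<close> leaves unchanged. What remains is the vanishing second component; membership in
  the span then follows from the formula.\<close>

lemma torque_iff_center_of_mass:
  defines "\<C>eq \<equiv> (\<lambda>x. Q *v x) ` C" and "\<B>eq \<equiv> (\<lambda>x. Q *v x) ` B"
    and "rB \<equiv> \<lambda>y. \<rho>B (transpose Q *v y)"
  defines "yC \<equiv> center_of_mass \<C>eq \<B>eq (\<lambda>y. rs (y $ 1)) rB (M + m)"
  shows "e3 \<bullet> cross3 (integral\<^sup>L (lebesgue_on (B \<union> C)) (\<lambda>x. total_density C \<rho> \<rho>B x *\<^sub>R x)) (g *\<^sub>R down \<theta>) = 0 \<longleftrightarrow>
    yC \<in> span {e1, e3} \<and>
    yC = (1 / (M + m)) *\<^sub>R
           ((integral\<^sup>L (lebesgue_on \<C>eq) (\<lambda>y. rs (y $ 1) * y $ 1)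
             + integral\<^sup>L (lebesgue_on \<B>eq) (\<lambda>y. rB y * y $ 1)) *\<^sub>R e1
            + integral\<^sup>L (lebesgue_on \<C>eq) (\<lambda>y. rs (y $ 1) * y $ 3) *\<^sub>R e3)"
proof -
  define Xf where "Xf = integral\<^sup>L (lebesgue_on C) (\<lambda>x. rs (down \<theta> \<bullet> x) *\<^sub>R x)"
  define Xb where "Xb = integral\<^sup>L (lebesgue_on B) (\<lambda>x. \<rho>B x *\<^sub>R x)"
  have dT: "down \<theta> \<bullet> (transpose Q *v y) = y $ 1" for y
    by (simp only: rot_e3_down[symmetric] rot_e3_inverse)
  have f: "integral\<^sup>L (lebesgue_on \<C>eq) (\<lambda>y. rs (y $ 1) *\<^sub>R y) = Q *v Xf"
    "integral\<^sup>L (lebesgue_on \<C>eq) (\<lambda>y. rs (y $ 1) * y $ i) = (Q *v Xf) $ i" for i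
    using rotated_moment(2,3)[OF meas(1) fluid_moment(1)] unfolding \<C>eq_def Xf_def dT by simp_all
  have b: "integral\<^sup>L (lebesgue_on \<B>eq) (\<lambda>y. rB y *\<^sub>R y) = Q *v Xb"
    "integral\<^sup>L (lebesgue_on \<B>eq) (\<lambda>y. rB y * y $ i) = (Q *v Xb) $ i" for i
    using rotated_moment(2,3)[OF meas(2) body_moment] unfolding \<B>eq_def rB_def Xb_def by simp_all
  have "Xb $ 3 = 0"
    using integral_bounded_linear[OF bounded_linear_vec_nth[of 3] body_moment] origin by (simp add: Xb_def)
  then have Xb3: "(Q *v Xb) $ 3 = 0" by (simp add: rot_e3_nth)
  define Y where "Y = Q *v Xf + Q *v Xb"
  have yC: "yC = (1 / (M + m)) *\<^sub>R Y"
    unfolding yC_def center_of_mass_def f b Y_def ..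
  have formula: "(1 / (M + m)) *\<^sub>R Y = (1 / (M + m)) *\<^sub>R
      (((Q *v Xf) $ 1 + (Q *v Xb) $ 1) *\<^sub>R e1 + (Q *v Xf) $ 3 *\<^sub>R e3) \<longleftrightarrow> Y $ 2 = 0"
  proof -
    have eq: "(1 / (M + m)) *\<^sub>R Y = (1 / (M + m)) *\<^sub>R Z \<longleftrightarrow> Y = Z" for Z using mass by simp
    show ?thesis
      unfolding eq using Xb3 by (simp add: vec_eq_iff forall_3 Y_def e1_def e3_def axis_def)
  qed
  have span: "(1 / (M + m)) *\<^sub>R (x *\<^sub>R e1 + z *\<^sub>R e3) \<in> span {e1, e3}" for x z
    by (intro span_scale span_add span_base) auto
  have "e3 \<bullet> cross3 (integral\<^sup>L (lebesgue_on (B \<union> C)) (\<lambda>x. total_density C \<rho> \<rho>B x *\<^sub>R x)) (g *\<^sub>R down \<theta>) =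
      - g * Y $ 2"
    unfolding total_moment torque_down Y_def Xf_def Xb_def by (simp add: matrix_vector_right_distrib)
  then show ?thesis
    unfolding yC f b using formula span g by auto
qed

end

subsection \<open>Rest states\<close>

lemma rest_mass_rotated:
  fixes C :: "(real^3) set"
  assumes C: "C \<in> sets lebesgue" and \<gamma>: "\<gamma> > 1"
  shows "integral\<^sup>L (lebesgue_on ((\<lambda>x. rot_e3 \<theta> *v x) ` C)) (\<lambda>y. rest_density g a \<gamma> c (y $ 1)) =
    integral\<^sup>L (lebesgue_on C) (\<lambda>x. rest_density g a \<gamma> c (down \<theta> \<bullet> x))"
proof -
  have "(\<lambda>x. rest_density g a \<gamma> c (down \<theta> \<bullet> x)) \<in> borel_measurable (lebesgue_on C)"
    by (intro measurable_restrict_space1 continuous_borel_measurable_lebesgue continuous_rest_density_inner[OF \<gamma>])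
  from lebesgue_on_orthogonal(2)[OF orthogonal_transpose_rot_e3[of \<theta>] C this]
  show ?thesis
    by (simp only: rot_e3_image rot_e3_down[symmetric] rot_e3_inverse)
qed

lemma renormalized_weak_solution_at_rest:
  fixes C B :: "(real^3) set"
  assumes C: "open C" "bounded C" and \<gamma>: "\<gamma> > 1" and a: "a > 0" and g: "g > 0"
    and v: "AE x in lebesgue_on C. v x = 0"
    and \<rho>: "AE x in lebesgue_on C. \<rho> x = rest_density g a \<gamma> c (down \<theta> \<bullet> x)"
    and M: "integral\<^sup>L (lebesgue_on C) (\<lambda>x. rest_density g a \<gamma> c (down \<theta> \<bullet> x)) = M"
    and torque: "e3 \<bullet> cross3 (integral\<^sup>L (lebesgue_on (B \<union> C)) (\<lambda>x. total_density C \<rho> \<rho>B x *\<^sub>R x)) (g *\<^sub>R down \<theta>) = 0"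
  shows "renormalized_weak_solution C B \<rho>B g a \<gamma> \<mu> lam M \<rho> v 0 (g *\<^sub>R down \<theta>)"
proof -
  let ?r = "\<lambda>x. rest_density g a \<gamma> c (down \<theta> \<bullet> x)"
  let ?P = "\<lambda>x. a * ?r x powr \<gamma>"
  have C': "C \<in> sets lebesgue" using C by simp
  have r_cont: "continuous_on UNIV ?r" by (rule continuous_rest_density_inner[OF \<gamma>])
  have P: "Ck (Suc 0) ?P" "partial_deriv j ?P = (\<lambda>x. ?r x * (g *\<^sub>R down \<theta>) $ j)" for j
    by (rule rest_pressure_gradient[OF a \<gamma>])+
  have r_int: "integrable (lebesgue_on C) ?r"
    by (rule integrable_continuous_bounded_set[OF C(2) C' r_cont])
  have \<rho>m: "\<rho> \<in> borel_measurable (lebesgue_on C)"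
    by (rule borel_measurable_AE_eq[OF complete_measure_lebesgue_on[OF C'] borel_measurable_integrable[OF r_int] \<rho>])
  have "in_Lp \<gamma> C \<rho>"
    unfolding in_Lp_def
  proof
    \<comment> \<open>The density to the power \<gamma> is taken as pressure over \<open>a\<close>,
      whose continuity is already known.\<close>
    have "continuous_on UNIV (\<lambda>x. (1 / a) * ?P x)"
      by (intro continuous_on_mult continuous_on_const Ck_continuous[OF P(1)])
    then have i: "integrable (lebesgue_on C) (\<lambda>x. (1 / a) * ?P x)"
      by (rule integrable_continuous_bounded_set[OF C(2) C'])
    have ae: "AE x in lebesgue_on C. \<bar>\<rho> x\<bar> powr \<gamma> = (1 / a) * ?P x"
      using \<rho> by eventually_elim (use a in \<open>simp add: rest_density_nonneg\<close>)
    have m: "(\<lambda>x. \<bar>\<rho> x\<bar> powr \<gamma>) \<in> borel_measurable (lebesgue_on C)"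
      using \<rho>m by measurable
    show "integrable (lebesgue_on C) (\<lambda>x. \<bar>\<rho> x\<bar> powr \<gamma>)"
      using integrable_cong_AE[OF m borel_measurable_integrable[OF i] ae] i by blast
  qed (rule \<rho>m)
  moreover have "AE x in lebesgue_on C. 0 \<le> \<rho> x"
    using \<rho> by eventually_elim (simp add: rest_density_nonneg)
  moreover have "in_W12_0 C (\<lambda>x. v x $ i)" for i
    by (rule in_W12_0_zero_AE[OF C(1)]) (use v in eventually_elim, simp)
  moreover have "(g *\<^sub>R down \<theta>) $ 3 = 0" by (simp add: down_def vector_3)
  moreover have "momentum_equation C a \<gamma> \<mu> lam \<rho> v 0 (g *\<^sub>R down \<theta>)"
    unfolding momentum_equation_at_rest[OF C(1) v]
  proof (intro allI conjI impI)
    fix j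
    have ae_p: "AE x in lebesgue_on C. pressure a \<gamma> (\<rho> x) = ?P x"
      using \<rho> by eventually_elim (simp add: pressure_def)
    have ae_f: "AE x in lebesgue_on C. \<rho> x * (g *\<^sub>R down \<theta>) $ j = ?r x * (g *\<^sub>R down \<theta>) $ j"
      using \<rho> by eventually_elim simp
    have li: "locally_integrable C ?P" "locally_integrable C (\<lambda>x. ?r x * (g *\<^sub>R down \<theta>) $ j)"
      by (rule locally_integrable_continuous, rule Ck_continuous[OF P(1)],
          rule locally_integrable_continuous, intro continuous_on_mult continuous_on_const r_cont)
    show lip: "locally_integrable C (\<lambda>x. pressure a \<gamma> (\<rho> x))"
      by (rule locally_integrable_cong_AE[OF C' li(1) ae_p])
    show lif: "locally_integrable C (\<lambda>x. \<rho> x * (g *\<^sub>R down \<theta>) $ j)"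
      by (rule locally_integrable_cong_AE[OF C' li(2) ae_f])
    fix \<phi> assume \<phi>: "test_function C \<phi>"
    have m: "\<phi> \<in> borel_measurable (lebesgue_on C)" "partial_deriv j \<phi> \<in> borel_measurable (lebesgue_on C)"
      using square_integrable_test_function[OF C' \<phi>] square_integrable_test_function[OF C' test_function_partial_deriv[OF \<phi>]]
      by (simp_all add: square_integrable_def)
    note lm = locally_integrable_measurable[OF C(1)]
    have "distr_deriv j (regular_distr C (\<lambda>x. pressure a \<gamma> (\<rho> x))) \<phi> = distr_deriv j (regular_distr C ?P) \<phi>"
      unfolding distr_deriv_def regular_distr_cong_AE[OF ae_p lm[OF lip] lm[OF li(1)] m(2)] ..
    also have "\<dots> = regular_distr C (partial_deriv j ?P) \<phi>"
      using has_weak_partial_C1[OF C(1) P(1), of j] \<phi> by (simp add: has_weak_partial_def)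
    also have "\<dots> = regular_distr C (\<lambda>x. \<rho> x * (g *\<^sub>R down \<theta>) $ j) \<phi>"
      unfolding P(2) using regular_distr_cong_AE[OF ae_f lm[OF lif] lm[OF li(2)] m(1)] by simp
    finally show "distr_deriv j (regular_distr C (\<lambda>x. pressure a \<gamma> (\<rho> x))) \<phi> =
        regular_distr C (\<lambda>x. \<rho> x * (g *\<^sub>R down \<theta>) $ j) \<phi>" .
  qed
  moreover have "continuity_equation C \<rho> v"
  proof -
    have ae: "AE x in lebesgue_on C. \<rho> x *\<^sub>R v x = 0" using v by eventually_elim simp
    show ?thesis
      unfolding continuity_equation_def
      using locally_integrable_cong_AE[OF C' locally_integrable_zero ae] distr_div_zero_AE[OF ae] by blast
  qed
  moreover have "renormalized_continuity C \<rho> v"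
    unfolding renormalized_continuity_def Let_def
  proof (intro allI impI)
    fix b :: "real \<Rightarrow> real" and \<phi>
    have "AE x in lebesgue_on C. b (\<rho> x) *\<^sub>R v x = 0"
      using v by eventually_elim simp
    moreover have "AE x in lebesgue_on C. (\<rho> x * deriv b (\<rho> x) - b (\<rho> x)) * weak_div C v x = 0"
      using weak_grad_zero_AE[OF C(1) v] by eventually_elim (simp add: weak_div_def trace_def)
    ultimately show "distr_div C (\<lambda>x. b (\<rho> x) *\<^sub>R v x) \<phi> +
        regular_distr C (\<lambda>x. (\<rho> x * deriv b (\<rho> x) - b (\<rho> x)) * weak_div C v x) \<phi> = 0"
      by (simp add: distr_div_zero_AE regular_distr_zero_AE)
  qed
  moreover have "integral\<^sup>L (lebesgue_on C) \<rho> = M"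
    using integral_cong_AE[OF \<rho>m borel_measurable_integrable[OF r_int] \<rho>] M by simp
  moreover have "norm (g *\<^sub>R down \<theta>) = g" using g by (simp add: norm_down)
  moreover have "integral\<^sup>L (lebesgue_on C) (\<lambda>x. stress \<mu> lam C v x \<bullet> weak_grad C v x) = 0"
    by (rule integral_eq_zero_AE) (use weak_grad_zero_AE[OF C(1) v] in eventually_elim, simp)
  ultimately show ?thesis
    unfolding renormalized_weak_solution_def using torque by simp
qed

lemma renormalized_weak_solution_imp_rest:
  fixes C B :: "(real^3) set"
  assumes C: "open C" "bounded C" "convex C" and \<gamma>: "\<gamma> > 1" and a: "a > 0" and g: "g > 0"
    and \<mu>: "\<mu> > 0" and lam: "lam \<ge> 0"
    and sol: "renormalized_weak_solution C B \<rho>B g a \<gamma> \<mu> lam M \<rho> v \<omega> gv"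
  obtains \<theta> c where "0 \<le> \<theta>" "\<theta> < 2 * pi" "gv = g *\<^sub>R down \<theta>" "\<omega> = 0"
    "AE x in lebesgue_on C. v x = 0"
    "AE x in lebesgue_on C. \<rho> x = rest_density g a \<gamma> c (down \<theta> \<bullet> x)"
    "integral\<^sup>L (lebesgue_on C) (\<lambda>x. rest_density g a \<gamma> c (down \<theta> \<bullet> x)) = M"
    "e3 \<bullet> cross3 (integral\<^sup>L (lebesgue_on (B \<union> C)) (\<lambda>x. total_density C \<rho> \<rho>B x *\<^sub>R x)) (g *\<^sub>R down \<theta>) = 0"
proof -
  have C': "C \<in> sets lebesgue" using C by simp
  have Lp: "in_Lp \<gamma> C \<rho>" and nonneg: "AE x in lebesgue_on C. 0 \<le> \<rho> x"
    and W: "\<And>i. in_W12_0 C (\<lambda>x. v x $ i)" and gv3: "gv $ 3 = 0"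
    and mom: "momentum_equation C a \<gamma> \<mu> lam \<rho> v \<omega> gv"
    and torque: "e3 \<bullet> cross3 (integral\<^sup>L (lebesgue_on (B \<union> C)) (\<lambda>x. total_density C \<rho> \<rho>B x *\<^sub>R x)) gv = 0"
    and spin: "\<omega> *\<^sub>R cross3 e3 gv = 0"
    and M: "integral\<^sup>L (lebesgue_on C) \<rho> = M" and ngv: "norm gv = g"
    and diss: "integral\<^sup>L (lebesgue_on C) (\<lambda>x. stress \<mu> lam C v x \<bullet> weak_grad C v x) \<le> 0"
    using sol unfolding renormalized_weak_solution_def by simp_all
  \<comment> \<open>The angle is read off the gravity vector, which \<open>spin\<close> then needs
    in nonzero horizontal form to force \<open>\<omega> = 0\<close>.\<close>
  obtain \<theta> where \<theta>: "0 \<le> \<theta>" "\<theta> < 2 * pi" "gv = g *\<^sub>R down \<theta>"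
    using horizontal_axis_gravity[OF gv3 ngv g] by blast
  have \<omega>: "\<omega> = 0" using spin g unfolding \<theta>(3) by (rule cross3_e3_down_eq_0)
  have v: "AE x in lebesgue_on C. v x = 0"
    by (rule zero_dissipation_imp_zero[OF C(1,2) W \<mu> lam diss])
  have "\<exists>c. AE x in lebesgue_on C. \<rho> x = rest_density g a \<gamma> c (down \<theta> \<bullet> x)"
  proof (rule hydrostatic_density_distr[OF C(1,3,2) norm_down g a \<gamma> Lp nonneg])
    show "distr_deriv j (regular_distr C (\<lambda>x. a * \<rho> x powr \<gamma>)) \<phi> = regular_distr C (\<lambda>x. \<rho> x * (g *\<^sub>R down \<theta>) $ j) \<phi>"
      if "test_function C \<phi>" for \<phi> j
      using mom that unfolding \<omega> \<theta>(3) momentum_equation_at_rest[OF C(1) v] pressure_def by blast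
  qed
  then obtain c where c: "AE x in lebesgue_on C. \<rho> x = rest_density g a \<gamma> c (down \<theta> \<bullet> x)" by blast
  have r_int: "integrable (lebesgue_on C) (\<lambda>x. rest_density g a \<gamma> c (down \<theta> \<bullet> x))"
    by (rule integrable_continuous_bounded_set[OF C(2) C' continuous_rest_density_inner[OF \<gamma>]])
  have "\<rho> \<in> borel_measurable (lebesgue_on C)" using Lp by (simp add: in_Lp_def)
  from integral_cong_AE[OF this borel_measurable_integrable[OF r_int] c]
  have "integral\<^sup>L (lebesgue_on C) (\<lambda>x. rest_density g a \<gamma> c (down \<theta> \<bullet> x)) = M"
    using M by simp
  with \<theta> \<omega> v c torque show thesis
    by (intro that[of \<theta> c]) simp_all
qed

theorem theorem3p1:
  fixes \<C>\<^sub>0 \<B>\<^sub>0 :: "(real^3) set"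
    and \<rho>\<^sub>B :: "real^3 \<Rightarrow> real"
    and m M g a \<gamma> \<mu> lam :: real
    and \<rho>\<^sub>s :: "real^3 \<Rightarrow> real" and v\<^sub>s :: "real^3 \<Rightarrow> real^3"
    and \<omega>\<^sub>s :: real and g\<^sub>s :: "real^3"
  assumes cavity: "open \<C>\<^sub>0" "\<C>\<^sub>0 \<noteq> {}" "simply_connected \<C>\<^sub>0"
    and body: "frontier \<C>\<^sub>0 \<subseteq> \<B>\<^sub>0" "\<C>\<^sub>0 \<inter> \<B>\<^sub>0 = {}"
    and whole: "bounded (\<B>\<^sub>0 \<union> \<C>\<^sub>0)" "simply_connected (\<B>\<^sub>0 \<union> \<C>\<^sub>0)" "open (\<B>\<^sub>0 \<union> \<C>\<^sub>0)"
    and body_density: "AE x in lebesgue_on \<B>\<^sub>0. 0 \<le> \<rho>\<^sub>B x"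
    and body_mass: "has_bochner_integral (lebesgue_on \<B>\<^sub>0) \<rho>\<^sub>B m"
    and origin: "integral\<^sup>L (lebesgue_on \<B>\<^sub>0) (\<lambda>x. \<rho>\<^sub>B x * x $ 3) = 0"
    and constants: "g > 0" "a > 0" "\<gamma> > 3 / 2" "\<mu> > 0" "lam \<ge> 0" "M > 0"
    and convex: "convex \<C>\<^sub>0"
  shows "renormalized_weak_solution \<C>\<^sub>0 \<B>\<^sub>0 \<rho>\<^sub>B g a \<gamma> \<mu> lam M \<rho>\<^sub>s v\<^sub>s \<omega>\<^sub>s g\<^sub>s \<longleftrightarrow>
    (\<exists>\<theta>\<^sub>0 c. 0 \<le> \<theta>\<^sub>0 \<and> \<theta>\<^sub>0 < 2 * pi \<and>
      (let Q\<^sub>0 = rot_e3 \<theta>\<^sub>0;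
           \<C>eq = (\<lambda>x. Q\<^sub>0 *v x) ` \<C>\<^sub>0;
           \<B>eq = (\<lambda>x. Q\<^sub>0 *v x) ` \<B>\<^sub>0;
           r\<^sub>s = rest_density g a \<gamma> c;
           r\<^sub>B = (\<lambda>y. \<rho>\<^sub>B (transpose Q\<^sub>0 *v y));
           y\<^sub>C = center_of_mass \<C>eq \<B>eq (\<lambda>y. r\<^sub>s (y $ 1)) r\<^sub>B (M + m)
       in
         \<comment> \<open>(i)\<close>
         \<omega>\<^sub>s = 0 \<and> (AE x in lebesgue_on \<C>\<^sub>0. full_velocity v\<^sub>s \<omega>\<^sub>s x = 0) \<and>
         \<comment> \<open>(ii)\<close>
         (AE x in lebesgue_on \<C>\<^sub>0. \<rho>\<^sub>s x = r\<^sub>s ((Q\<^sub>0 *v x) $ 1)) \<and>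
         Q\<^sub>0 *v g\<^sub>s = g *\<^sub>R e1 \<and>
         (\<forall>c'. integral\<^sup>L (lebesgue_on \<C>eq) (\<lambda>y. rest_density g a \<gamma> c' (y $ 1)) = M \<longleftrightarrow> c' = c) \<and>
         \<comment> \<open>(iii)\<close>
         y\<^sub>C \<in> span {e1, e3} \<and>
         y\<^sub>C = (1 / (M + m)) *\<^sub>R
           ((integral\<^sup>L (lebesgue_on \<C>eq) (\<lambda>y. r\<^sub>s (y $ 1) * y $ 1)
             + integral\<^sup>L (lebesgue_on \<B>eq) (\<lambda>y. r\<^sub>B y * y $ 1)) *\<^sub>R e1
            + integral\<^sup>L (lebesgue_on \<C>eq) (\<lambda>y. r\<^sub>s (y $ 1) * y $ 3) *\<^sub>R e3)))"
proof -
  have \<gamma>: "\<gamma> > 1" using constants(3) by simp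
  have bounded: "bounded \<C>\<^sub>0" using whole(1) by simp
  have meas: "\<C>\<^sub>0 \<in> sets lebesgue" using cavity(1) by simp
  \<comment> \<open>A nonnegative body density makes the total mass positive, so the factor
    \<open>1 / (M + m)\<close> can be cancelled in the centre of mass.\<close>
  have "0 \<le> m"
    using body_mass body_density integral_nonneg_AE[of "\<rho>\<^sub>B" "lebesgue_on \<B>\<^sub>0"] by (auto simp: has_bochner_integral_iff)
  then have mass: "M + m > 0" using constants(6) by simp
  note torque_iff = torque_iff_center_of_mass[OF cavity(1) body(2) whole(1,3) body_mass origin \<gamma> constants(1) mass]
  show ?thesis (is "?lhs \<longleftrightarrow> ?rhs")
  proof
    assume "renormalized_weak_solution \<C>\<^sub>0 \<B>\<^sub>0 \<rho>\<^sub>B g a \<gamma> \<mu> lam M \<rho>\<^sub>s v\<^sub>s \<omega>\<^sub>s g\<^sub>s"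
    then obtain \<theta> c where \<theta>: "0 \<le> \<theta>" "\<theta> < 2 * pi" and gv: "g\<^sub>s = g *\<^sub>R down \<theta>" and \<omega>: "\<omega>\<^sub>s = 0"
      and v: "AE x in lebesgue_on \<C>\<^sub>0. v\<^sub>s x = 0"
      and \<rho>: "AE x in lebesgue_on \<C>\<^sub>0. \<rho>\<^sub>s x = rest_density g a \<gamma> c (down \<theta> \<bullet> x)"
      and M: "integral\<^sup>L (lebesgue_on \<C>\<^sub>0) (\<lambda>x. rest_density g a \<gamma> c (down \<theta> \<bullet> x)) = M"
      and torque: "e3 \<bullet> cross3 (integral\<^sup>L (lebesgue_on (\<B>\<^sub>0 \<union> \<C>\<^sub>0)) (\<lambda>x. total_density \<C>\<^sub>0 \<rho>\<^sub>s \<rho>\<^sub>B x *\<^sub>R x)) (g *\<^sub>R down \<theta>) = 0"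
      by (rule renormalized_weak_solution_imp_rest[OF cavity(1) bounded convex \<gamma> constants(2,1,4,5)])
    have \<rho>': "AE x in lebesgue_on \<C>\<^sub>0. \<rho>\<^sub>s x = rest_density g a \<gamma> c ((rot_e3 \<theta> *v x) $ 1)"
      using \<rho> by (simp only: rot_e3_down)
    note center = torque_iff[OF \<rho>', THEN iffD1, OF torque]
    show "?rhs"
      unfolding Let_def
    proof (rule exI[of _ \<theta>], rule exI[of _ c], intro conjI)
      show "AE x in lebesgue_on \<C>\<^sub>0. full_velocity v\<^sub>s \<omega>\<^sub>s x = 0"
        using v unfolding \<omega> full_velocity_zero .
      show "rot_e3 \<theta> *v g\<^sub>s = g *\<^sub>R e1"
        unfolding rot_e3_gravity by (rule gv)
      \<comment> \<open>At \<open>c' = c\<close> this is the mass condition; for other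
        \<open>c'\<close> it says that the mass determines the constant.\<close>
      show "\<forall>c'. integral\<^sup>L (lebesgue_on ((\<lambda>x. rot_e3 \<theta> *v x) ` \<C>\<^sub>0)) (\<lambda>y. rest_density g a \<gamma> c' (y $ 1)) = M \<longleftrightarrow> c' = c"
        unfolding rest_mass_rotated[OF meas \<gamma>]
        using rest_density_mass_unique[OF bounded meas \<gamma> constants(6) M] by blast
    qed (fact \<theta> \<omega> \<rho>' center[THEN conjunct1] center[THEN conjunct2])+
  next
    assume "?rhs"
    then obtain \<theta> c where \<omega>: "\<omega>\<^sub>s = 0" and v: "AE x in lebesgue_on \<C>\<^sub>0. full_velocity v\<^sub>s \<omega>\<^sub>s x = 0"
      and \<rho>: "AE x in lebesgue_on \<C>\<^sub>0. \<rho>\<^sub>s x = rest_density g a \<gamma> c ((rot_e3 \<theta> *v x) $ 1)"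
      and gv: "rot_e3 \<theta> *v g\<^sub>s = g *\<^sub>R e1"
      and c: "\<forall>c'. integral\<^sup>L (lebesgue_on ((\<lambda>x. rot_e3 \<theta> *v x) ` \<C>\<^sub>0)) (\<lambda>y. rest_density g a \<gamma> c' (y $ 1)) = M \<longleftrightarrow> c' = c"
      and center: "center_of_mass ((\<lambda>x. rot_e3 \<theta> *v x) ` \<C>\<^sub>0) ((\<lambda>x. rot_e3 \<theta> *v x) ` \<B>\<^sub>0) (\<lambda>y. rest_density g a \<gamma> c (y $ 1))
           (\<lambda>y. \<rho>\<^sub>B (transpose (rot_e3 \<theta>) *v y)) (M + m) \<in> span {e1, e3}"
        "center_of_mass ((\<lambda>x. rot_e3 \<theta> *v x) ` \<C>\<^sub>0) ((\<lambda>x. rot_e3 \<theta> *v x) ` \<B>\<^sub>0) (\<lambda>y. rest_density g a \<gamma> c (y $ 1))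
           (\<lambda>y. \<rho>\<^sub>B (transpose (rot_e3 \<theta>) *v y)) (M + m) = (1 / (M + m)) *\<^sub>R
           ((integral\<^sup>L (lebesgue_on ((\<lambda>x. rot_e3 \<theta> *v x) ` \<C>\<^sub>0)) (\<lambda>y. rest_density g a \<gamma> c (y $ 1) * y $ 1)
             + integral\<^sup>L (lebesgue_on ((\<lambda>x. rot_e3 \<theta> *v x) ` \<B>\<^sub>0)) (\<lambda>y. \<rho>\<^sub>B (transpose (rot_e3 \<theta>) *v y) * y $ 1)) *\<^sub>R e1
            + integral\<^sup>L (lebesgue_on ((\<lambda>x. rot_e3 \<theta> *v x) ` \<C>\<^sub>0)) (\<lambda>y. rest_density g a \<gamma> c (y $ 1) * y $ 3) *\<^sub>R e3)"
      unfolding Let_def by (elim exE conjE)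
    have torque: "e3 \<bullet> cross3 (integral\<^sup>L (lebesgue_on (\<B>\<^sub>0 \<union> \<C>\<^sub>0)) (\<lambda>x. total_density \<C>\<^sub>0 \<rho>\<^sub>s \<rho>\<^sub>B x *\<^sub>R x)) (g *\<^sub>R down \<theta>) = 0"
      by (rule torque_iff[OF \<rho>, THEN iffD2, OF conjI[OF center]])
    have "integral\<^sup>L (lebesgue_on \<C>\<^sub>0) (\<lambda>x. rest_density g a \<gamma> c (down \<theta> \<bullet> x)) = M"
      using c unfolding rest_mass_rotated[OF meas \<gamma>] by blast
    moreover have "AE x in lebesgue_on \<C>\<^sub>0. v\<^sub>s x = 0"
      using v unfolding \<omega> full_velocity_zero .
    moreover have "AE x in lebesgue_on \<C>\<^sub>0. \<rho>\<^sub>s x = rest_density g a \<gamma> c (down \<theta> \<bullet> x)"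
      using \<rho> by (simp only: rot_e3_down)
    ultimately have "renormalized_weak_solution \<C>\<^sub>0 \<B>\<^sub>0 \<rho>\<^sub>B g a \<gamma> \<mu> lam M \<rho>\<^sub>s v\<^sub>s 0 (g *\<^sub>R down \<theta>)"
      using torque by (intro renormalized_weak_solution_at_rest[OF cavity(1) bounded \<gamma> constants(2,1)])
    then show "renormalized_weak_solution \<C>\<^sub>0 \<B>\<^sub>0 \<rho>\<^sub>B g a \<gamma> \<mu> lam M \<rho>\<^sub>s v\<^sub>s \<omega>\<^sub>s g\<^sub>s"
      using gv unfolding \<omega> rot_e3_gravity by simp
  qed
qed

end
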